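(* Let $n\ge3$, $s\ge1$, and consider the $\imath$quantum group $\mathbf U^\imath$ of type A.1 (affine type $A^{(1)}_{n-1}$, $\tau=\mathrm{id}$, $B_i=F_i+q^{-1}E_iK_i^{-1}$). The map $$\mathcal K:\mathcal B_s(x)\to\mathcal B_s^\vee(x^{-1}),\qquad x^db_\alpha\mapsto x^{d+I(\alpha)}b^\vee_{\alpha'},$$ $$I(\alpha)=2\left\lfloor\tfrac{\alpha_1}2\right\rfloor=\alpha_1-\theta(\alpha_1),\qquad \alpha'_i=\alpha_{i+1}+\theta(\alpha_i)-\theta(\alpha_{i+1})\quad(i\in\mathbb Z/n\mathbb Z),$$ where $\theta(m)=1$ if $m$ is odd and $0$ if $m$ is even, is the combinatorial $K$-matrix on $\mathcal B_s$.
   Context: Type A setting. $I=\mathbb Z/n\mathbb Z$; $\mathbf U$ is the quantum affine algebra of type $A^{(1)}_{n-1}$ over $\mathbb C(q)$ with Chevalley generators $E_i,F_i,K_i^{\pm1}$ and coproduct $\Delta(E_i)=E_i\otimes1+K_i\otimes E_i$, $\Delta(F_i)=F_i\otimes K_i^{-1}+1\otimes F_i$, $\Delta(K_i)=K_i\otimes K_i$. For $\alpha=(\alpha_1,\dots,\alpha_n)\in\mathbb Z_{\ge0}^n$ with $\sum\alpha_i=s$, indices mod $n$, $\mathbf e_i$ standard basis vectors, $[m]=\frac{q^m-q^{-m}}{q-q^{-1}}$: the KR module $\mathcal W_s$ has basis $v_\alpha$ with $E_iv_\alpha=[\alpha_i+1]v_{\alpha+\mathbf e_i-\mathbf e_{i+1}}$,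 $F_iv_\alpha=[\alpha_{i+1}+1]v_{\alpha-\mathbf e_i+\mathbf e_{i+1}}$, $K_iv_\alpha=q^{\alpha_i-\alpha_{i+1}}v_\alpha$; the dual KR module $\mathcal W_s^\vee$ has basis $v_\alpha^\vee$ with $E_iv_\alpha^\vee=[\alpha_{i+1}+1]v^\vee_{\alpha-\mathbf e_i+\mathbf e_{i+1}}$, $F_iv_\alpha^\vee=[\alpha_i+1]v^\vee_{\alpha+\mathbf e_i-\mathbf e_{i+1}}$, $K_iv_\alpha^\vee=q^{-\alpha_i+\alpha_{i+1}}v_\alpha^\vee$ (vectors with a negative index entry are $0$). Write $\mathcal W=\mathcal W_1$ (basis $v_j=v_{\mathbf e_j}$) and $\mathcal W^\vee=\mathcal W_1^\vee$ (basis $v_j^\vee$). $U(x)$ is $U$ (scalars extended to $\mathbb C(q,x)$) with $E_0,F_0$ acting as $xE_0,x^{-1}F_0$. $\mathcal W_s(x)$ is embedded in $\mathcal W(q^{1-s}x)\otimes\mathcal W(q^{3-s}x)\otimes\cdots\otimes\mathcal W(q^{s-1}x)$ by $v_\alpha=\sum_{\mathbf i}q^{-\#\{p<p':\,i_p>i_{p'}\}}v_{i_1}\otimes\cdots\otimes v_{i_s}$, sum over $\mathbf i\in\{1,\dots,n\}^s$ containing each $i$ exactly $\alpha_i$ times; similarly $v^\vee_\alpha=\sum_{\mathbf i}q^{-\#\{p<p':\,i_p<i_{p'}\}}v^\vee_{i_1}\otimes\cdots\otimes v^\vee_{i_s}$ for $\mathcal W_s^\vee$. Quantum $K$-matrix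 (twisted type). $\mathbf U^\imath\subset\mathbf U$ is generated by $B_i=F_i+q^{-1}E_iK_i^{-1}$, $i\in I$. $K_{\mathcal W}(x):\mathcal W(x)\to\mathcal W^\vee(x^{-1})$ is the $\mathbf U^\imath$-linear map $v_j\mapsto v_j^\vee$. $R_{\mathcal W^\vee,\mathcal W}(u,v):\mathcal W^\vee(u)\otimes\mathcal W(v)\to\mathcal W(v)\otimes\mathcal W^\vee(u)$ is the $\mathbf U$-linear isomorphism (for generic $u/v$), unique up to scalar. $K_{\mathcal W_s}(x):\mathcal W_s(x)\to\mathcal W_s^\vee(x^{-1})$ is the restriction to $\mathcal W_s(x)$ of $K^{(s)}(x)\cdots K^{(1)}(x)$, where $K^{(j)}(x)=K_1(q^{-s+2j-1}x)R_{1,2}(q^{s-2j+3}x^{-1},q^{-s+2j-1}x)R_{2,3}(q^{s-2j+5}x^{-1},q^{-s+2j-1}x)\cdots R_{j-1,j}(q^{s-1}x^{-1},q^{-s+2j-1}x)$, $K_1$ is $K_{\mathcal W}$ on the first component and $R_{i,i+1}$ is $R_{\mathcal W^\vee,\mathcal W}$ on components $i,i+1$. It is $\mathbf U^\imath$-linear. Combinatorial $K$-matrix. Let $\mathbf A_x=\mathbb C(q,x)\cap\mathbb C(x)[[q^{-1}]]$, and let $\mathcal L_s(x)$, $\mathcal L_s^\vee(x^{-1})$ be the $\mathbf A_x$-spans of the $v_\alpha$, resp. $v_\alpha^\vee$. Let $b_\alpha,b_\alpha^\vee$ be the classes of $v_\alpha,v_\alpha^\vee$ modulo $q^{-1}$,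 $\mathcal B_s(x)=\{x^db_\alpha\mid d\in\mathbb Z\}$, $\mathcal B_s^\vee(x^{-1})=\{x^db_\alpha^\vee\mid d\in\mathbb Z\}$. Rescale $K_{\mathcal W_s}(x)$ by a nonzero scalar in $\mathbb C(q,x)$ so that it maps $\mathcal L_s(x)$ into $\mathcal L_s^\vee(x^{-1})$ and the induced $\mathbb C(x)$-linear map $\bar K_{\mathcal W_s}(x)$ modulo $q^{-1}$ is nonzero. If (for a suitable such scalar) the restriction of $\bar K_{\mathcal W_s}(x)$ to $\mathcal B_s(x)$ is a bijection $\mathcal B_s(x)\to\mathcal B_s^\vee(x^{-1})$, this bijection is called the combinatorial $K$-matrix on $\mathcal B_s$; it is unique up to multiplication by a power of $x$. *)

theory Defs
  imports
    "HOL-Computational_Algebra.Fraction_Field"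
    "HOL-Computational_Algebra.Polynomial"
    "HOL-Computational_Algebra.Formal_Laurent_Series"
begin

section \<open>The base field and expansion at infinity\<close>

type_synonym Cx = "complex poly fract"

text \<open>\<open>\<complex>(q, x)\<close> is realised as \<open>\<complex>(x)(q)\<close>: the outer polynomial variable is \<open>q\<close>.\<close>

type_synonym Cqx = "Cx poly fract"

definition x0 :: Cx where "x0 = Fraction_Field.Fract [:0, 1:] 1"

definition xv :: Cqx where "xv = Fraction_Field.Fract [:x0:] 1"

definition qv :: Cqx where "qv = Fraction_Field.Fract [:0, 1:] 1"

definition qint :: "nat \<Rightarrow> Cqx" where
  "qint m = (qv ^ m - inverse qv ^ m) / (qv - inverse qv)"

text \<open>Elements of \<open>'a fls\<close> are read as Laurent series in \<open>q\<inverse>\<close>, so \<open>q\<close> itself becomes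
  \<^const>\<open>fls_X_inv\<close>.\<close>

definition poly_expand :: "'a::field poly \<Rightarrow> 'a fls" where
  "poly_expand p = poly (map_poly fls_const p) fls_X_inv"

lemma poly_expand_0 [simp]: "poly_expand 0 = 0"
  by (simp add: poly_expand_def)

lemma poly_expand_pCons: "poly_expand (pCons a p) = fls_const a + fls_X_inv * poly_expand p"
  by (simp add: poly_expand_def map_poly_pCons)

lemma poly_expand_add: "poly_expand (p + r) = poly_expand p + poly_expand r"
  by (induction p r rule: poly_induct2)
     (simp_all add: poly_expand_pCons algebra_simps flip: fls_plus_const)

lemma poly_expand_smult: "poly_expand (smult a p) = fls_const a * poly_expand p"
  by (induction p) (simp_all add: poly_expand_pCons algebra_simps flip: fls_const_mult_const)

lemma poly_expand_mult: "poly_expand (p * r) = poly_expand p * poly_expand r"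
  by (induction p) (simp_all add: poly_expand_pCons poly_expand_add poly_expand_smult algebra_simps)

lemma fls_nth_poly_expand:
  "fls_nth (poly_expand p) k = (if k \<le> 0 then coeff p (nat (- k)) else 0)"
proof (induction p arbitrary: k)
  case 0
  then show ?case by simp
next
  case (pCons a p)
  show ?case
  proof (cases "k < 0")
    case True
    then have "nat (- k) = Suc (nat (- (k + 1)))" by simp
    then show ?thesis
      using pCons.IH[of "k + 1"] True
      by (simp add: poly_expand_pCons fls_X_inv_times_conv_shift)
  next
    case False
    then show ?thesis
      using pCons.IH[of "k + 1"]
      by (simp add: poly_expand_pCons fls_X_inv_times_conv_shift)
  qed
qed

lemma poly_expand_eq_0_iff [simp]: "poly_expand p = 0 \<longleftrightarrow> p = 0"
proof
  assume *: "poly_expand p = 0"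
  show "p = 0"
  proof (rule poly_eqI)
    show "coeff p k = coeff 0 k" for k
      using fls_nth_poly_expand[of p "- int k"] * by simp
  qed
qed simp

lift_definition expand :: "'a::field poly fract \<Rightarrow> 'a fls" is
  "\<lambda>(a, b). poly_expand a / poly_expand b"
  by (auto simp: fractrel_def frac_eq_eq simp flip: poly_expand_mult)

lemma expand_Fract: "b \<noteq> 0 \<Longrightarrow> expand (Fraction_Field.Fract a b) = poly_expand a / poly_expand b"
  by transfer simp


definition Ax :: "Cqx set" where "Ax = {f. expand f \<in> range fps_to_fls}"

text \<open>The residue map \<open>A\<^sub>x \<rightarrow> A\<^sub>x / q\<inverse> A\<^sub>x = \<complex>(x)\<close>.\<close>

definition residue :: "Cqx \<Rightarrow> Cx" where "residue f = fls_nth (expand f) 0"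

section \<open>Based vector spaces\<close>

text \<open>A vector in a space with basis \<open>B\<close> is its coordinate function, vanishing outside \<open>B\<close>.
  A linear map is given by the images of the basis vectors and applied to vectors by
  \<open>lin\<close>.\<close>

type_synonym 'b vec = "'b \<Rightarrow> Cqx"

definition vspace :: "'b set \<Rightarrow> 'b vec set" where
  "vspace B = {v. \<forall>b. b \<notin> B \<longrightarrow> v b = 0}"

definition bvec :: "'b \<Rightarrow> 'b \<Rightarrow> 'a::zero_neq_one" where
  "bvec b = (\<lambda>c. if c = b then 1 else 0)"

definition lin :: "'b set \<Rightarrow> ('b \<Rightarrow> 'c vec) \<Rightarrow> 'b vec \<Rightarrow> 'c vec" where
  "lin B T v = (\<lambda>c. \<Sum>b\<in>B. v b * T b c)"

definition outer :: "'b vec \<Rightarrow> 'c vec \<Rightarrow> ('b \<times> 'c) vec" where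
  "outer v w = (\<lambda>(b, c). v b * w c)"

section \<open>Modules over the quantum affine algebra\<close>

text \<open>\<open>I = \<int>/n\<int>\<close> is represented by \<open>{1..n}\<close>, so that the affine node \<open>0\<close> is \<open>n\<close>.
  A \<open>U\<close>-module is recorded by a basis and the action of the Chevalley generators on it.\<close>

datatype chev = chE nat | chF nat | chK nat | chKinv nat

definition generators :: "nat \<Rightarrow> chev set" where
  "generators n = (\<Union>i\<in>{1..n}. {chE i, chF i, chK i, chKinv i})"

definition nxt :: "nat \<Rightarrow> nat \<Rightarrow> nat" where
  "nxt n i = (if i = n then 1 else i + 1)"

record 'b umod =
  labels :: "'b set"
  act :: "chev \<Rightarrow> 'b \<Rightarrow> 'b vec"

definition U_linear :: "nat \<Rightarrow> 'b umod \<Rightarrow> 'c umod \<Rightarrow> ('b \<Rightarrow> 'c vec) \<Rightarrow> bool" where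
  "U_linear n M N T \<longleftrightarrow>
     (\<forall>b\<in>labels M. T b \<in> vspace (labels N)) \<and>
     (\<forall>g\<in>generators n. \<forall>b\<in>labels M.
        lin (labels M) T (act M g b) = lin (labels N) (act N g) (T b))"

definition U_iso :: "nat \<Rightarrow> 'b umod \<Rightarrow> 'c umod \<Rightarrow> ('b \<Rightarrow> 'c vec) \<Rightarrow> bool" where
  "U_iso n M N T \<longleftrightarrow> U_linear n M N T \<and>
     bij_betw (lin (labels M) T) (vspace (labels M)) (vspace (labels N))"

text \<open>The generator \<open>B\<^sub>i = F\<^sub>i + q\<inverse> E\<^sub>i K\<^sub>i\<inverse>\<close> of \<open>U\<^sup>\<imath>\<close>.\<close>

definition actB :: "'b umod \<Rightarrow> nat \<Rightarrow> 'b \<Rightarrow> 'b vec" where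
  "actB M i b = (\<lambda>c. act M (chF i) b c
     + inverse qv * lin (labels M) (act M (chE i)) (act M (chKinv i) b) c)"

definition Ui_linear :: "nat \<Rightarrow> 'b umod \<Rightarrow> 'c umod \<Rightarrow> ('b \<Rightarrow> 'c vec) \<Rightarrow> bool" where
  "Ui_linear n M N T \<longleftrightarrow>
     (\<forall>b\<in>labels M. T b \<in> vspace (labels N)) \<and>
     (\<forall>i\<in>{1..n}. \<forall>b\<in>labels M.
        lin (labels M) T (actB M i b) = lin (labels N) (actB N i) (T b))"

fun tensor_act :: "(chev \<Rightarrow> 'b \<Rightarrow> 'b vec) \<Rightarrow> (chev \<Rightarrow> 'c \<Rightarrow> 'c vec) \<Rightarrow>
    chev \<Rightarrow> 'b \<times> 'c \<Rightarrow> ('b \<times> 'c) vec" where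
  "tensor_act A D (chE i) (b, c) =
     (\<lambda>p. outer (A (chE i) b) (bvec c) p + outer (A (chK i) b) (D (chE i) c) p)"
| "tensor_act A D (chF i) (b, c) =
     (\<lambda>p. outer (A (chF i) b) (D (chKinv i) c) p + outer (bvec b) (D (chF i) c) p)"
| "tensor_act A D (chK i) (b, c) = outer (A (chK i) b) (D (chK i) c)"
| "tensor_act A D (chKinv i) (b, c) = outer (A (chKinv i) b) (D (chKinv i) c)"

definition tensor :: "'b umod \<Rightarrow> 'c umod \<Rightarrow> ('b \<times> 'c) umod" where
  "tensor M N = \<lparr>labels = labels M \<times> labels N, act = tensor_act (act M) (act N)\<rparr>"

section \<open>Kirillov--Reshetikhin modules\<close>

type_synonym comp = "nat \<Rightarrow> nat"

definition comps :: "nat \<Rightarrow> nat \<Rightarrow> comp set" where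
  "comps n s = {\<alpha>. (\<forall>i. i \<notin> {1..n} \<longrightarrow> \<alpha> i = 0) \<and> (\<Sum>i=1..n. \<alpha> i) = s}"

definition ee :: "nat \<Rightarrow> comp" where
  "ee j = (\<lambda>i. if i = j then 1 else 0)"

text \<open>The vector \<open>v\<close> with index \<open>\<alpha> + e\<^sub>i - e\<^sub>j\<close> for \<open>i \<noteq> j\<close>.\<close>

definition vmove :: "comp \<Rightarrow> nat \<Rightarrow> nat \<Rightarrow> comp vec" where
  "vmove \<alpha> i j = (if \<alpha> j = 0 then (\<lambda>_. 0) else bvec (\<alpha>(i := \<alpha> i + 1, j := \<alpha> j - 1)))"

definition spec :: "nat \<Rightarrow> Cqx \<Rightarrow> nat \<Rightarrow> Cqx" where
  "spec n z i = (if i = n then z else 1)"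

definition wt :: "nat \<Rightarrow> comp \<Rightarrow> nat \<Rightarrow> int" where
  "wt n \<alpha> i = int (\<alpha> i) - int (\<alpha> (nxt n i))"

fun KR_act :: "nat \<Rightarrow> Cqx \<Rightarrow> chev \<Rightarrow> comp \<Rightarrow> comp vec" where
  "KR_act n z (chE i) \<alpha> =
     (\<lambda>\<beta>. spec n z i * qint (\<alpha> i + 1) * vmove \<alpha> i (nxt n i) \<beta>)"
| "KR_act n z (chF i) \<alpha> =
     (\<lambda>\<beta>. inverse (spec n z i) * qint (\<alpha> (nxt n i) + 1) * vmove \<alpha> (nxt n i) i \<beta>)"
| "KR_act n z (chK i) \<alpha> = (\<lambda>\<beta>. qv powi wt n \<alpha> i * bvec \<alpha> \<beta>)"
| "KR_act n z (chKinv i) \<alpha> = (\<lambda>\<beta>. qv powi (- wt n \<alpha> i) * bvec \<alpha> \<beta>)"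

fun KRd_act :: "nat \<Rightarrow> Cqx \<Rightarrow> chev \<Rightarrow> comp \<Rightarrow> comp vec" where
  "KRd_act n z (chE i) \<alpha> =
     (\<lambda>\<beta>. spec n z i * qint (\<alpha> (nxt n i) + 1) * vmove \<alpha> (nxt n i) i \<beta>)"
| "KRd_act n z (chF i) \<alpha> =
     (\<lambda>\<beta>. inverse (spec n z i) * qint (\<alpha> i + 1) * vmove \<alpha> i (nxt n i) \<beta>)"
| "KRd_act n z (chK i) \<alpha> = (\<lambda>\<beta>. qv powi (- wt n \<alpha> i) * bvec \<alpha> \<beta>)"
| "KRd_act n z (chKinv i) \<alpha> = (\<lambda>\<beta>. qv powi wt n \<alpha> i * bvec \<alpha> \<beta>)"

text \<open>\<open>W(z)\<close> and \<open>W\<^sup>\<or>(z)\<close>: the modules for \<open>s = 1\<close> with the basis vector indexed by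
  \<open>e\<^sub>j\<close> relabelled as \<open>j\<close>.\<close>

definition W :: "nat \<Rightarrow> Cqx \<Rightarrow> nat umod" where
  "W n z = \<lparr>labels = {1..n}, act = (\<lambda>g j k. KR_act n z g (ee j) (ee k))\<rparr>"

definition Wd :: "nat \<Rightarrow> Cqx \<Rightarrow> nat umod" where
  "Wd n z = \<lparr>labels = {1..n}, act = (\<lambda>g j k. KRd_act n z g (ee j) (ee k))\<rparr>"

text \<open>Basis words of the \<open>s\<close>-fold tensor powers; positions are counted from \<open>0\<close>.\<close>

definition words :: "nat \<Rightarrow> nat \<Rightarrow> nat list set" where
  "words n s = {w. length w = s \<and> set w \<subseteq> {1..n}}"

definition words_of :: "nat \<Rightarrow> nat \<Rightarrow> comp \<Rightarrow> nat list set" where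
  "words_of n s \<alpha> = {w \<in> words n s. \<forall>i\<in>{1..n}. count_list w i = \<alpha> i}"

definition emb :: "nat \<Rightarrow> nat \<Rightarrow> comp \<Rightarrow> nat list vec" where
  "emb n s \<alpha> = (\<lambda>w. if w \<in> words_of n s \<alpha>
     then qv powi (- int (card {(p, p'). p < p' \<and> p' < s \<and> w ! p > w ! p'})) else 0)"

definition embd :: "nat \<Rightarrow> nat \<Rightarrow> comp \<Rightarrow> nat list vec" where
  "embd n s \<alpha> = (\<lambda>w. if w \<in> words_of n s \<alpha>
     then qv powi (- int (card {(p, p'). p < p' \<and> p' < s \<and> w ! p < w ! p'})) else 0)"

section \<open>Quantum K-matrices\<close>

definition is_R :: "nat \<Rightarrow> Cqx \<Rightarrow> Cqx \<Rightarrow> (nat \<times> nat \<Rightarrow> (nat \<times> nat) vec) \<Rightarrow> bool" where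
  "is_R n u v R \<longleftrightarrow> U_iso n (tensor (Wd n u) (W n v)) (tensor (W n v) (Wd n u)) R"

definition is_K :: "nat \<Rightarrow> Cqx \<Rightarrow> (nat \<Rightarrow> nat vec) \<Rightarrow> bool" where
  "is_K n z K \<longleftrightarrow> Ui_linear n (W n z) (Wd n (inverse z)) K \<and> (\<forall>j\<in>{1..n}. K j = bvec j)"

text \<open>\<open>K\<^sub>1\<close> acts on the first letter, \<open>R\<^sub>i\<^sub>,\<^sub>i\<^sub>+\<^sub>1\<close> on the letters at positions \<open>i - 1\<close> and
  \<open>i\<close> of a word.\<close>

definition K_first :: "nat \<Rightarrow> nat \<Rightarrow> (nat \<Rightarrow> nat vec) \<Rightarrow> nat list vec \<Rightarrow> nat list vec" where
  "K_first n s K = lin (words n s) (\<lambda>w w'.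
     if length w' = s \<and> (\<forall>p<s. p \<noteq> 0 \<longrightarrow> w' ! p = w ! p)
     then K (w ! 0) (w' ! 0) else 0)"

definition R_at :: "nat \<Rightarrow> nat \<Rightarrow> nat \<Rightarrow> (nat \<times> nat \<Rightarrow> (nat \<times> nat) vec) \<Rightarrow>
    nat list vec \<Rightarrow> nat list vec" where
  "R_at n s i R = lin (words n s) (\<lambda>w w'.
     if length w' = s \<and> (\<forall>p<s. p \<noteq> i - 1 \<and> p \<noteq> i \<longrightarrow> w' ! p = w ! p)
     then R (w ! (i - 1), w ! i) (w' ! (i - 1), w' ! i) else 0)"

definition v_par :: "nat \<Rightarrow> nat \<Rightarrow> Cqx" where
  "v_par s j = qv powi (2 * int j - int s - 1) * xv"

definition u_par :: "nat \<Rightarrow> nat \<Rightarrow> nat \<Rightarrow> Cqx" where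
  "u_par s j i = qv powi (int s - 2 * int j + 2 * int i + 1) * inverse xv"

type_synonym R_family = "Cqx \<Rightarrow> Cqx \<Rightarrow> nat \<times> nat \<Rightarrow> (nat \<times> nat) vec"
type_synonym K_family = "Cqx \<Rightarrow> nat \<Rightarrow> nat vec"

definition R_choice :: "nat \<Rightarrow> nat \<Rightarrow> R_family \<Rightarrow> bool" where
  "R_choice n s R \<longleftrightarrow>
     (\<forall>j\<in>{1..s}. \<forall>i\<in>{1..<j}. is_R n (u_par s j i) (v_par s j) (R (u_par s j i) (v_par s j)))"

definition K_choice :: "nat \<Rightarrow> nat \<Rightarrow> K_family \<Rightarrow> bool" where
  "K_choice n s K \<longleftrightarrow> (\<forall>j\<in>{1..s}. is_K n (v_par s j) (K (v_par s j)))"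

text \<open>\<open>K\<^sup>(\<^sup>j\<^sup>) = K\<^sub>1 R\<^sub>1\<^sub>,\<^sub>2 \<dots> R\<^sub>j\<^sub>-\<^sub>1\<^sub>,\<^sub>j\<close>\<close>

definition K_stage :: "nat \<Rightarrow> nat \<Rightarrow> R_family \<Rightarrow> K_family \<Rightarrow> nat \<Rightarrow>
    nat list vec \<Rightarrow> nat list vec" where
  "K_stage n s R K j = K_first n s (K (v_par s j)) \<circ>
     foldr (\<lambda>i f. R_at n s i (R (u_par s j i) (v_par s j)) \<circ> f) [1..<j] id"

text \<open>\<open>K\<^sup>(\<^sup>s\<^sup>) \<dots> K\<^sup>(\<^sup>1\<^sup>)\<close>\<close>

definition K_total :: "nat \<Rightarrow> nat \<Rightarrow> R_family \<Rightarrow> K_family \<Rightarrow> nat list vec \<Rightarrow> nat list vec" where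
  "K_total n s R K = fold (\<lambda>j f. K_stage n s R K j \<circ> f) [1..<s + 1] id"

text \<open>\<open>M\<close> is the matrix of \<open>K\<^sub>W\<^sub>s(x) : W\<^sub>s(x) \<rightarrow> W\<^sub>s\<^sup>\<or>(x\<inverse>)\<close> in the bases \<open>v\<^sub>\<alpha>\<close>, \<open>v\<^sub>\<alpha>\<^sup>\<or>\<close>, for
  some normalisation of the R-matrices.\<close>

definition quantum_K_matrix :: "nat \<Rightarrow> nat \<Rightarrow> (comp \<Rightarrow> comp vec) \<Rightarrow> bool" where
  "quantum_K_matrix n s M \<longleftrightarrow> (\<exists>R K. R_choice n s R \<and> K_choice n s K \<and>
     (\<forall>\<alpha>\<in>comps n s. M \<alpha> \<in> vspace (comps n s) \<and>
        K_total n s R K (emb n s \<alpha>) = lin (comps n s) (embd n s) (M \<alpha>)))"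

section \<open>Combinatorial K-matrices\<close>

text \<open>In coordinates with respect to \<open>v\<^sub>\<alpha>\<close>, resp. \<open>v\<^sub>\<alpha>\<^sup>\<or>\<close>, the lattices \<open>L\<^sub>s(x)\<close> and
  \<open>L\<^sub>s\<^sup>\<or>(x\<inverse>)\<close> are the same set, and so are \<open>B\<^sub>s(x)\<close> and \<open>B\<^sub>s\<^sup>\<or>(x\<inverse>)\<close>. The kernel of
  \<open>reduce\<close> on the lattice is \<open>q\<inverse>\<close> times the lattice, so classes modulo \<open>q\<inverse>\<close> are identified
  with coordinate functions valued in \<open>\<complex>(x)\<close>.\<close>

definition lattice :: "nat \<Rightarrow> nat \<Rightarrow> comp vec set" where
  "lattice n s = {v \<in> vspace (comps n s). \<forall>\<alpha>\<in>comps n s. v \<alpha> \<in> Ax}"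

definition reduce :: "comp vec \<Rightarrow> comp \<Rightarrow> Cx" where
  "reduce v = (\<lambda>\<alpha>. residue (v \<alpha>))"

definition xb :: "int \<Rightarrow> comp \<Rightarrow> comp \<Rightarrow> Cx" where
  "xb d \<alpha> = (\<lambda>\<beta>. x0 powi d * bvec \<alpha> \<beta>)"

definition crystal :: "nat \<Rightarrow> nat \<Rightarrow> (comp \<Rightarrow> Cx) set" where
  "crystal n s = {xb d \<alpha> | d \<alpha>. \<alpha> \<in> comps n s}"

text \<open>\<open>T\<close> preserves the lattices and \<open>Tbar\<close> is the map it induces modulo \<open>q\<inverse>\<close>.\<close>

definition induces :: "nat \<Rightarrow> nat \<Rightarrow> (comp vec \<Rightarrow> comp vec) \<Rightarrow>
    ((comp \<Rightarrow> Cx) \<Rightarrow> comp \<Rightarrow> Cx) \<Rightarrow> bool" where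
  "induces n s T Tbar \<longleftrightarrow>
     (\<forall>v\<in>lattice n s. T v \<in> lattice n s \<and> Tbar (reduce v) = reduce (T v))"

text \<open>The existence clause makes sure that the quantum K-matrix is defined, i.e. that the
  R-matrices exist at the parameters in question and that the composite restricts to a map
  \<open>W\<^sub>s(x) \<rightarrow> W\<^sub>s\<^sup>\<or>(x\<inverse>)\<close>. As R-matrices are only determined up to scalars, the remaining
  condition is required for every normalisation.\<close>

definition combinatorial_K_matrix ::
    "nat \<Rightarrow> nat \<Rightarrow> ((comp \<Rightarrow> Cx) \<Rightarrow> comp \<Rightarrow> Cx) \<Rightarrow> bool" where
  "combinatorial_K_matrix n s \<kappa> \<longleftrightarrow>
     (\<exists>M. quantum_K_matrix n s M) \<and>
     (\<forall>M. quantum_K_matrix n s M \<longrightarrow>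
        (\<exists>c Kbar. c \<noteq> 0 \<and>
           induces n s (\<lambda>v \<alpha>. c * lin (comps n s) M v \<alpha>) Kbar \<and>
           (\<exists>v\<in>lattice n s. Kbar (reduce v) \<noteq> (\<lambda>_. 0)) \<and>
           bij_betw Kbar (crystal n s) (crystal n s) \<and>
           (\<forall>b\<in>crystal n s. \<kappa> b = Kbar b)))"

section \<open>The explicit map\<close>

definition theta :: "nat \<Rightarrow> nat" where
  "theta m = (if odd m then 1 else 0)"

definition Istat :: "comp \<Rightarrow> nat" where
  "Istat \<alpha> = 2 * (\<alpha> 1 div 2)"

lemma Istat_eq: "Istat \<alpha> = \<alpha> 1 - theta (\<alpha> 1)"
  by (auto simp: Istat_def theta_def elim!: oddE)

text \<open>Since \<open>theta m \<le> m\<close>, the subtraction on \<^typ>\<open>nat\<close> does not truncate.\<close>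

definition prim :: "nat \<Rightarrow> comp \<Rightarrow> comp" where
  "prim n \<alpha> = (\<lambda>i. if i \<in> {1..n}
     then \<alpha> (nxt n i) + theta (\<alpha> i) - theta (\<alpha> (nxt n i)) else 0)"

definition calK :: "nat \<Rightarrow> nat \<Rightarrow> (comp \<Rightarrow> Cx) \<Rightarrow> comp \<Rightarrow> Cx" where
  "calK n s b = (THE b'. \<exists>d. \<exists>\<alpha>\<in>comps n s.
     b = xb d \<alpha> \<and> b' = xb (d + int (Istat \<alpha>)) (prim n \<alpha>))"

lemma x0_nonzero: "x0 \<noteq> 0"
  by (simp add: x0_def Zero_fract_def eq_fract)

lemma x0_power: "x0 ^ k = Fraction_Field.Fract ([:0, 1:] ^ k) 1"
  by (induction k) (simp_all add: x0_def One_fract_def)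

lemma x0_power_eq_1: "x0 ^ k = 1 \<Longrightarrow> k = 0"
proof -
  assume "x0 ^ k = 1"
  then have "([:0, 1:] :: complex poly) ^ k = 1"
    by (simp add: x0_power One_fract_def eq_fract)
  then have "degree (([:0, 1:] :: complex poly) ^ k) = 0"
    by simp
  then show "k = 0"
    by (simp add: degree_power_eq)
qed

lemma x0_powi_eq_1: "x0 powi d = 1 \<Longrightarrow> d = 0"
  using x0_power_eq_1[of "nat \<bar>d\<bar>"]
  by (auto simp: power_int_def power_inverse split: if_splits)

lemma xb_inject: "xb d \<alpha> = xb d' \<alpha>' \<longleftrightarrow> d = d' \<and> \<alpha> = \<alpha>'"
proof
  assume eq: "xb d \<alpha> = xb d' \<alpha>'"
  have "\<alpha> = \<alpha>'"
    using fun_cong[OF eq, of \<alpha>] x0_nonzero by (auto simp: xb_def bvec_def split: if_splits)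
  moreover have "x0 powi (d - d') = 1"
    using fun_cong[OF eq, of \<alpha>] x0_nonzero \<open>\<alpha> = \<alpha>'\<close>
    by (simp add: xb_def bvec_def power_int_diff)
  ultimately show "d = d' \<and> \<alpha> = \<alpha>'"
    using x0_powi_eq_1[of "d - d'"] by simp
qed simp

lemma calK_xb:
  "\<alpha> \<in> comps n s \<Longrightarrow> calK n s (xb d \<alpha>) = xb (d + int (Istat \<alpha>)) (prim n \<alpha>)"
  unfolding calK_def by (rule the_equality) (auto simp: xb_inject)

end

theory Submission
  imports Defs
begin

text \<open>On the weight strings of one node \<open>i\<close>, the operator \<open>B\<^sub>i\<close> has eigenvalues \<open>\<plusminus>[k]\<close>, and there is a basis
  congruent modulo \<open>q\<inverse>\<close> to the crystal basis (up to powers of \<open>x\<close>) on which \<open>B\<^sub>i\<close> acts by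
  \<open>w(\<alpha>) \<mapsto> [k\<^sub>i(\<alpha>)] w(\<sigma>\<^sub>i(\<alpha>))\<close> for an involution \<open>\<sigma>\<^sub>i\<close>. Since \<open>[k]\<^sup>2\<close> determines \<open>k\<close>, the limit of any
  map intertwining all \<open>B\<^sub>i\<close> preserves every \<open>k\<^sub>i\<close> and commutes with every \<open>\<sigma>\<^sub>i\<close>, up to powers of \<open>x\<close>.
  The \<open>\<sigma>\<^sub>i\<close> connect all compositions, and for \<open>n \<ge> 3\<close> the numbers \<open>k\<^sub>i\<close> determine the image of
  \<open>(s, 0, \<dots>, 0)\<close>; so the limit is the stated map up to a scalar.

  That the composite of R- and K-matrices maps \<open>W\<^sub>s\<close> into \<open>W\<^sub>s\<^sup>\<or>\<close> is deduced from the same structure.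
  The subspace \<open>N\<close> of vectors whose image is symmetric is stable under all \<open>B\<^sub>i\<close>. The eigenvalues \<open>\<plusminus>[s]\<close>
  of \<open>B\<^sub>1\<close> on the tensor product only occur on symmetric tensors, so \<open>N\<close> contains the corresponding
  eigenvectors; moving along the \<open>\<sigma>\<^sub>i\<close>, it contains
  vectors congruent to nonzero multiples of all basis vectors, hence everything by Nakayama's lemma.\<close>

text \<open>The obstacle is that B_i does not preserve the lattice: its eigenvalues [k] grow like
  q^(k-1), so it has no reduction modulo q^-1 and the intertwining relation cannot simply be
  specialised. The relations are therefore derived exactly over \<open>Cqx\<close> in the adapted
  bases; there a factor [k] occurs on both sides and cancels, and only then are residues taken. The
  adapted basis of an (m + 1)-dimensional string comes from that of the (m - 1)-dimensional one by
  the deformed multiplication by y^2 - z^2, whose diagonal coefficients are 1 modulo q^-1. The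
  powers of x have a single source: at the affine node the spectral parameter is absorbed into the
  gauge factor \<open>g ^ c j\<close> of \<open>node_basis\<close>, and I(\<alpha>) is the
  correction that makes the exponents agree along affine swaps. An R-matrix enters only through its
  injectivity and its compatibility with the coproducts of B_i and the inverse of K_i, so every
  normalisation is covered at once. An explicit R-matrix serves to show that one exists.\<close>

section \<open>Expansion at q = infinity, the ring \<open>Ax\<close> and its residue map\<close>

lemma expand_0 [simp]: "expand 0 = 0"
  by (simp add: Zero_fract_def expand_Fract)

lemma poly_expand_1 [simp]: "poly_expand 1 = 1"
  by (simp add: one_pCons poly_expand_pCons)

lemma expand_1 [simp]: "expand 1 = 1"
  by (simp add: One_fract_def expand_Fract)

lemma expand_add: "expand (f + g) = expand f + expand g"
  by (cases f; cases g)
     (simp add: expand_Fract poly_expand_mult poly_expand_add add_frac_eq)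

lemma expand_mult: "expand (f * g) = expand f * expand g"
  by (cases f; cases g) (simp add: expand_Fract poly_expand_mult)

lemma expand_uminus: "expand (- f) = - expand f"
proof -
  have "expand f + expand (- f) = 0"
    by (simp flip: expand_add)
  then show ?thesis by (simp add: eq_neg_iff_add_eq_0 add.commute)
qed

lemma expand_eq_0_iff [simp]: "expand f = 0 \<longleftrightarrow> f = 0"
  by (cases f) (simp add: expand_Fract Zero_fract_def eq_fract)

lemma expand_inverse: "expand (inverse f) = inverse (expand f)"
proof (cases "f = 0")
  case False
  then have "expand f * expand (inverse f) = 1"
    by (simp flip: expand_mult)
  then show ?thesis by (simp add: inverse_unique)
qed simp

definition cst :: "Cx \<Rightarrow> Cqx" where "cst a = Fraction_Field.Fract [:a:] 1"

lemma xv_cst: "xv = cst x0"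
  by (simp add: xv_def cst_def)

lemma expand_cst: "expand (cst a) = fls_const a"
  by (simp add: cst_def expand_Fract poly_expand_pCons)

lemma expand_qv: "expand qv = fls_X_inv"
  by (simp add: qv_def expand_Fract poly_expand_pCons)

lemma qv_nonzero [simp]: "qv \<noteq> 0"
  using expand_qv by (metis expand_0 fls_X_inv_nonzero)

lemma xv_nonzero [simp]: "xv \<noteq> 0"
  using expand_cst[of x0] x0_nonzero by (metis expand_0 fls_const_nonzero xv_cst)

lemma Ax_iff: "f \<in> Ax \<longleftrightarrow> (\<exists>F. expand f = fps_to_fls F)"
  by (auto simp: Ax_def)

lemma Ax_0 [simp]: "0 \<in> Ax" and Ax_1 [simp]: "1 \<in> Ax"
  unfolding Ax_iff by (auto intro: exI[of _ 0] exI[of _ 1])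

lemma residue_0 [simp]: "residue 0 = 0" and residue_1 [simp]: "residue 1 = 1"
  by (simp_all add: residue_def)

lemma Ax_add [simp, intro]: "f \<in> Ax \<Longrightarrow> g \<in> Ax \<Longrightarrow> f + g \<in> Ax"
  unfolding Ax_iff by (auto simp: expand_add simp flip: fps_to_fls_plus)

lemma residue_add: "residue (f + g) = residue f + residue g"
  by (simp add: residue_def expand_add)

lemma Ax_uminus [simp, intro]: "f \<in> Ax \<Longrightarrow> - f \<in> Ax"
  unfolding Ax_iff by (auto simp: expand_uminus simp flip: fps_to_fls_uminus)

lemma residue_uminus: "residue (- f) = - residue f"
  by (simp add: residue_def expand_uminus)

lemma Ax_diff [simp, intro]: "f \<in> Ax \<Longrightarrow> g \<in> Ax \<Longrightarrow> f - g \<in> Ax"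
  using Ax_add[of f "- g"] by simp

lemma residue_diff: "residue (f - g) = residue f - residue g"
  using residue_add[of f "- g"] by (simp add: residue_uminus)

lemma Ax_mult [simp, intro]: "f \<in> Ax \<Longrightarrow> g \<in> Ax \<Longrightarrow> f * g \<in> Ax"
  unfolding Ax_iff by (auto simp: expand_mult simp flip: fls_times_fps_to_fls)

lemma residue_mult: "f \<in> Ax \<Longrightarrow> g \<in> Ax \<Longrightarrow> residue (f * g) = residue f * residue g"
  unfolding Ax_iff
  by (auto simp: residue_def expand_mult simp flip: fls_times_fps_to_fls)

lemma Ax_power [simp, intro]: "f \<in> Ax \<Longrightarrow> f ^ k \<in> Ax"
  by (induction k) auto

lemma residue_power: "f \<in> Ax \<Longrightarrow> residue (f ^ k) = residue f ^ k"
  by (induction k) (simp_all add: residue_mult)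

lemma Ax_sum [simp, intro]: "(\<And>a. a \<in> S \<Longrightarrow> f a \<in> Ax) \<Longrightarrow> sum f S \<in> Ax"
  by (induction S rule: infinite_finite_induct) auto

lemma residue_sum: "residue (sum f S) = (\<Sum>a\<in>S. residue (f a))"
  by (induction S rule: infinite_finite_induct) (auto simp: residue_add)

lemma Ax_inverse:
  assumes "f \<in> Ax" "residue f \<noteq> 0"
  shows "inverse f \<in> Ax" "residue (inverse f) = inverse (residue f)"
proof -
  obtain F where F: "expand f = fps_to_fls F" using assms by (auto simp: Ax_iff)
  have F0: "fps_nth F 0 \<noteq> 0" using assms(2) F by (simp add: residue_def)
  have "fps_to_fls F * fps_to_fls (inverse F) = 1"
    using F0 by (metis fls_times_fps_to_fls fps_one_to_fls inverse_mult_eq_1')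
  then have "expand (inverse f) = fps_to_fls (inverse F)"
    by (simp add: expand_inverse F inverse_unique)
  then show 1: "inverse f \<in> Ax" by (auto simp: Ax_iff)
  have "f \<noteq> 0" using assms(2) by auto
  then have "residue f * residue (inverse f) = 1"
    using residue_mult[OF assms(1) 1] by simp
  then show "residue (inverse f) = inverse (residue f)"
    by (simp add: inverse_unique)
qed

lemma Ax_cst [simp, intro]: "cst a \<in> Ax"
  unfolding Ax_iff expand_cst by (rule exI[of _ "fps_const a"]) simp

lemma residue_cst [simp]: "residue (cst a) = a"
  by (simp add: residue_def expand_cst)

lemma Ax_xv_powi [simp, intro]: "xv powi k \<in> Ax"
  and residue_xv_powi: "residue (xv powi k) = x0 powi k"
  using Ax_inverse[of "cst x0"] x0_nonzero
  by (auto simp: power_int_def xv_cst residue_power)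

lemma Ax_qinv [simp, intro]: "inverse qv \<in> Ax" and residue_qinv [simp]: "residue (inverse qv) = 0"
proof -
  have "expand (inverse qv) = fps_to_fls fps_X"
    by (simp add: expand_inverse expand_qv fls_inverse_X_inv)
  then show "inverse qv \<in> Ax" "residue (inverse qv) = 0"
    by (auto simp: Ax_iff residue_def simp del: fps_X_to_fls)
qed

lemma expand_qv_powi: "expand (qv powi k) = fls_X_intpow (- k)"
proof -
  have p: "expand (f ^ m) = expand f ^ m" for f :: Cqx and m
    by (induction m) (simp_all add: expand_mult)
  show ?thesis
    by (simp add: power_int_def p expand_inverse expand_qv fls_inverse_X_inv fls_X_power_conv_shift_1
        fls_X_inv_power_conv_shift_1)
qed

lemma nth_expand_qv_powi_mult: "fls_nth (expand (qv powi k * f)) m = fls_nth (expand f) (m + k)"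
  by (simp add: expand_mult expand_qv_powi fls_shifted_times_simps)

lemma Ax_nth_iff: "f \<in> Ax \<longleftrightarrow> (\<forall>k<0. fls_nth (expand f) k = 0)"
proof
  assume "\<forall>k<0. fls_nth (expand f) k = 0"
  then have "fls_subdegree (expand f) \<ge> 0"
    by (cases "expand f = 0") (auto intro: fls_subdegree_geI)
  then have "expand f = fps_to_fls (fls_regpart (expand f))"
    by simp
  then show "f \<in> Ax"
    unfolding Ax_iff by blast
qed (auto simp: Ax_iff)

text \<open>The exponent t is the least order in q^-1 among the nonzero members. Multiplying by q^t
  shifts all expansions by this amount, and a member attaining the minimum acquires a nonzero
  constant term.\<close>

lemma normalise_family:
  assumes "finite S" "a0 \<in> S" "f a0 \<noteq> 0"
  obtains t where "\<And>a. a \<in> S \<Longrightarrow> qv powi t * f a \<in> Ax"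
    "\<exists>a\<in>S. residue (qv powi t * f a) \<noteq> 0"
proof -
  define S' where "S' = {a \<in> S. f a \<noteq> 0}"
  define t where "t = Min ((\<lambda>a. fls_subdegree (expand (f a))) ` S')"
  have fin: "finite S'" and ne: "S' \<noteq> {}" using assms by (auto simp: S'_def)
  have le: "t \<le> fls_subdegree (expand (f a))" if "a \<in> S'" for a
    unfolding t_def using fin that by (intro Min_le) auto
  have "t \<in> (\<lambda>a. fls_subdegree (expand (f a))) ` S'"
    unfolding t_def using fin ne by (intro Min_in) auto
  then obtain a where a: "a \<in> S'" "t = fls_subdegree (expand (f a))" by auto
  show ?thesis
  proof (rule that[of t])
    fix b assume b: "b \<in> S"
    show "qv powi t * f b \<in> Ax"
    proof (cases "f b = 0")
      case False
      then have "t \<le> fls_subdegree (expand (f b))" using le b by (simp add: S'_def)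
      then show ?thesis by (auto simp: Ax_nth_iff nth_expand_qv_powi_mult intro: fls_eq0_below_subdegree)
    qed simp
  next
    have "residue (qv powi t * f a) \<noteq> 0"
      using a by (simp add: residue_def nth_expand_qv_powi_mult S'_def)
    then show "\<exists>a\<in>S. residue (qv powi t * f a) \<noteq> 0" using a by (auto simp: S'_def)
  qed
qed

section \<open>Quantum integers and their growth in q\<close>

lemma qinv_power_residue: "residue (inverse qv ^ k) = (if k = 0 then 1 else 0)"
  by (simp add: residue_power)

lemma qv_minus_inverse_nonzero: "qv - inverse qv \<noteq> 0"
proof
  assume "qv - inverse qv = 0"
  then have "1 - inverse qv * inverse qv = 0"
    by (metis eq_iff_diff_eq_0 inverse_inverse_eq left_inverse nonzero_imp_inverse_nonzero qv_nonzero)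
  then have "residue (1 - inverse qv * inverse qv) = 0" by simp
  then show False by (simp add: residue_diff residue_mult)
qed

lemma qint_0 [simp]: "qint 0 = 0" and qint_1 [simp]: "qint (Suc 0) = 1"
  using qv_minus_inverse_nonzero by (simp_all add: qint_def)

text \<open>Extracting q^k leaves (1 - q^(-2k-2)) / (1 - q^-2), a unit of residue 1. The lattice
  estimates for the rank one bases come down to counting these powers of q.\<close>

lemma qint_asymp:
  obtains h where "qint (Suc k) = qv ^ k * h" "h \<in> Ax" "residue h = 1"
proof -
  define p where "p = inverse qv"
  have pq: "qv * p = 1" by (simp add: p_def)
  define h where "h = (1 - p ^ (2 * Suc k)) * inverse (1 - p ^ 2)"
  have u: "1 - p ^ 2 \<in> Ax" "residue (1 - p ^ 2) = 1"
    by (simp_all add: p_def residue_diff residue_power)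
  have u0: "1 - p ^ 2 \<noteq> 0" using u(2) by auto
  have "qint (Suc k) = qv ^ k * h"
  proof -
    have "qv ^ k * (1 - p ^ (2 * Suc k)) * (qv - p) = (qv ^ Suc k - p ^ Suc k) * (1 - p ^ 2)"
    proof -
      have "qv ^ k * p ^ (2 * Suc k) = p ^ Suc (Suc k)"
      proof -
        have "p ^ (2 * Suc k) = p ^ k * p ^ Suc (Suc k)"
          by (simp add: mult_2 flip: power_add)
        then have "qv ^ k * p ^ (2 * Suc k) = (qv * p) ^ k * p ^ Suc (Suc k)"
          by (simp only: power_mult_distrib mult.assoc)
        then show ?thesis by (simp add: pq)
      qed
      then have 1: "qv ^ k * (1 - p ^ (2 * Suc k)) = qv ^ k - p ^ Suc (Suc k)"
        by (simp only: right_diff_distrib mult_1_right)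
      have "(a - p * (p * b)) * (qv - p) = (qv * a - p * b) * (1 - p ^ 2)" for a b
        using pq by algebra
      then show ?thesis using 1 by simp
    qed
    then show ?thesis
      using u0 qv_minus_inverse_nonzero unfolding qint_def h_def p_def[symmetric]
      by (simp add: divide_simps) 
  qed
  moreover have "h \<in> Ax" "residue h = 1"
    using Ax_inverse[of "1 - p ^ 2"] u
    by (simp_all add: h_def p_def residue_mult residue_diff residue_power)
  ultimately show ?thesis using that by blast
qed

lemma qv_power_cancel: "inverse qv ^ (k + e) * (qv ^ k * h) = inverse qv ^ e * h"
proof -
  have "inverse qv ^ (k + e) * (qv ^ k * h) = (inverse qv * qv) ^ k * (inverse qv ^ e * h)"
    unfolding power_mult_distrib power_add by (simp only: mult_ac)
  then show ?thesis by simp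
qed

text \<open>The larger of two quantum integers dominates: divided by its leading power of q it has
  residue 1, while the smaller one then has residue 0.\<close>

lemma qint_eq_iff: "qint k = qint l \<longleftrightarrow> k = l"
proof -
  have *: "qint k \<noteq> qint l" if kl: "k < l" for k l
  proof
    assume eq: "qint k = qint l"
    obtain l' where l: "l = Suc l'" using kl by (cases l) simp_all
    obtain h where h: "qint l = qv ^ l' * h" "h \<in> Ax" "residue h = 1"
      using qint_asymp l by blast
    have "h = inverse qv ^ l' * qint k"
      unfolding eq h(1) using qv_power_cancel[of l' 0 h] by (simp only: add_0_right power_0 mult_1_left)
    moreover have "residue (inverse qv ^ l' * qint k) = 0"
    proof (cases k)
      case (Suc k')
      obtain g where g: "qint k = qv ^ k' * g" "g \<in> Ax" using qint_asymp[of k'] Suc by blast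
      define e where "e = l' - Suc k'"
      have e: "l' = k' + Suc e" using kl l Suc by (simp add: e_def)
      have *: "inverse qv ^ l' * qint k = inverse qv ^ Suc e * g"
        unfolding g e by (rule qv_power_cancel)
      show ?thesis
        unfolding * using g(2) by (simp add: residue_mult residue_power)
    qed simp
    ultimately show False using h(3) by simp
  qed
  show ?thesis
  proof (cases k l rule: linorder_cases)
    case less
    then show ?thesis using *[OF less] by simp
  next
    case greater
    then show ?thesis using *[OF greater] by simp
  qed simp
qed

lemma qint_eq_0_iff [simp]: "qint k = 0 \<longleftrightarrow> k = 0"
  using qint_eq_iff[of k 0] by simp

text \<open>Both leading coefficients are 1, so they cannot cancel: the residue of the rescaled sum
  is 1, or 1 + 1 if the degrees agree.\<close>

lemma qint_sum_nonzero: assumes "k + l \<noteq> 0" shows "qint k + qint l \<noteq> 0"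
proof -
  have *: "qint k + qint l \<noteq> 0" if kl: "k \<le> l" "l \<noteq> 0" for k l
  proof
    assume eq: "qint k + qint l = 0"
    obtain l' where l: "l = Suc l'" using kl by (cases l) auto
    obtain h where h: "qint l = qv ^ l' * h" "h \<in> Ax" "residue h = 1"
      using qint_asymp l by blast
    show False
    proof (cases k)
      case 0
      then show False using eq kl by simp
    next
      case (Suc k')
      obtain g where g: "qint k = qv ^ k' * g" "g \<in> Ax" "residue g = 1" using qint_asymp[of k'] Suc by blast
      define e where "e = l' - k'"
      have e: "l' = k' + e" using kl l Suc by (simp add: e_def)
      have "inverse qv ^ l' * (qint k + qint l) = inverse qv ^ e * g + h"
        unfolding distrib_left g(1) h(1) e qv_power_cancel
        using qv_power_cancel[of "k' + e" 0 h] by (simp only: add_0_right power_0 mult_1_left)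
      then have "residue (inverse qv ^ e * g + h) = 0" using eq by simp
      then have "(if e = 0 then 1 else 0) + 1 = (0::Cx)" using g h
        by (simp add: residue_add residue_mult residue_power power_0_left)
      moreover have "(1::Cx) + 1 \<noteq> 0"
        by (simp add: One_fract_def Zero_fract_def eq_fract)
      ultimately show False by (cases "e = 0") simp_all
    qed
  qed
  show ?thesis
  proof (cases "k \<le> l")
    case True
    then have "l \<noteq> 0" using assms by linarith
    then show ?thesis using * True by blast
  next
    case False
    then have "l \<le> k" "k \<noteq> 0" by simp_all
    then have "qint l + qint k \<noteq> 0" using * by blast
    then show ?thesis by (metis add.commute)
  qed
qed

lemma qint_square_eq_iff: "qint k ^ 2 = qint l ^ 2 \<longleftrightarrow> k = l"
proof
  assume "qint k ^ 2 = qint l ^ 2"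
  then have "qint k = qint l \<or> qint k + qint l = 0"
    unfolding power2_eq_iff eq_neg_iff_add_eq_0 .
  then show "k = l" using qint_eq_iff[of k l] qint_sum_nonzero[of k l] by fastforce
qed simp

section \<open>The rank one coideal operator\<close>

text \<open>\<open>rk1 m\<close> is \<open>B = F + q\<inverse> E K\<inverse>\<close> on the \<open>(m + 1)\<close>-dimensional simple module, in coordinates
  \<open>c = 0..m\<close>; the truncated arguments \<open>c - 1\<close> and \<open>c + 1\<close> only occur with coefficient 0.\<close>

definition rk1 :: "nat \<Rightarrow> (nat \<Rightarrow> Cqx) \<Rightarrow> nat \<Rightarrow> Cqx" where
  "rk1 m w c = qint c * w (c - 1) + qv powi (2 * int c + 1 - int m) * qint (m - c) * w (c + 1)"

text \<open>A \<open>q\<close>-deformation of multiplication by \<open>y\<^sup>2 - z\<^sup>2\<close>, which commutes with \<open>y \<partial>\<^sub>z + z \<partial>\<^sub>y\<close>.\<close>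

definition rk1_lift :: "nat \<Rightarrow> (nat \<Rightarrow> Cqx) \<Rightarrow> nat \<Rightarrow> Cqx" where
  "rk1_lift m w c = qv powi (2 * int c + 3 - 2 * int m) * qint (m - c) * qint (m - c - 1) * w c
     - qv powi (2 - 2 * int m) * qint (c - 1) * qint c * w (c - 2)"

text \<open>The top indices b = m - 1 and b = m give the two parity halves of the vector with
  entries q^(-(m-c)(m-c-1)/2); \<open>rk1\<close> exchanges these halves with factor [m]. All
  smaller b are lifted from the string for m - 2.\<close>

fun rk1_basis :: "nat \<Rightarrow> nat \<Rightarrow> nat \<Rightarrow> Cqx" where
  "rk1_basis m b c =
     (if b + 2 \<le> m then rk1_lift m (rk1_basis (m - 2) b) c
      else if c \<le> m \<and> even (b + c) then inverse qv ^ ((m - c) * (m - c - 1) div 2) else 0)"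

declare rk1_basis.simps [simp del]

text \<open>The basis vectors come in pairs {b - 1, b} with b congruent to m modulo 2, and [b] is
  the factor of the pair. For b = 0 and m even the truncated \<open>b - 1\<close> in
  \<open>rk1_swap\<close> is again 0, and the factor [0] vanishes.\<close>

definition rk1_k :: "nat \<Rightarrow> nat \<Rightarrow> nat" where
  "rk1_k m b = (if even (m - b) then b else b + 1)"

definition rk1_swap :: "nat \<Rightarrow> nat \<Rightarrow> nat" where
  "rk1_swap m b = (if even (m - b) then b - 1 else b + 1)"

lemma qv_inverse_mult: "qv ^ k * inverse qv ^ k = 1"
  by (simp flip: power_mult_distrib)

lemma qv_powi_minus: "qv powi (- int k) = inverse qv ^ k"
  by (simp add: power_int_minus power_inverse)

lemma qv_powi_mult: "qv powi a * qv powi b = qv powi (a + b)"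
  by (simp add: power_int_add)

lemma qv_powi_mult_power: "qv powi a * qv ^ k = qv powi (a + int k)"
  "qv powi a * inverse qv ^ k = qv powi (a - int k)"
  using qv_powi_mult[of a "int k"] qv_powi_mult[of a "- int k"] by (simp_all add: qv_powi_minus)

lemma qint_add: "qint (c + r) = inverse qv ^ r * qint c + qv ^ c * qint r"
proof -
  define p where "p = inverse qv"
  have "a * b - a' * b' = b' * (a - a') + a * (b - b')" for a b a' b' :: Cqx
    by (simp add: algebra_simps)
  then show ?thesis
    unfolding qint_def p_def[symmetric] power_add
    by (simp add: diff_divide_distrib add_divide_distrib algebra_simps)
qed

text \<open>The coefficient identity to which the commutation of \<open>rk1\<close> with
  \<open>rk1_lift\<close> reduces at an interior position of the string.\<close>

lemma qint_lift_aux: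
  "qint (Suc (Suc d)) - qv ^ 2 * qint d =
   inverse qv ^ (c + d) * qint (Suc (Suc c)) - inverse qv ^ (c + d + 2) * qint c"
proof -
  define p where "p = inverse qv"
  define b where "b = qv ^ c"
  define b' where "b' = p ^ c"
  have pq: "qv * p = 1" and bb: "b * b' = 1"
    by (simp_all add: p_def b_def b'_def qv_inverse_mult)
  have *: "(qv ^ 2 * a - p ^ 2 * a') - qv ^ 2 * (a - a')
      = (a' * b') * (qv ^ 2 * b - p ^ 2 * b') - (a' * b' * p ^ 2) * (b - b')" for a a'
    using bb by algebra
  show ?thesis
    unfolding qint_def p_def[symmetric]
    using *[of "qv ^ d" "p ^ d"] qv_minus_inverse_nonzero
    unfolding p_def[symmetric]
    by (simp add: divide_simps b_def b'_def power_add power2_eq_square mult_ac)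
qed

lemma rk1_lift_arith: "C * (P * D2 * D1 * z - B * c2 * c' * y) + Q * D1 * (P * u ^ 4 * d * d1 * z' - B * C * C1 * z)
    = P * u ^ 2 * D1 * d * (C * z + Q * u ^ 2 * d1 * z') - B * (c' * C * c2 * y) - C * D1 * c' * (P * s * z)"
    if "D2 = u ^ 2 * d + (t * C1 - s * c')" "Q * B = P * t"
    for C P D2 D1 z B c2 c' y Q u d d1 z' C1 t s :: "'a::comm_ring_1"
proof -
  have "Q * D1 * (X - B * C * C1 * z) = Q * D1 * X - P * t * D1 * C * C1 * z" for X
    unfolding that(2)[symmetric] by (simp add: algebra_simps)
  then show ?thesis unfolding that(1) by (simp add: algebra_simps flip: power_add)
qed

text \<open>At the two ends of the string one neighbour is missing and both sides agree after
  reordering factors. In the interior the terms in w (c - 3) and w (c + 1) match directly; only the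
  coefficient of w (c - 1) needs an identity, namely \<open>qint_lift_aux\<close>.\<close>

lemma rk1_lift_commute:
  assumes "2 \<le> m" "c \<le> m"
  shows "rk1 m (rk1_lift m w) c = rk1_lift m (rk1 (m - 2) w) c"
proof -
  consider (1) "c = 0" | (2) "c = m" | (3) c' d where "c = Suc c'" "m = Suc (Suc (c' + d))"
  proof (cases "c = 0 \<or> c = m")
    case False
    then have "c = Suc (c - 1)" "m = Suc (Suc (c - 1 + (m - c - 1)))" using assms(2) by auto
    then show ?thesis by (rule that(3))
  qed (use that in blast)
  then show ?thesis
  proof cases
    case 1
    have ab: "qv powi (1 - int m) * qv powi (5 - 2 * int m) = qv powi (3 - 2 * int m) * qv powi (1 - int (m - 2))"
      using assms by (simp flip: power_int_add)
    have swap: "a * x * (b * y * z * v) = c * x * y * (d * z * v)" if "a * b = c * d"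
      for a b c d x y z v :: Cqx
    proof -
      have "a * x * (b * y * z * v) = (a * b) * (x * y * z * v)" by (simp only: mult_ac)
      then show ?thesis unfolding that by (simp only: mult_ac)
    qed
    have L: "rk1 m (rk1_lift m w) c = qv powi (1 - int m) * qint m *
        (qv powi (5 - 2 * int m) * qint (m - 1) * qint (m - 2) * w 1)"
      using 1 by (simp add: rk1_def rk1_lift_def numeral_2_eq_2)
    have R: "rk1_lift m (rk1 (m - 2) w) c = qv powi (3 - 2 * int m) * qint m * qint (m - 1) *
        (qv powi (1 - int (m - 2)) * qint (m - 2) * w 1)"
      using 1 by (simp add: rk1_def rk1_lift_def numeral_2_eq_2)
    show ?thesis unfolding L R by (rule swap[OF ab])
  next
    case 2
    obtain k where m: "m = Suc (Suc k)" using assms(1) by (metis add_2_eq_Suc le_Suc_ex)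
    have "Suc (Suc k) - 1 - 2 = k - 1" "Suc (Suc k) - 2 - 1 = k - 1" "Suc (Suc k) - 1 - 1 = k" by simp_all
    then have "rk1 m (rk1_lift m w) c = qint m * (- (qv powi (2 - 2 * int m) * qint k * qint (Suc k) * w (k - 1)))"
      "rk1_lift m (rk1 (m - 2) w) c = - (qv powi (2 - 2 * int m) * qint (Suc k) * qint m * (qint k * w (k - 1)))"
      unfolding rk1_def rk1_lift_def 2 m by simp_all
    then show ?thesis by (simp only: mult_minus_right mult_ac)
  next
    case 3
    define P where "P = qv powi (2 * int c' + 3 - 2 * int m)"
    define B where "B = qv powi (2 - 2 * int m)"
    define Q where "Q = qv powi (2 * int c + 1 - int m)"
    have e1: "qv powi (2 * int (c - 1) + 3 - 2 * int m) = P"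
      "qv powi (2 * int c + 3 - 2 * int m) = P * qv ^ 2"
      "qv powi (2 * int (c + 1) + 3 - 2 * int m) = P * qv ^ 4"
      "Q * B = P * inverse qv ^ (c' + d)"
      "qv powi (2 * int c + 1 - int (m - 2)) = Q * qv ^ 2"
      unfolding P_def Q_def B_def qv_powi_mult qv_powi_mult_power
      using 3 by (auto intro!: arg_cong[where f = "power_int qv"])
    have e2: "qint c' * (B * qv powi (2 * int (c - 2) + 1 - int (m - 2)) * w (c - 2 + 1))
       = qint c' * (P * inverse qv ^ (c' + d + 2) * w (c - 1))"
    proof (cases c')
      case (Suc c'')
      have "B * qv powi (2 * int (c - 2) + 1 - int (m - 2)) = P * inverse qv ^ (c' + d + 2)"
        unfolding P_def B_def qv_powi_mult qv_powi_mult_power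
        using 3 Suc by (auto intro!: arg_cong[where f = "power_int qv"])
      then show ?thesis using 3 Suc by simp
    qed simp
    have d: "m - c = Suc d" "m - (c - 1) = Suc (Suc d)" "m - (c + 1) = d" "m - 2 - c = d - 1" "c - 1 = c'"
      "qint c' * qint (m - 2 - (c - 2)) = qint c' * qint (Suc d)"
      using 3 by (auto simp: Suc_diff_le) (cases c'; simp)
    have "c - 1 - 2 = c - 2 - 1" "c - 1 - 1 = c - 2" "c + 1 - 1 = c" "c + 1 - 2 = c - 1" by simp_all
    note idx = this
    have L: "rk1 m (rk1_lift m w) c =
       qint c * (P * qint (Suc (Suc d)) * qint (Suc d) * w (c - 1) - B * qint (c - 2) * qint c' * w (c - 2 - 1))
       + Q * qint (Suc d) * (P * qv ^ 4 * qint d * qint (d - 1) * w (c + 1) - B * qint c * qint (c + 1) * w (c - 1))"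
      unfolding rk1_def rk1_lift_def unfolding e1 B_def[symmetric] Q_def[symmetric]
      unfolding idx unfolding d(1,2,3) unfolding d(5) diff_Suc_1 ..
    have R: "rk1_lift m (rk1 (m - 2) w) c =
       P * qv ^ 2 * qint (Suc d) * qint d * (qint c * w (c - 1) + Q * qv ^ 2 * qint (d - 1) * w (c + 1))
       - B * (qint c' * qint c * qint (c - 2) * w (c - 2 - 1))
       - qint c * (qint c' * qint (m - 2 - (c - 2))) * (B * qv powi (2 * int (c - 2) + 1 - int (m - 2)) * w (c - 2 + 1))"
    proof -
      have *: "m - c - 1 = d" using d(1) by simp
      show ?thesis
        unfolding rk1_def rk1_lift_def unfolding e1 B_def[symmetric] *
        unfolding d(1,4,5) by (simp only: algebra_simps)
    qed
    have R': "qint c * (qint c' * qint (m - 2 - (c - 2))) * (B * qv powi (2 * int (c - 2) + 1 - int (m - 2)) * w (c - 2 + 1))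
      = qint c * qint (Suc d) * qint c' * (P * inverse qv ^ (c' + d + 2) * w (c - 1))"
    proof -
      have swap: "qint c * (qint c' * qint (Suc d)) * V = qint c * qint (Suc d) * (qint c' * V)" for V
        by (simp only: mult_ac)
      show ?thesis unfolding d(6) swap e2 by (simp only: mult.assoc)
    qed
    have key: "qint (Suc (Suc d)) = qv ^ 2 * qint d +
       (inverse qv ^ (c' + d) * qint (c + 1) - inverse qv ^ (c' + d + 2) * qint c')"
      using qint_lift_aux[of d c'] 3 by (simp only: Suc_eq_plus1 diff_eq_eq add.commute)
    show ?thesis
      unfolding L R R' by (rule rk1_lift_arith[OF key e1(4)])
  qed
qed

text \<open>Beyond m - 2 the argument is read only with the coefficient [m - c] [m - c - 1], which
  vanishes there. Hence an induction hypothesis on the shorter string is enough.\<close>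

lemma rk1_lift_cong:
  assumes "2 \<le> m" "\<And>c'. c' \<le> m - 2 \<Longrightarrow> v c' = w c'" "c \<le> m"
  shows "rk1_lift m v c = rk1_lift m w c"
proof -
  have 1: "v (c - 2) = w (c - 2)" using assms by simp
  show ?thesis
  proof (cases "c \<le> m - 2")
    case True
    then show ?thesis using assms(2) 1 by (simp add: rk1_lift_def)
  next
    case False
    then have "qint (m - c) * qint (m - c - 1) = 0"
      using assms(1,3) by auto
    then have "z * qint (m - c) * qint (m - c - 1) * y = 0" for y z
      by auto
    then show ?thesis using 1 by (simp only: rk1_lift_def)
  qed
qed

lemma triangular_Suc: "Suc r * r div 2 = r * (r - 1) div 2 + r"
proof -
  have "Suc r * r = r * (r - 1) + r * 2" by (cases r) auto
  then show ?thesis by simp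
qed

text \<open>With m = c + r the two neighbours contribute q^-r [c] and q^c [r] times the value at c,
  and these add up to [c + r].\<close>

lemma rk1_top:
  assumes "c \<le> m" "even (b + c)" "u = (\<lambda>c. if c \<le> m \<and> odd (b + c) then inverse qv ^ ((m - c) * (m - c - 1) div 2) else 0)"
  shows "rk1 m u c = qint m * inverse qv ^ ((m - c) * (m - c - 1) div 2)"
proof -
  obtain r where m: "m = c + r" using assms(1) le_Suc_ex by blast
  define T where "T = inverse qv ^ (r * (r - 1) div 2)"
  have 1: "qint c * u (c - 1) = qint c * inverse qv ^ r * T"
  proof (cases c)
    case (Suc c')
    then have "u c' = inverse qv ^ (Suc r * r div 2)"
      using assms m by simp
    then show ?thesis unfolding triangular_Suc using Suc by (simp add: T_def power_add mult_ac)
  qed simp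
  have 2: "qv powi (2 * int c + 1 - int m) * qint (m - c) * u (c + 1) = qv ^ c * qint r * T"
  proof (cases r)
    case (Suc r')
    have u: "u (c + 1) = inverse qv ^ (r' * (r' - 1) div 2)"
      using assms m Suc by simp
    have T: "T = inverse qv ^ (r' * (r' - 1) div 2) * inverse qv ^ r'"
      unfolding T_def Suc diff_Suc_1 triangular_Suc power_add ..
    have "2 * int c + 1 - int m = int c + - int r'" using m Suc by simp
    then have "qv powi (2 * int c + 1 - int m) = qv ^ c * inverse qv ^ r'"
      by (simp only: power_int_add qv_nonzero power_int_minus power_int_of_nat power_inverse simp_thms disjI1)
    then show ?thesis unfolding u T using m Suc by (simp add: mult_ac)
  qed (use m in simp)
  have "rk1 m u c = (qint c * inverse qv ^ r + qv ^ c * qint r) * T"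
    unfolding rk1_def 1 2 by (simp add: algebra_simps)
  also have "\<dots> = qint m * T" unfolding m qint_add by (simp add: mult.commute)
  finally show ?thesis using m by (simp add: T_def)
qed

lemma rk1_basis_step: "b + 2 \<le> m \<Longrightarrow> rk1_basis m b = rk1_lift m (rk1_basis (m - 2) b)"
  by (rule ext) (subst rk1_basis.simps, simp)

lemma rk1_basis_top:
  "\<not> b + 2 \<le> m \<Longrightarrow> rk1_basis m b =
    (\<lambda>c. if c \<le> m \<and> even (b + c) then inverse qv ^ ((m - c) * (m - c - 1) div 2) else 0)"
  by (rule ext) (subst rk1_basis.simps, simp)

lemma rk1_lift_linear: "rk1_lift m (\<lambda>c. a * v c) c = a * rk1_lift m v c"
  by (simp add: rk1_lift_def algebra_simps)

text \<open>Induction in steps of two: \<open>rk1_lift\<close> commutes with \<open>rk1\<close>, and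
  \<open>rk1_k\<close> and \<open>rk1_swap\<close> depend on m only through the parity of m - b, so
  the relation lifts unchanged. A pair is lifted as a whole: b is raised only if m - b is odd, so
  raising it from below m - 1 never reaches the two top indices.\<close>

lemma rk1_basis_eigen:
  "b \<le> m \<Longrightarrow> c \<le> m \<Longrightarrow>
   rk1 m (rk1_basis m b) c = qint (rk1_k m b) * rk1_basis m (rk1_swap m b) c"
proof (induction m arbitrary: c rule: less_induct)
  case (less m)
  show ?case
  proof (cases "b + 2 \<le> m")
    case True
    have e: "even (m - 2 - b) \<longleftrightarrow> even (m - b)" using True by auto
    then have k: "rk1_k (m - 2) b = rk1_k m b" "rk1_swap (m - 2) b = rk1_swap m b"
      by (simp_all add: rk1_k_def rk1_swap_def)
    have s: "rk1_swap m b + 2 \<le> m"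
    proof (cases "even (m - b)")
      case odd: False
      then have "m - b \<noteq> 2" using even_numeral by metis
      then show ?thesis using odd True by (simp add: rk1_swap_def)
    qed (use True in \<open>simp add: rk1_swap_def\<close>)
    have "rk1 m (rk1_basis m b) c = rk1_lift m (rk1 (m - 2) (rk1_basis (m - 2) b)) c"
      unfolding rk1_basis_step[OF True] using True less.prems by (intro rk1_lift_commute) auto
    also have "\<dots> = rk1_lift m (\<lambda>c. qint (rk1_k m b) * rk1_basis (m - 2) (rk1_swap m b) c) c"
      using True less.prems less.IH[of "m - 2"] by (intro rk1_lift_cong) (auto simp: k)
    also have "\<dots> = qint (rk1_k m b) * rk1_basis m (rk1_swap m b) c"
      unfolding rk1_lift_linear rk1_basis_step[OF s] ..
    finally show ?thesis .
  next
    case False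
    have top: "rk1_k m b = m \<and> (m = 0 \<or> odd (b + rk1_swap m b) \<and> \<not> rk1_swap m b + 2 \<le> m)"
    proof (cases "b = m")
      case True
      then show ?thesis by (cases m) (auto simp: rk1_k_def rk1_swap_def)
    next
      case neq: False
      then have "m = Suc b" using False less.prems by simp
      then show ?thesis by (simp add: rk1_k_def rk1_swap_def)
    qed
    show ?thesis
    proof (cases "m = 0")
      case True
      then show ?thesis using top less.prems by (simp add: rk1_def)
    next
      case m: False
      have s: "odd (b + rk1_swap m b)" "\<not> rk1_swap m b + 2 \<le> m" using top m by auto
      let ?b' = "rk1_swap m b"
      have par: "even (?b' + c) \<longleftrightarrow> odd (b + c)" for c using s(1) by auto
      show ?thesis
      proof (cases "even (?b' + c)")
        case True
        have "rk1 m (rk1_basis m b) c = qint m * inverse qv ^ ((m - c) * (m - c - 1) div 2)"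
          by (rule rk1_top[OF less.prems(2) True]) (rule ext, simp only: rk1_basis_top[OF False] par not_not)
        then show ?thesis using True less.prems top by (simp add: rk1_basis_top[OF s(2)])
      next
        case odd: False
        then have "odd (b + (c + 1))" "c > 0 \<Longrightarrow> odd (b + (c - 1))" using par[of c] by auto
        then have "rk1 m (rk1_basis m b) c = 0"
          by (cases c) (auto simp: rk1_def rk1_basis_top[OF False])
        then show ?thesis using odd by (simp add: rk1_basis_top[OF s(2)])
      qed
    qed
  qed
qed

text \<open>The diagonal coefficient of the lift has degree (2c + 3 - 2m) + (m - c - 1) + (m - c -
  2) = 0 in q and residue 1; the other one has degree 2 (c - m) - 1 < 0. For the top indices the
  exponent is 0 only at c = m - 1 and c = m, and parity selects the one equal to b.\<close>

lemma rk1_basis_lattice: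
  "b \<le> m \<Longrightarrow> c \<le> m \<Longrightarrow>
   rk1_basis m b c \<in> Ax \<and> residue (rk1_basis m b c) = (if c = b then 1 else 0)"
proof (induction m arbitrary: c rule: less_induct)
  case (less m)
  show ?case
  proof (cases "b + 2 \<le> m")
    case True
    let ?w = "rk1_basis (m - 2) b"
    let ?a = "qv powi (2 * int c + 3 - 2 * int m) * qint (m - c) * qint (m - c - 1)"
    let ?b = "qv powi (2 - 2 * int m) * qint (c - 1) * qint c"
    have IH: "c' \<le> m - 2 \<Longrightarrow> ?w c' \<in> Ax \<and> residue (?w c') = (if c' = b then 1 else 0)" for c'
      using less.IH[of "m - 2" c'] True by simp
    have 1: "?a * ?w c \<in> Ax \<and> residue (?a * ?w c) = (if c = b then 1 else 0)"
    proof (cases "c \<le> m - 2")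
      case le: True
      define r where "r = m - c - 2"
      have r: "m = Suc (Suc (c + r))" using True le by (simp add: r_def)
      obtain h where h: "qint (Suc (Suc r)) = qv ^ Suc r * h" "h \<in> Ax" "residue h = 1"
        using qint_asymp by blast
      obtain g where g: "qint (Suc r) = qv ^ r * g" "g \<in> Ax" "residue g = 1"
        using qint_asymp by blast
      have "qv powi (2 * int c + 3 - 2 * int m) * qv ^ Suc r * qv ^ r = 1"
        using r by (simp flip: power_int_add power_int_of_nat)
      moreover have "m - c = Suc (Suc r)" "m - c - 1 = Suc r" using r by auto
      ultimately have "?a = h * g" using h g by (simp add: mult_ac)
      then show ?thesis using h g IH[OF le] by (auto simp: residue_mult)
    next
      case False
      then have "qint (m - c) * qint (m - c - 1) = 0" using less.prems by auto
      then have "?a = 0" by auto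
      then show ?thesis using False True by auto
    qed
    have 2: "?b * ?w (c - 2) \<in> Ax \<and> residue (?b * ?w (c - 2)) = 0"
    proof (cases "c < 2")
      case True
      then have "c - 1 = 0" by simp
      then show ?thesis by simp
    next
      case False
      define r e where "r = c - 2" and "e = m - c"
      have r: "c = Suc (Suc r)" and e: "m = Suc (Suc (r + e))"
        using False less.prems by (simp_all add: r_def e_def)
      obtain h where h: "qint (Suc (Suc r)) = qv ^ Suc r * h" "h \<in> Ax" "residue h = 1"
        using qint_asymp by blast
      obtain g where g: "qint (Suc r) = qv ^ r * g" "g \<in> Ax" "residue g = 1"
        using qint_asymp by blast
      have "qv powi (2 - 2 * int m) * qv ^ Suc r * qv ^ r = inverse qv ^ Suc (2 * e)"
      proof -
        have "2 - 2 * int m + int (Suc r) + int r = - int (Suc (2 * e))" using e by simp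
        then have "qv powi (2 - 2 * int m + int (Suc r) + int r) = inverse qv ^ Suc (2 * e)"
          by (simp only: qv_powi_minus)
        then show ?thesis
          by (simp only: power_int_add power_int_of_nat qv_nonzero simp_thms)
      qed
      then have "?b = inverse qv ^ Suc (2 * e) * (h * g)" using h g r by (simp add: mult_ac)
      moreover have "?w (c - 2) \<in> Ax" using IH[of "c - 2"] less.prems by simp
      ultimately show ?thesis using h g by (auto simp: residue_mult residue_power)
    qed
    show ?thesis
      unfolding rk1_basis_step[OF True] rk1_lift_def using 1 2 by (auto simp: residue_diff)
  next
    case False
    have *: "(m - c) * (m - c - 1) div 2 = 0 \<longleftrightarrow> m - c \<le> 1"
    proof -
      obtain r where "m - c = r" by simp
      moreover have "r * (r - 1) div 2 = 0 \<longleftrightarrow> r \<le> 1"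
      proof (cases r)
        case (Suc r')
        then show ?thesis using triangular_Suc[of r'] by auto
      qed simp
      ultimately show ?thesis by simp
    qed
    define E where "E = (m - c) * (m - c - 1) div 2"
    have "c = b \<or> even (b + c) \<and> E \<noteq> 0 \<or> odd (b + c)"
      unfolding E_def * using False less.prems by presburger
    moreover have "c = b \<Longrightarrow> E = 0" unfolding E_def * using False by simp
    ultimately show ?thesis
      using less.prems unfolding rk1_basis_top[OF False] E_def[symmetric]
      by (auto simp: qinv_power_residue)
  qed
qed

section \<open>Lattice bases and operators permuting them\<close>

text \<open>Congruence to the standard basis modulo q^-1, up to nonzero factors d. The factors are
  needed because the adapted bases at the affine node reduce to powers of x times crystal basis
  elements.\<close>

definition lattice_basis :: "'b set \<Rightarrow> ('b \<Rightarrow> Cx) \<Rightarrow> ('b \<Rightarrow> 'b vec) \<Rightarrow> bool" where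
  "lattice_basis S d w \<longleftrightarrow> finite S \<and> (\<forall>a\<in>S. w a \<in> vspace S \<and> d a \<noteq> 0 \<and>
     (\<forall>b\<in>S. w a b \<in> Ax \<and> residue (w a b) = (if b = a then d a else 0)))"

text \<open>If k a = 0 the operator kills w a and \<sigma> a carries no information, so the
  involution property is demanded only for k a nonzero.\<close>

definition eigen_swap :: "'b set \<Rightarrow> ('b vec \<Rightarrow> 'b vec) \<Rightarrow> ('b \<Rightarrow> nat) \<Rightarrow> ('b \<Rightarrow> 'b) \<Rightarrow>
    ('b \<Rightarrow> 'b vec) \<Rightarrow> bool" where
  "eigen_swap S B k \<sigma> w \<longleftrightarrow> (\<forall>a\<in>S. \<sigma> a \<in> S \<and> B (w a) = (\<lambda>c. qint (k a) * w (\<sigma> a) c) \<and>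
     (k a \<noteq> 0 \<longrightarrow> k (\<sigma> a) = k a \<and> \<sigma> (\<sigma> a) = a))"

definition lincomb :: "'b set \<Rightarrow> ('b \<Rightarrow> Cqx) \<Rightarrow> ('b \<Rightarrow> 'c vec) \<Rightarrow> 'c vec" where
  "lincomb S c w = (\<lambda>x. \<Sum>a\<in>S. c a * w a x)"

definition lin_op :: "('b vec \<Rightarrow> 'c vec) \<Rightarrow> bool" where
  "lin_op B \<longleftrightarrow> (\<forall>v w. B (\<lambda>x. v x + w x) = (\<lambda>y. B v y + B w y)) \<and>
     (\<forall>a v. B (\<lambda>x. a * v x) = (\<lambda>y. a * B v y))"

lemma lin_op_smult: "lin_op B \<Longrightarrow> B (\<lambda>x. a * v x) = (\<lambda>y. a * B v y)"
  by (simp add: lin_op_def)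

lemma lin_op_add: "lin_op B \<Longrightarrow> B (\<lambda>x. v x + w x) = (\<lambda>y. B v y + B w y)"
  by (simp add: lin_op_def)

lemma lin_op_0: "lin_op B \<Longrightarrow> B (\<lambda>x. 0) = (\<lambda>y. 0)"
  using lin_op_smult[of B 0 "\<lambda>x. 0"] by simp

lemma lin_op_lincomb: "lin_op B \<Longrightarrow> B (lincomb S c w) = lincomb S c (\<lambda>a. B (w a))"
  unfolding lincomb_def
proof (induction S rule: infinite_finite_induct)
  case (insert a S)
  have "B (\<lambda>x. c a * w a x + (\<Sum>a\<in>S. c a * w a x))
      = (\<lambda>y. B (\<lambda>x. c a * w a x) y + B (\<lambda>x. \<Sum>a\<in>S. c a * w a x) y)"
    by (rule lin_op_add[OF insert.prems])
  also have "B (\<lambda>x. c a * w a x) = (\<lambda>y. c a * B (w a) y)"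
    by (rule lin_op_smult[OF insert.prems])
  also note insert.IH[OF insert.prems]
  finally show ?case using insert.hyps by simp
qed (simp_all add: lin_op_0)

lemma lin_op_lin: "lin_op (lin S M)"
  by (auto simp: lin_op_def lin_def algebra_simps sum.distrib sum_distrib_left)

lemma lincomb_cong:
  "(\<And>a. a \<in> S \<Longrightarrow> c a = c' a) \<Longrightarrow> (\<And>a. a \<in> S \<Longrightarrow> w a = w' a) \<Longrightarrow> lincomb S c w = lincomb S c' w'"
  by (simp add: lincomb_def cong: sum.cong)

lemma lincomb_smult: "(\<lambda>x. t * lincomb S c w x) = lincomb S (\<lambda>a. t * c a) w"
  by (simp add: lincomb_def sum_distrib_left mult.assoc)

lemma lincomb_lincomb:
  "lincomb S c (\<lambda>a. lincomb S (C a) w) = lincomb S (\<lambda>b. \<Sum>a\<in>S. c a * C a b) w"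
proof
  fix x
  have "lincomb S c (\<lambda>a. lincomb S (C a) w) x = (\<Sum>a\<in>S. \<Sum>b\<in>S. c a * C a b * w b x)"
    by (simp add: lincomb_def sum_distrib_left mult.assoc)
  also have "\<dots> = (\<Sum>b\<in>S. \<Sum>a\<in>S. c a * C a b * w b x)"
    by (rule sum.swap)
  finally show "lincomb S c (\<lambda>a. lincomb S (C a) w) x = lincomb S (\<lambda>b. \<Sum>a\<in>S. c a * C a b) w x"
    by (simp add: lincomb_def sum_distrib_right)
qed

lemma lincomb_bvec:
  assumes "finite S" "v \<in> vspace S"
  shows "v = lincomb S v bvec"
proof
  fix x
  have "lincomb S v bvec x = (\<Sum>a\<in>S. if x = a then v a else 0)"
    unfolding lincomb_def bvec_def by (intro sum.cong) auto
  then show "v x = lincomb S v bvec x"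
    using assms by (auto simp: vspace_def)
qed

lemma lattice_basisD:
  assumes "lattice_basis S d w"
  shows "finite S" "a \<in> S \<Longrightarrow> w a \<in> vspace S" "a \<in> S \<Longrightarrow> d a \<noteq> 0"
    "a \<in> S \<Longrightarrow> b \<in> S \<Longrightarrow> w a b \<in> Ax"
    "a \<in> S \<Longrightarrow> b \<in> S \<Longrightarrow> residue (w a b) = (if b = a then d a else 0)"
  using assms by (auto simp: lattice_basis_def)

lemma lincomb_vspace: "(\<And>a. a \<in> S \<Longrightarrow> w a \<in> vspace T) \<Longrightarrow> lincomb S c w \<in> vspace T"
  by (auto simp: lincomb_def vspace_def)

lemma residue_lincomb:
  assumes w: "lattice_basis S d w" and "b \<in> S" and c: "\<And>a. a \<in> S \<Longrightarrow> c a \<in> Ax"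
  shows "residue (lincomb S c w b) = residue (c b) * d b"
proof -
  have "residue (lincomb S c w b) = (\<Sum>a\<in>S. residue (c a) * (if b = a then d a else 0))"
    unfolding lincomb_def residue_sum
    using assms(2) c lattice_basisD[OF w] by (intro sum.cong) (simp_all add: residue_mult)
  also have "\<dots> = (\<Sum>a\<in>S. if b = a then residue (c a) * d a else 0)"
    by (intro sum.cong) auto
  also have "\<dots> = residue (c b) * d b"
    using assms(2) lattice_basisD(1)[OF w] by simp
  finally show ?thesis .
qed

text \<open>Nakayama's lemma, by Gaussian elimination with pivots that are units modulo \<open>q\<inverse>\<close>.\<close>

lemma lattice_basis_elimination:
  assumes w: "lattice_basis S d w" and "F \<subseteq> S"
  shows "\<exists>C. \<forall>a\<in>S. (\<forall>b. C a b \<in> Ax) \<and>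
    (\<forall>b\<in>S. lincomb S (C a) w b \<in> Ax \<and> residue (lincomb S (C a) w b) = (if b = a then 1 else 0)) \<and>
    (\<forall>b\<in>F. lincomb S (C a) w b = (if b = a then 1 else 0))"
  (is "\<exists>C. ?P F C")
proof -
  have "finite F" using assms lattice_basisD(1) finite_subset by blast
  then show ?thesis using \<open>F \<subseteq> S\<close>
  proof (induction F)
    case empty
    define C where "C a b = (if b = a then cst (inverse (d a)) else 0)" for a b
    have "lincomb S (C a) w b = cst (inverse (d a)) * w a b" if "a \<in> S" for a b
    proof -
      have "lincomb S (C a) w b = (\<Sum>a'\<in>S. if a = a' then cst (inverse (d a)) * w a' b else 0)"
        unfolding lincomb_def C_def by (intro sum.cong) auto
      then show ?thesis using that lattice_basisD(1)[OF w] by simp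
    qed
    moreover have "C a b \<in> Ax" for a b by (simp add: C_def)
    ultimately show ?case
      using lattice_basisD[OF w] by (intro exI[of _ C]) (simp add: residue_mult)
  next
    case (insert y F)
    have y: "y \<in> S" and F: "F \<subseteq> S" using insert.prems by simp_all
    from insert.IH[OF F] obtain C where "?P F C" by (rule exE)
    then have C: "\<And>a b. a \<in> S \<Longrightarrow> C a b \<in> Ax"
      "\<And>a b. a \<in> S \<Longrightarrow> b \<in> S \<Longrightarrow> lincomb S (C a) w b \<in> Ax"
      "\<And>a b. a \<in> S \<Longrightarrow> b \<in> S \<Longrightarrow> residue (lincomb S (C a) w b) = (if b = a then 1 else 0)"
      "\<And>a b. a \<in> S \<Longrightarrow> b \<in> F \<Longrightarrow> lincomb S (C a) w b = (if b = a then 1 else 0)"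
      by blast+
    define p where "p = inverse (lincomb S (C y) w y)"
    have p: "p \<in> Ax" "residue p = 1"
      unfolding p_def using Ax_inverse[of "lincomb S (C y) w y"] C y by simp_all
    have py: "p * lincomb S (C y) w y = 1"
    proof -
      have "lincomb S (C y) w y \<noteq> 0" using C(3)[OF y y] by auto
      then show ?thesis by (simp add: p_def)
    qed
    \<comment> \<open>The multiple of row y to be added to row a: it clears column y, and for a = y
      it turns the pivot into 1. Its residue is 0, so the rows keep their reductions.\<close>
    define t where "t a = (if a = y then p - 1 else - (lincomb S (C a) w y * p))" for a
    have t: "t a \<in> Ax" "residue (t a) = 0" if "a \<in> S" for a
      using C y p that by (auto simp: t_def residue_mult residue_diff residue_uminus)
    define C' where "C' a b = C a b + t a * C y b" for a b
    have C': "lincomb S (C' a) w b = lincomb S (C a) w b + t a * lincomb S (C y) w b" for a b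
      by (simp add: C'_def lincomb_def sum.distrib distrib_right sum_distrib_left mult.assoc)
    have "lincomb S (C' a) w b = (if b = a then 1 else 0)" if "a \<in> S" "b \<in> insert y F" for a b
    proof (cases "b = y")
      case True
      have "z - z * p * l = z * (1 - p * l)" for z l :: Cqx by (simp add: algebra_simps)
      then have "z - z * p * lincomb S (C y) w y = 0" for z using py by simp
      then show ?thesis using True py by (auto simp: C' t_def algebra_simps)
    next
      case False
      then have "b \<in> F" using that by simp
      moreover have "lincomb S (C y) w b = 0" using C(4)[OF y \<open>b \<in> F\<close>] False by simp
      ultimately show ?thesis using C(4)[OF that(1)] by (simp add: C')
    qed
    moreover have "lincomb S (C' a) w b \<in> Ax \<and> residue (lincomb S (C' a) w b) = (if b = a then 1 else 0)"
      if "a \<in> S" "b \<in> S" for a b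
      using C(2,3)[OF that] C(2,3)[OF y that(2)] t[OF that(1)]
      by (simp add: C' residue_add residue_mult)
    moreover have "C' a b \<in> Ax" if "a \<in> S" for a b
      using C(1) y that t by (simp add: C'_def)
    ultimately show ?case by (intro exI[of _ C']) blast
  qed
qed

lemma lattice_basis_expand:
  assumes w: "lattice_basis S d w" and v: "v \<in> vspace S"
  obtains c where "v = lincomb S c w" "(\<forall>a\<in>S. v a \<in> Ax) \<Longrightarrow> (\<forall>a\<in>S. c a \<in> Ax)"
proof -
  obtain C where C: "\<And>a b. a \<in> S \<Longrightarrow> C a b \<in> Ax"
      "\<And>a b. a \<in> S \<Longrightarrow> b \<in> S \<Longrightarrow> lincomb S (C a) w b = (if b = a then 1 else 0)"
    using lattice_basis_elimination[OF w order_refl] by metis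
  have "lincomb S (C a) w = bvec a" if "a \<in> S" for a
  proof
    fix b
    show "lincomb S (C a) w b = bvec a b"
      using C(2)[OF that, of b] lincomb_vspace[of S w S "C a"] lattice_basisD(2)[OF w] that
      by (cases "b \<in> S") (auto simp: bvec_def vspace_def)
  qed
  then have "lincomb S v (\<lambda>a. lincomb S (C a) w) = lincomb S v bvec"
    by (intro lincomb_cong) simp_all
  then have "v = lincomb S v (\<lambda>a. lincomb S (C a) w)"
    using lincomb_bvec[OF lattice_basisD(1)[OF w] v] by simp
  then have "v = lincomb S (\<lambda>b. \<Sum>a\<in>S. v a * C a b) w"
    unfolding lincomb_lincomb .
  moreover have "\<forall>b\<in>S. (\<Sum>a\<in>S. v a * C a b) \<in> Ax" if "\<forall>a\<in>S. v a \<in> Ax"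
    using that C(1) by auto
  ultimately show ?thesis using that by blast
qed

text \<open>A nontrivial relation, rescaled by a power of q so that its coefficients lie in
  \<open>Ax\<close> and not all of their residues vanish, would reduce to a nonzero vector.\<close>

lemma lattice_basis_independent:
  assumes w: "lattice_basis S d w" and 0: "\<And>b. b \<in> S \<Longrightarrow> lincomb S c w b = 0" and "a \<in> S"
  shows "c a = 0"
proof (rule ccontr)
  assume "c a \<noteq> 0"
  then obtain t where t: "\<And>b. b \<in> S \<Longrightarrow> qv powi t * c b \<in> Ax" "\<exists>b\<in>S. residue (qv powi t * c b) \<noteq> 0"
    using normalise_family[of S a c] lattice_basisD(1)[OF w] \<open>a \<in> S\<close> by metis
  obtain b where b: "b \<in> S" "residue (qv powi t * c b) \<noteq> 0" using t(2) by blast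
  have "lincomb S (\<lambda>b. qv powi t * c b) w b = 0"
    using 0[OF b(1)] by (simp flip: lincomb_smult)
  then have "residue (qv powi t * c b) * d b = 0"
    using residue_lincomb[OF w b(1), of "\<lambda>b. qv powi t * c b"] t(1) by simp
  then show False using b lattice_basisD(3)[OF w] by simp
qed

lemma lattice_basis_eqD:
  assumes w: "lattice_basis S d w" and eq: "lincomb S c w = lincomb S c' w" and "a \<in> S"
  shows "c a = c' a"
proof -
  have "lincomb S (\<lambda>a. c a - c' a) w b = 0" for b
    using fun_cong[OF eq, of b] by (simp add: lincomb_def left_diff_distrib sum_subtractf)
  then show ?thesis using lattice_basis_independent[OF w _ assms(3), of "\<lambda>a. c a - c' a"] by simp
qed

lemma eigen_swap_square:
  assumes "lin_op B" "eigen_swap S B k \<sigma> w" "a \<in> S"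
  shows "B (B (w a)) = (\<lambda>x. qint (k a) ^ 2 * w a x)"
proof (cases "k a = 0")
  case True
  then show ?thesis
    using assms by (simp add: eigen_swap_def lin_op_0[OF assms(1)])
next
  case False
  then have "B (B (w a)) = (\<lambda>x. qint (k a) * (qint (k a) * w a x))"
    using assms by (simp add: eigen_swap_def lin_op_smult[OF assms(1), of "qint (k a)"])
  then show ?thesis by (simp add: power2_eq_square mult.assoc)
qed

text \<open>Applying the squares of the operators shows that the coordinates c of the image of w a
  satisfy [k a]^2 c y = [k' y]^2 c y, so only y with k' y = k a occur. On these, B' produces the
  same factor [k a] that B produces on w a. It cancels exactly and leaves the image of w (\<sigma>
  a) with the coordinates permuted by \<sigma>'; residues are taken after the cancellation.\<close>

lemma intertwiner_residue:
  fixes S :: "'b set"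
  assumes B: "lin_op B" and B': "lin_op B'"
    and w: "lattice_basis S d w" and w': "lattice_basis S d' w'"
    and e: "eigen_swap S B k \<sigma> w" and e': "eigen_swap S B' k' \<sigma>' w'"
    and M: "\<And>a. a \<in> S \<Longrightarrow> M a \<in> vspace S" "\<And>a b. a \<in> S \<Longrightarrow> b \<in> S \<Longrightarrow> M a b \<in> Ax"
    and f: "\<And>v. v \<in> vspace S \<Longrightarrow> lin S M (B v) = B' (lin S M v)"
    and a: "a \<in> S" and b: "b \<in> S"
  shows "residue (M a b) \<noteq> 0 \<Longrightarrow> k a = k' b"
    and "k a = k' b \<Longrightarrow> k a \<noteq> 0 \<Longrightarrow>
      residue (M (\<sigma> a) (\<sigma>' b)) * d (\<sigma> a) * d' b = residue (M a b) * d a * d' (\<sigma>' b)"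
proof -
  let ?f = "lin S M"
  have lf: "lin_op ?f" by (rule lin_op_lin)
  have fv: "?f v \<in> vspace S" for v using M(1) by (auto simp: lin_def vspace_def)
  have fw: "residue (?f (w x) y) = d x * residue (M x y)" "?f (w x) y \<in> Ax" if "x \<in> S" "y \<in> S" for x y
  proof -
    have "residue (?f (w x) y) = (\<Sum>z\<in>S. (if x = z then d x * residue (M x y) else 0))"
      unfolding lin_def residue_sum
      using lattice_basisD[OF w] M that by (intro sum.cong) (auto simp: residue_mult)
    then show "residue (?f (w x) y) = d x * residue (M x y)"
      using lattice_basisD(1)[OF w] that by simp
    show "?f (w x) y \<in> Ax"
      unfolding lin_def using lattice_basisD[OF w] M that by auto
  qed
  have \<sigma>: "\<sigma> a \<in> S" and Bw: "B (w a) = (\<lambda>c. qint (k a) * w (\<sigma> a) c)" using e a by (auto simp: eigen_swap_def)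
  have Bv: "B (w a) \<in> vspace S" using lattice_basisD(2)[OF w \<sigma>] by (auto simp: Bw vspace_def)
  obtain c where c: "?f (w a) = lincomb S c w'" "\<forall>x\<in>S. c x \<in> Ax"
    using lattice_basis_expand[OF w' fv, of "w a"] fw(2)[OF a] by metis
  have rc: "residue (c y) * d' y = d a * residue (M a y)" if "y \<in> S" for y
    using residue_lincomb[OF w' that, of c] c fw(1)[OF a that] by simp
  have "?f (B (B (w a))) = B' (B' (?f (w a)))"
    using f[OF Bv] f[OF lattice_basisD(2)[OF w a]] by simp
  then have "(\<lambda>x. qint (k a) ^ 2 * ?f (w a) x) = B' (B' (?f (w a)))"
    unfolding eigen_swap_square[OF B e a] lin_op_smult[OF lf] .
  also have "\<dots> = lincomb S c (\<lambda>y x. qint (k' y) ^ 2 * w' y x)"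
    unfolding c(1) lin_op_lincomb[OF B'] using eigen_swap_square[OF B' e']
    by (intro lincomb_cong) auto
  also have "\<dots> = lincomb S (\<lambda>y. c y * qint (k' y) ^ 2) w'"
    by (simp add: lincomb_def mult.assoc)
  finally have "lincomb S (\<lambda>y. qint (k a) ^ 2 * c y) w' = lincomb S (\<lambda>y. c y * qint (k' y) ^ 2) w'"
    by (simp only: c(1) lincomb_smult)
  then have "qint (k a) ^ 2 * c y = c y * qint (k' y) ^ 2" if "y \<in> S" for y
    using lattice_basis_eqD[OF w' _ that] by meson
  then have H: "c y = 0 \<or> qint (k a) ^ 2 = qint (k' y) ^ 2" if "y \<in> S" for y
    using that by (metis mult.commute mult_right_cancel)
  have c0: "k a = k' y" if "y \<in> S" "c y \<noteq> 0" for y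
    using H[OF that(1)] that(2) by (simp add: qint_square_eq_iff)
  show "residue (M a b) \<noteq> 0 \<Longrightarrow> k a = k' b"
    using c0[OF b] rc[OF b] lattice_basisD(3)[OF w a] by fastforce
  assume k: "k a = k' b" and k0: "k a \<noteq> 0"
  have "(\<lambda>x. qint (k a) * ?f (w (\<sigma> a)) x) = B' (?f (w a))"
    using f[OF lattice_basisD(2)[OF w a]] by (simp add: Bw lin_op_smult[OF lf])
  also have "\<dots> = lincomb S c (\<lambda>y x. qint (k' y) * w' (\<sigma>' y) x)"
    unfolding c(1) lin_op_lincomb[OF B'] using e'
    by (intro lincomb_cong) (auto simp: eigen_swap_def)
  also have "\<dots> = (\<lambda>x. qint (k a) * lincomb S c (\<lambda>y. w' (\<sigma>' y)) x)"
    unfolding lincomb_def sum_distrib_left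
  proof (intro ext sum.cong refl)
    fix x y assume "y \<in> S"
    then show "c y * (qint (k' y) * w' (\<sigma>' y) x) = qint (k a) * (c y * w' (\<sigma>' y) x)"
      using c0 by (cases "c y = 0") auto
  qed
  finally have "?f (w (\<sigma> a)) = lincomb S c (\<lambda>y. w' (\<sigma>' y))"
    using k0 by (auto simp: fun_eq_iff)
  then have "residue (?f (w (\<sigma> a)) (\<sigma>' b)) = (\<Sum>y\<in>S. residue (c y * w' (\<sigma>' y) (\<sigma>' b)))"
    by (simp add: lincomb_def residue_sum)
  also have "\<dots> = (\<Sum>y\<in>S. if b = y then residue (c b) * d' (\<sigma>' b) else 0)"
  proof (intro sum.cong refl)
    fix y assume y: "y \<in> S"
    show "residue (c y * w' (\<sigma>' y) (\<sigma>' b)) = (if b = y then residue (c b) * d' (\<sigma>' b) else 0)"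
    proof (cases "c y = 0")
      case False
      \<comment> \<open>Where k' is nonzero \<sigma>' is an involution, hence injective; so the only
        contribution at \<sigma>' b comes from y = b.\<close>
      then have "k' y \<noteq> 0" "k' b \<noteq> 0" using c0[OF y] k k0 by auto
      then have "\<sigma>' b = \<sigma>' y \<longleftrightarrow> b = y" using e' y b by (metis eigen_swap_def)
      then show ?thesis
        using y b e' c(2) lattice_basisD(4,5)[OF w'] by (auto simp: residue_mult eigen_swap_def)
    qed auto
  qed
  also have "\<dots> = residue (c b) * d' (\<sigma>' b)"
    using b lattice_basisD(1)[OF w'] by simp
  finally have "d (\<sigma> a) * residue (M (\<sigma> a) (\<sigma>' b)) = residue (c b) * d' (\<sigma>' b)"
    using fw(1)[OF \<sigma>] b e' by (simp add: eigen_swap_def)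
  then have "residue (M (\<sigma> a) (\<sigma>' b)) * d (\<sigma> a) * d' b = residue (c b) * d' b * d' (\<sigma>' b)"
    by (metis mult.commute mult.assoc)
  then show "residue (M (\<sigma> a) (\<sigma>' b)) * d (\<sigma> a) * d' b = residue (M a b) * d a * d' (\<sigma>' b)"
    unfolding rc[OF b] by (simp only: mult.commute)
qed

section \<open>Subspaces stable under an operator with an adapted basis\<close>

definition subspace_of :: "'b set \<Rightarrow> 'b vec set \<Rightarrow> bool" where
  "subspace_of S N \<longleftrightarrow> N \<subseteq> vspace S \<and> (\<lambda>_. 0) \<in> N \<and>
     (\<forall>v\<in>N. \<forall>u\<in>N. \<forall>t. (\<lambda>x. t * v x + u x) \<in> N)"

lemma subspace_smult: "subspace_of S N \<Longrightarrow> v \<in> N \<Longrightarrow> (\<lambda>x. t * v x) \<in> N"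
  by (metis (no_types, lifting) add_0_right subspace_of_def ext)

lemma subspace_lincomb:
  assumes N: "subspace_of S N" and "\<And>a. a \<in> T \<Longrightarrow> w a \<in> N"
  shows "lincomb T c w \<in> N"
  using assms(2) unfolding lincomb_def
proof (induction T rule: infinite_finite_induct)
  case (insert a T)
  then show ?case using N by (simp add: subspace_of_def)
qed (use N in \<open>auto simp: subspace_of_def\<close>)

text \<open>The form of membership that survives a change of node: the adapted bases of different
  nodes differ, but agree modulo q^-1 up to nonzero factors.\<close>

definition reaches :: "'b set \<Rightarrow> 'b vec set \<Rightarrow> 'b \<Rightarrow> bool" where
  "reaches S N a \<longleftrightarrow> (\<exists>v\<in>N. \<exists>t. t \<noteq> 0 \<and>
     (\<forall>b\<in>S. v b \<in> Ax \<and> residue (v b) = (if b = a then t else 0)))"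

lemma reaches_all:
  assumes "finite S" "subspace_of S N" "\<And>a. a \<in> S \<Longrightarrow> reaches S N a"
  shows "N = vspace S"
proof -
  obtain w t where w: "\<And>a. a \<in> S \<Longrightarrow> w a \<in> N \<and> t a \<noteq> 0 \<and>
     (\<forall>b\<in>S. w a b \<in> Ax \<and> residue (w a b) = (if b = a then t a else 0))"
    using assms(3) unfolding reaches_def by metis
  then have L: "lattice_basis S t w"
    using assms(1,2) by (auto simp: lattice_basis_def subspace_of_def)
  have "v \<in> N" if "v \<in> vspace S" for v
    using lattice_basis_expand[OF L that] subspace_lincomb[OF assms(2)] w by metis
  then show ?thesis using assms(2) by (auto simp: subspace_of_def)
qed

text \<open>The component of v with eigenvalue [k a]^2 under the square of B is a polynomial in that
  square applied to v, up to a nonzero scalar, so it lies in N. In adapted coordinates the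
  projection merely deletes coefficients and keeps the congruence. Applying B and dividing by [k a]
  then replaces each remaining w b by w (\<sigma> b).\<close>

lemma reaches_swap:
  assumes B: "lin_op B" and w: "lattice_basis S d w" and e: "eigen_swap S B k \<sigma> w"
    and N: "subspace_of S N" and NB: "\<And>v. v \<in> N \<Longrightarrow> B v \<in> N"
    and a: "a \<in> S" "k a \<noteq> 0" and r: "reaches S N a"
  shows "reaches S N (\<sigma> a)"
proof -
  obtain v t where v: "v \<in> N" "t \<noteq> 0" "\<And>b. b \<in> S \<Longrightarrow> v b \<in> Ax"
    "\<And>b. b \<in> S \<Longrightarrow> residue (v b) = (if b = a then t else 0)"
    using r by (auto simp: reaches_def)
  obtain c where c: "v = lincomb S c w" "\<forall>b\<in>S. c b \<in> Ax"
    using lattice_basis_expand[OF w, of v] v N by (metis subsetD subspace_of_def)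
  have rc: "residue (c b) * d b = (if b = a then t else 0)" if "b \<in> S" for b
    using residue_lincomb[OF w that, of c] c v(4)[OF that] by simp
  have poly: "lincomb S (\<lambda>b. c b * (\<Prod>j\<in>J. qint (k b) ^ 2 - qint j ^ 2)) w \<in> N" if "finite J" for J :: "nat set"
    using that
  proof (induction J)
    case empty
    then show ?case using c v by simp
  next
    case (insert j J)
    define c' where "c' = (\<lambda>b. c b * (\<Prod>j\<in>J. qint (k b) ^ 2 - qint j ^ 2))"
    have v': "lincomb S c' w \<in> N" using insert.IH unfolding c'_def .
    have "B (B (lincomb S c' w)) = lincomb S c' (\<lambda>b x. qint (k b) ^ 2 * w b x)"
      unfolding lin_op_lincomb[OF B] using eigen_swap_square[OF B e] by (intro lincomb_cong) auto
    also have "\<dots> = lincomb S (\<lambda>b. c' b * qint (k b) ^ 2) w"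
      by (simp add: lincomb_def mult.assoc)
    finally have "lincomb S (\<lambda>b. c' b * qint (k b) ^ 2) w \<in> N" using NB[OF NB[OF v']] by simp
    then have "(\<lambda>x. - (qint j ^ 2) * lincomb S c' w x + lincomb S (\<lambda>b. c' b * qint (k b) ^ 2) w x) \<in> N"
      using v' N by (simp only: subspace_of_def)
    also have "(\<lambda>x. - (qint j ^ 2) * lincomb S c' w x + lincomb S (\<lambda>b. c' b * qint (k b) ^ 2) w x)
        = lincomb S (\<lambda>b. - (qint j ^ 2) * c' b + c' b * qint (k b) ^ 2) w"
      by (simp only: lincomb_def sum_distrib_left distrib_right sum.distrib mult.assoc)
    finally have "lincomb S (\<lambda>b. - (qint j ^ 2) * c' b + c' b * qint (k b) ^ 2) w \<in> N" .
    moreover have "- (qint j ^ 2) * c' b + c' b * qint (k b) ^ 2 = c b * (\<Prod>j\<in>insert j J. qint (k b) ^ 2 - qint j ^ 2)" for b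
      using insert.hyps by (simp add: c'_def algebra_simps)
    ultimately show ?case by (simp only:)
  qed
  \<comment> \<open>One factor for every other eigenvalue. On coordinates with eigenvalue [k a]^2
    the product is the constant z, nonzero because the squares [j]^2 are distinct; on all others it
    vanishes.\<close>
  define J where "J = k ` S - {k a}"
  have J: "finite J" using lattice_basisD(1)[OF w] by (simp add: J_def)
  define z where "z = (\<Prod>j\<in>J. qint (k a) ^ 2 - qint j ^ 2)"
  have z: "z \<noteq> 0" using J by (auto simp: z_def J_def qint_square_eq_iff)
  have "c b * (\<Prod>j\<in>J. qint (k b) ^ 2 - qint j ^ 2) = z * (if k b = k a then c b else 0)" if "b \<in> S" for b
  proof (cases "k b = k a")
    case False
    then have "k b \<in> J" using that by (simp add: J_def)
    then have "(\<Prod>j\<in>J. qint (k b) ^ 2 - qint j ^ 2) = 0" using J by (intro prod_zero) auto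
    then show ?thesis using False by simp
  qed (simp add: z_def)
  then have "lincomb S (\<lambda>b. c b * (\<Prod>j\<in>J. qint (k b) ^ 2 - qint j ^ 2)) w
     = (\<lambda>x. z * lincomb S (\<lambda>b. if k b = k a then c b else 0) w x)"
    unfolding lincomb_smult by (intro lincomb_cong) auto
  then have "(\<lambda>x. z * lincomb S (\<lambda>b. if k b = k a then c b else 0) w x) \<in> N" using poly[OF J] by simp
  from subspace_smult[OF N this, of "inverse z"]
  have u: "lincomb S (\<lambda>b. if k b = k a then c b else 0) w \<in> N"
    using z by (simp add: mult.assoc[symmetric])
  have "B (lincomb S (\<lambda>b. if k b = k a then c b else 0) w)
    = lincomb S (\<lambda>b. if k b = k a then c b else 0) (\<lambda>b x. qint (k b) * w (\<sigma> b) x)"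
    unfolding lin_op_lincomb[OF B] using e by (intro lincomb_cong) (auto simp: eigen_swap_def)
  also have "\<dots> = (\<lambda>x. qint (k a) * lincomb S (\<lambda>b. if k b = k a then c b else 0) (\<lambda>b. w (\<sigma> b)) x)"
    unfolding lincomb_def sum_distrib_left by (intro ext sum.cong) auto
  finally have "(\<lambda>x. qint (k a) * lincomb S (\<lambda>b. if k b = k a then c b else 0) (\<lambda>b. w (\<sigma> b)) x) \<in> N"
    using NB[OF u] by simp
  from subspace_smult[OF N this, of "inverse (qint (k a))"]
  have u': "lincomb S (\<lambda>b. if k b = k a then c b else 0) (\<lambda>b. w (\<sigma> b)) \<in> N" (is "?u \<in> N")
    using a by (simp add: mult.assoc[symmetric])
  have \<sigma>: "\<sigma> b \<in> S" if "b \<in> S" for b using e that by (auto simp: eigen_swap_def)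
  have "?u b \<in> Ax \<and> residue (?u b) = (if b = \<sigma> a then residue (c a) * d (\<sigma> a) else 0)" if "b \<in> S" for b
  proof
    show "?u b \<in> Ax"
      unfolding lincomb_def using c(2) lattice_basisD(4)[OF w \<sigma> that] by auto
    have "residue (?u b) = (\<Sum>y\<in>S. if a = y then (if b = \<sigma> a then residue (c a) * d (\<sigma> a) else 0) else 0)"
      unfolding lincomb_def residue_sum
    proof (intro sum.cong refl)
      fix y assume y: "y \<in> S"
      have "residue (c y) = 0" if "a \<noteq> y" using rc[OF y] that lattice_basisD(3)[OF w y] by auto
      then show "residue ((if k y = k a then c y else 0) * w (\<sigma> y) b)
         = (if a = y then (if b = \<sigma> a then residue (c a) * d (\<sigma> a) else 0) else 0)"
        using c(2) y lattice_basisD(4,5)[OF w \<sigma>[OF y] that] by (auto simp: residue_mult)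
    qed
    then show "residue (?u b) = (if b = \<sigma> a then residue (c a) * d (\<sigma> a) else 0)"
      using a lattice_basisD(1)[OF w] by simp
  qed
  moreover have "residue (c a) * d (\<sigma> a) \<noteq> 0"
    using rc[OF a(1)] v(2) lattice_basisD(3)[OF w \<sigma>[OF a(1)]] by auto
  ultimately show ?thesis using u' unfolding reaches_def by blast
qed

section \<open>The coideal operators on compositions\<close>

text \<open>With \<open>j = i\<close>, \<open>j' = i + 1\<close> this is \<open>B\<^sub>i\<close> on \<open>W\<^sub>s\<close>, with \<open>j = i + 1\<close>, \<open>j' = i\<close> it is \<open>B\<^sub>i\<close> on
  \<open>W\<^sub>s\<^sup>\<or>\<close>; \<open>g\<close> is the spectral parameter at the affine node and 1 elsewhere.\<close>

definition node_op :: "nat \<Rightarrow> nat \<Rightarrow> Cqx \<Rightarrow> comp vec \<Rightarrow> comp vec" where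
  "node_op j j' g v = (\<lambda>c. inverse g * qint (c j') * v (c(j := c j + 1, j' := c j' - 1))
     + g * qv powi (1 - int (c j) + int (c j')) * qint (c j) * v (c(j := c j - 1, j' := c j' + 1)))"

definition node_k :: "nat \<Rightarrow> nat \<Rightarrow> comp \<Rightarrow> nat" where
  "node_k j j' a = (if even (a j) then a j' else a j' + 1)"

definition node_swap :: "nat \<Rightarrow> nat \<Rightarrow> comp \<Rightarrow> comp" where
  "node_swap j j' a = (if even (a j) then (if a j' = 0 then a else a(j := a j + 1, j' := a j' - 1))
     else a(j := a j - 1, j' := a j' + 1))"

definition same_string :: "nat \<Rightarrow> nat \<Rightarrow> comp \<Rightarrow> comp \<Rightarrow> bool" where
  "same_string j j' a c \<longleftrightarrow> (\<forall>l. l \<noteq> j \<and> l \<noteq> j' \<longrightarrow> c l = a l) \<and> c j + c j' = a j + a j'"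

text \<open>The factor \<open>g ^ c j\<close> gauges away the spectral parameter, so that
  \<open>node_op\<close> becomes \<open>rk1\<close> on each string, with the entry at j' as
  coordinate.\<close>

definition node_basis :: "nat \<Rightarrow> nat \<Rightarrow> Cqx \<Rightarrow> comp \<Rightarrow> comp vec" where
  "node_basis j j' g a = (\<lambda>c. if same_string j j' a c
     then g ^ c j * rk1_basis (a j + a j') (a j') (c j') else 0)"

lemma lin_op_node_op: "lin_op (node_op j j' g)"
  by (simp add: lin_op_def node_op_def algebra_simps)

lemma finite_comps: "finite (comps n s)"
proof -
  have "comps n s \<subseteq> {f. \<forall>i. (i \<in> {1..n} \<longrightarrow> f i \<in> {0..s}) \<and> (i \<notin> {1..n} \<longrightarrow> f i = 0)}"
  proof
    fix f assume f: "f \<in> comps n s"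
    have "f i \<le> s" if "i \<in> {1..n}" for i
      using f member_le_sum[of i "{1..n}" f] that by (auto simp: comps_def)
    moreover have "f i = 0" if "i \<notin> {1..n}" for i
      using f that unfolding comps_def by blast
    ultimately show "f \<in> {f. \<forall>i. (i \<in> {1..n} \<longrightarrow> f i \<in> {0..s}) \<and> (i \<notin> {1..n} \<longrightarrow> f i = 0)}"
      by simp
  qed
  then show ?thesis
    by (rule finite_subset) (rule finite_set_of_finite_funs; simp)
qed

lemma sum_split_two:
  fixes f :: "nat \<Rightarrow> nat"
  assumes "j \<in> {1..n}" "j' \<in> {1..n}" "j \<noteq> j'"
  shows "sum f {1..n} = f j + f j' + sum f ({1..n} - {j, j'})"
proof -
  have "sum f {1..n} = f j + sum f ({1..n} - {j})"
    using assms by (intro sum.remove) auto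
  also have "sum f ({1..n} - {j}) = f j' + sum f ({1..n} - {j} - {j'})"
    using assms by (intro sum.remove) auto
  finally show ?thesis by (simp add: Diff_insert2[symmetric] insert_commute)
qed

lemma same_string_comps:
  assumes "j \<in> {1..n}" "j' \<in> {1..n}" "j \<noteq> j'" "same_string j j' a c" "a \<in> comps n s"
  shows "c \<in> comps n s"
proof -
  have "sum c ({1..n} - {j, j'}) = sum a ({1..n} - {j, j'})"
    using assms(4) by (intro sum.cong) (auto simp: same_string_def)
  then show ?thesis
    using assms sum_split_two[OF assms(1-3), of a] sum_split_two[OF assms(1-3), of c]
    by (auto simp: comps_def same_string_def)
qed

lemma node_swap_rk1:
  assumes "j \<noteq> j'"
  shows "same_string j j' a (node_swap j j' a)"
    "node_swap j j' a j' = rk1_swap (a j + a j') (a j')"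
    "node_k j j' a = rk1_k (a j + a j') (a j')"
  using assms by (auto simp: same_string_def node_swap_def rk1_swap_def node_k_def rk1_k_def)

lemma same_string_node_swap:
  assumes "j \<noteq> j'" shows "same_string j j' (node_swap j j' a) c \<longleftrightarrow> same_string j j' a c"
  using node_swap_rk1(1)[OF assms, of a] by (auto simp: same_string_def)

lemma node_op_basis:
  assumes j: "j \<noteq> j'" and g: "g \<noteq> 0"
  shows "node_op j j' g (node_basis j j' g a) =
    (\<lambda>c. qint (node_k j j' a) * node_basis j j' g (node_swap j j' a) c)"
proof
  fix c
  let ?m = "a j + a j'"
  let ?w = "rk1_basis ?m (a j')"
  have m': "node_swap j j' a j + node_swap j j' a j' = ?m"
    using node_swap_rk1(1)[OF j, of a] by (simp add: same_string_def)
  have up: "c j' \<noteq> 0 \<Longrightarrow> same_string j j' a (c(j := c j + 1, j' := c j' - 1)) = same_string j j' a c"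
    and down: "c j \<noteq> 0 \<Longrightarrow> same_string j j' a (c(j := c j - 1, j' := c j' + 1)) = same_string j j' a c"
    using j by (auto simp: same_string_def)
  show "node_op j j' g (node_basis j j' g a) c = qint (node_k j j' a) * node_basis j j' g (node_swap j j' a) c"
  proof (cases "same_string j j' a c")
    case True
    then have m: "c j + c j' = ?m" by (simp add: same_string_def)
    have 1: "inverse g * qint (c j') * node_basis j j' g a (c(j := c j + 1, j' := c j' - 1))
        = g ^ c j * (qint (c j') * ?w (c j' - 1))"
      using True up j g by (cases "c j' = 0") (auto simp: node_basis_def)
    have e: "1 - int (c j) + int (c j') = 2 * int (c j') + 1 - int ?m" "?m - c j' = c j"
      using m by auto
    have 2: "g * qv powi (1 - int (c j) + int (c j')) * qint (c j) * node_basis j j' g a (c(j := c j - 1, j' := c j' + 1))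
        = g ^ c j * (qv powi (2 * int (c j') + 1 - int ?m) * qint (?m - c j') * ?w (c j' + 1))"
    proof (cases "c j")
      case (Suc r)
      then show ?thesis unfolding e using True down j by (simp add: node_basis_def mult_ac)
    qed (use e in simp)
    have "node_op j j' g (node_basis j j' g a) c = g ^ c j * rk1 ?m ?w (c j')"
      unfolding node_op_def 1 2 by (simp only: rk1_def distrib_left)
    also have "rk1 ?m ?w (c j') = qint (node_k j j' a) * rk1_basis ?m (node_swap j j' a j') (c j')"
      unfolding node_swap_rk1(2,3)[OF j] using m by (intro rk1_basis_eigen) auto
    finally show ?thesis
      using True by (simp add: node_basis_def same_string_node_swap[OF j] m')
  next
    case False
    then have 1: "qint (c j') * node_basis j j' g a (c(j := c j + 1, j' := c j' - 1)) = 0"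
      using up by (cases "c j' = 0") (simp_all add: node_basis_def)
    have 2: "qint (c j) * node_basis j j' g a (c(j := c j - 1, j' := c j' + 1)) = 0"
      using down False by (cases "c j = 0") (simp_all add: node_basis_def)
    have "node_op j j' g (node_basis j j' g a) c = 0"
      unfolding node_op_def using 1 2 by auto
    then show ?thesis using False by (simp add: node_basis_def same_string_node_swap[OF j])
  qed
qed

lemma node_swap_swap:
  assumes "j \<noteq> j'" "node_k j j' a \<noteq> 0"
  shows "node_swap j j' (node_swap j j' a) = a" "node_k j j' (node_swap j j' a) = node_k j j' a"
  using assms by (auto simp: node_swap_def node_k_def fun_eq_iff split: if_splits)

lemma node_swap_comps:
  assumes "j \<in> {1..n}" "j' \<in> {1..n}" "j \<noteq> j'" "a \<in> comps n s"
  shows "node_swap j j' a \<in> comps n s"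
  using same_string_comps[OF assms(1-3) node_swap_rk1(1)[OF assms(3)] assms(4)] .

lemma eigen_swap_node:
  assumes "j \<in> {1..n}" "j' \<in> {1..n}" "j \<noteq> j'" "g \<noteq> 0"
  shows "eigen_swap (comps n s) (node_op j j' g) (node_k j j') (node_swap j j') (node_basis j j' g)"
  using assms by (auto simp: eigen_swap_def node_op_basis node_swap_swap node_swap_comps)

lemma lattice_basis_node:
  assumes j: "j \<in> {1..n}" "j' \<in> {1..n}" "j \<noteq> j'" and g: "g \<in> Ax" "residue g \<noteq> 0"
  shows "lattice_basis (comps n s) (\<lambda>a. residue g ^ a j) (node_basis j j' g)"
proof -
  have 1: "node_basis j j' g a c \<in> Ax \<and> residue (node_basis j j' g a c) = (if c = a then residue g ^ a j else 0)" for a c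
  proof (cases "same_string j j' a c")
    case True
    then have "c j' \<le> a j + a j'" by (auto simp: same_string_def)
    then have w: "rk1_basis (a j + a j') (a j') (c j') \<in> Ax"
      "residue (rk1_basis (a j + a j') (a j') (c j')) = (if c j' = a j' then 1 else 0)"
      using rk1_basis_lattice[of "a j'" "a j + a j'" "c j'"] by simp_all
    have "c j' = a j' \<longleftrightarrow> c = a"
      using True by (auto simp: same_string_def fun_eq_iff)
    then show ?thesis using True w g by (auto simp: node_basis_def residue_mult residue_power)
  next
    case False
    then have "c \<noteq> a" by (auto simp: same_string_def)
    then show ?thesis using False by (simp add: node_basis_def)
  qed
  have "node_basis j j' g a \<in> vspace (comps n s)" if "a \<in> comps n s" for a
    using same_string_comps[OF j _ that] by (auto simp: vspace_def node_basis_def)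
  then show ?thesis using 1 g finite_comps by (auto simp: lattice_basis_def)
qed

section \<open>Connectedness\<close>

lemma nxt_in: "i \<in> {1..n} \<Longrightarrow> nxt n i \<in> {1..n}"
  by (auto simp: nxt_def)

lemma nxt_neq: "2 \<le> n \<Longrightarrow> nxt n i \<noteq> i"
  by (auto simp: nxt_def)

definition top_comp :: "nat \<Rightarrow> comp" where
  "top_comp s = (\<lambda>i. if i = 1 then s else 0)"

lemma top_comp_in: "1 \<le> n \<Longrightarrow> top_comp s \<in> comps n s"
  by (auto simp: top_comp_def comps_def sum.delta if_distrib cong: if_cong)

lemma comps_move:
  assumes "j \<in> {1..n}" "j' \<in> {1..n}" "j \<noteq> j'" "a \<in> comps n s" "r \<le> a j'"
  shows "a(j := a j + r, j' := a j' - r) \<in> comps n s"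
  by (rule same_string_comps[OF assms(1-3) _ assms(4)]) (use assms in \<open>auto simp: same_string_def\<close>)

lemma weight_move:
  fixes a :: comp
  assumes "j \<in> {1..n}" "j' \<in> {1..n}" "j \<noteq> j'" "r \<le> a j'"
  shows "(\<Sum>i=1..n. i * (a(j := a j + r, j' := a j' - r)) i) + j' * r = (\<Sum>i=1..n. i * a i) + j * r"
proof -
  let ?c = "a(j := a j + r, j' := a j' - r)"
  have "(\<Sum>i\<in>{1..n} - {j, j'}. i * ?c i) = (\<Sum>i\<in>{1..n} - {j, j'}. i * a i)"
    by (intro sum.cong) auto
  moreover have "j' * (a j' - r) + j' * r = j' * a j'"
    using assms(4) by (simp flip: distrib_left)
  ultimately show ?thesis
    using sum_split_two[OF assms(1-3), of "\<lambda>i. i * ?c i"] sum_split_two[OF assms(1-3), of "\<lambda>i. i * a i"] assms(3)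
    by (simp add: distrib_left)
qed

text \<open>Moving units in pairs from c to c - 1 lowers the weighted sum of i times e i until
  everything sits at site 1. The move is indexed by the site i before the two sites involved,
  because its realisation by swaps borrows i as an auxiliary site.\<close>

lemma pair_shift_induct:
  assumes n: "3 \<le> n"
    and shift: "\<And>e i. e \<in> comps n t \<Longrightarrow> \<forall>l. even (e l) \<Longrightarrow> i \<in> {1..n} \<Longrightarrow> 2 \<le> e (nxt n (nxt n i)) \<Longrightarrow>
      Q (e(nxt n i := e (nxt n i) + 2, nxt n (nxt n i) := e (nxt n (nxt n i)) - 2)) = Q e"
    and e: "e \<in> comps n t" "\<forall>l. even (e l)"
  shows "Q e = Q (top_comp t)"
  using e
proof (induction "\<Sum>i=1..n. i * e i" arbitrary: e rule: less_induct)
  case less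
  show ?case
  proof (cases "\<exists>c\<in>{2..n}. e c \<noteq> 0")
    case True
    then obtain c where c: "c \<in> {2..n}" "e c \<noteq> 0" by blast
    then have c2: "2 \<le> e c" using less.prems(2) by (metis One_nat_def Suc_leI dvd_imp_le neq0_conv)
    define i where "i = (if c = 2 then n else c - 2)"
    have i: "i \<in> {1..n}" and i': "nxt n i = c - 1" and i'': "nxt n (nxt n i) = c"
      using c n by (auto simp: i_def nxt_def)
    let ?e = "e(c - 1 := e (c - 1) + 2, c := e c - 2)"
    have j: "c - 1 \<in> {1..n}" "c \<in> {1..n}" "c - 1 \<noteq> c" using c by auto
    have "Q ?e = Q e"
      using shift[OF less.prems i] c2 unfolding i'' unfolding i' by blast
    moreover have "Q ?e = Q (top_comp t)"
    proof (rule less.hyps)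
      have "c * 2 = (c - 1) * 2 + 2" using c by auto
      then show "(\<Sum>i=1..n. i * ?e i) < (\<Sum>i=1..n. i * e i)"
        using weight_move[where a = e and r = 2, OF j c2] by linarith
      show "?e \<in> comps n t" using comps_move[OF j less.prems(1) c2] .
      show "\<forall>l. even (?e l)" using less.prems(2) c2 by simp
    qed
    ultimately show ?thesis by simp
  next
    case False
    have "e i = top_comp t i" for i
    proof -
      have 0: "e l = 0" if "l \<noteq> 1" for l
        using False less.prems(1) that by (cases "l = 0 \<or> l > n") (auto simp: comps_def)
      have "(\<Sum>l=1..n. e l) = (\<Sum>l=1..n. if l = 1 then e 1 else 0)"
        using 0 by (intro sum.cong) auto
      then have "e 1 = t" using less.prems(1) n by (simp add: comps_def)
      then show ?thesis using 0 by (simp add: top_comp_def)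
    qed
    then have "e = top_comp t" by blast
    then show ?thesis by simp
  qed
qed

text \<open>A swap at node i pushes a unit from i to i + 1 if the entry at i is odd, and pulls one
  back if it is even. Pushing collects all odd parity at site n, which leaves an even composition,
  plus one spare unit if s is odd. Even compositions are then connected by moving pairs of units,
  for which three distinct sites are used.\<close>

lemma swap_connected:
  assumes n: "3 \<le> n"
    and closed: "\<And>a i. a \<in> comps n s \<Longrightarrow> i \<in> {1..n} \<Longrightarrow> node_k i (nxt n i) a \<noteq> 0 \<Longrightarrow> P a \<Longrightarrow>
      P (node_swap i (nxt n i) a)"
    and a: "a \<in> comps n s" and b: "b \<in> comps n s" and "P a"
  shows "P b"
proof -
  have nn: "nxt n i \<noteq> i" for i using n nxt_neq by simp
  have sw: "P (node_swap i (nxt n i) a) = P a"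
    if "a \<in> comps n s" "i \<in> {1..n}" "node_k i (nxt n i) a \<noteq> 0" for a i
    using closed[OF that] closed[OF node_swap_comps[OF that(2) nxt_in[OF that(2)] nn[symmetric] that(1)] that(2)]
      node_swap_swap[OF nn[symmetric] that(3)] that(3) by auto
  have right: "P (a(i := a i - 1, nxt n i := a (nxt n i) + 1)) = P a"
    if "a \<in> comps n s" "i \<in> {1..n}" "odd (a i)" for a i
    using sw[OF that(1,2)] that(3) by (simp add: node_k_def node_swap_def)
  have left: "P (a(i := a i + 1, nxt n i := a (nxt n i) - 1)) = P a"
    if "a \<in> comps n s" "i \<in> {1..n}" "even (a i)" "a (nxt n i) \<noteq> 0" for a i
    using sw[OF that(1,2)] that(3,4) by (simp add: node_k_def node_swap_def)
  have bound: "(\<Sum>i=1..n. i * a i) \<le> n * s" if "a \<in> comps n s" for a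
  proof -
    have "(\<Sum>i=1..n. i * a i) \<le> (\<Sum>i=1..n. n * a i)" by (intro sum_mono) simp
    then show ?thesis using that by (simp add: comps_def flip: sum_distrib_left)
  qed
  have push: "\<exists>c\<in>comps n s. P c = P a \<and> (\<forall>i\<in>{1..<n}. even (c i))" if "a \<in> comps n s" for a
    using that
  proof (induction "n * s - (\<Sum>i=1..n. i * a i)" arbitrary: a rule: less_induct)
    case less
    show ?case
    proof (cases "\<forall>i\<in>{1..<n}. even (a i)")
      case False
      then obtain i where i: "i \<in> {1..<n}" "odd (a i)" by blast
      have nx: "nxt n i = i + 1" using i by (simp add: nxt_def)
      let ?c = "a(i + 1 := a (i + 1) + 1, i := a i - 1)"
      have j: "i + 1 \<in> {1..n}" "i \<in> {1..n}" "i + 1 \<noteq> i" "1 \<le> a i" using i by (auto elim: oddE)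
      have c: "?c \<in> comps n s" using comps_move[OF j(1-3) less.prems j(4)] .
      have "P ?c = P a"
        using right[OF less.prems j(2) i(2)] by (simp add: nx fun_upd_twist)
      moreover have "n * s - (\<Sum>i=1..n. i * ?c i) < n * s - (\<Sum>i=1..n. i * a i)"
        using weight_move[where a = a and r = 1, OF j] bound[OF c] by simp
      ultimately show ?thesis using less.hyps[OF _ c] by auto
    qed (use less.prems in blast)
  qed
  \<comment> \<open>P for the even composition e, with the spare unit parked at site 1 if s is odd;
    \<open>site_P\<close> below shows that its place does not affect P.\<close>
  define Q where "Q e = (if even s then P e else P (e(1 := e 1 + 1)))" for e
  define t where "t = s - s mod 2"
  have site: "e(i := e i + 1) \<in> comps n s" if "e \<in> comps n t" "odd s" "i \<in> {1..n}" for e i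
  proof -
    have "(\<Sum>l=1..n. (e(i := e i + 1)) l) = (\<Sum>l=1..n. e l + (if l = i then 1 else 0))"
      by (intro sum.cong) auto
    also have "\<dots> = t + 1" using that by (simp add: sum.distrib comps_def)
    also have "\<dots> = s" using that(2) by (auto simp: t_def odd_iff_mod_2_eq_one elim: oddE)
    finally show ?thesis using that by (auto simp: comps_def)
  qed
  have site_P: "P (e(i := e i + 1)) = P (e(1 := e 1 + 1))"
    if e: "e \<in> comps n t" "odd s" "\<forall>l. even (e l)" and "i \<in> {1..n}" for e i
    using \<open>i \<in> {1..n}\<close>
  proof (induction i)
    case (Suc i)
    show ?case
    proof (cases "i = 0")
      case False
      then have i: "i \<in> {1..n}" "nxt n i = Suc i" using Suc.prems by (auto simp: nxt_def)
      have "P (e(Suc i := e (Suc i) + 1)) = P (e(i := e i + 1))"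
        using right[OF site[OF e(1,2) i(1)] i(1)] e(3) i by simp
      then show ?thesis using Suc.IH[OF i(1)] by (simp only:)
    qed simp
  qed simp
  have t_even: "even s \<Longrightarrow> t = s" by (simp add: t_def)
  have shift: "Q (e(nxt n i := e (nxt n i) + 2, nxt n (nxt n i) := e (nxt n (nxt n i)) - 2)) = Q e"
    if e: "e \<in> comps n t" "\<forall>l. even (e l)" and i: "i \<in> {1..n}" and 2: "2 \<le> e (nxt n (nxt n i))" for e i
  proof -
    define x y z where "x = i" and "y = nxt n i" and "z = nxt n (nxt n i)"
    have xyz: "x \<in> {1..n}" "y \<in> {1..n}" "z \<in> {1..n}" "x \<noteq> y" "y \<noteq> z" "x \<noteq> z" "nxt n x = y" "nxt n y = z"
      using i n by (auto simp: x_def y_def z_def nxt_def)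
    have z2: "2 \<le> e z" using 2 by (simp add: z_def)
    let ?e = "e(y := e y + 2, z := e z - 2)"
    have e': "?e \<in> comps n t" using comps_move[OF xyz(2,3,5) e(1) z2] .
    have ev: "even (e x)" "even (e y)" "even (e z)" using e by auto
    have "Q ?e = Q e"
    proof (cases "even s")
      case True
      have e: "e \<in> comps n s" using e t_even True by simp
      \<comment> \<open>A pair travels from z to y with x as auxiliary site: pull z to y, pull y to
        x, pull z to y, push x to y. Each direction is the one dictated by the current
        parity.\<close>
      define e1 where "e1 = e(y := e y + 1, z := e z - 1)"
      define e2 where "e2 = e1(x := e1 x + 1, y := e1 y - 1)"
      define e3 where "e3 = e2(y := e2 y + 1, z := e2 z - 1)"
      define e4 where "e4 = e3(x := e3 x - 1, y := e3 y + 1)"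
      have 1: "P e1 = P e" "e1 \<in> comps n s"
        using left[OF e xyz(2)] comps_move[OF xyz(2,3,5) e, of 1] z2 ev xyz by (simp_all add: e1_def)
      have 2: "P e2 = P e1" "e2 \<in> comps n s"
        using left[OF 1(2) xyz(1)] comps_move[OF xyz(1,2,4) 1(2), of 1] ev xyz by (simp_all add: e2_def e1_def)
      have 3: "P e3 = P e2" "e3 \<in> comps n s"
        using left[OF 2(2) xyz(2)] comps_move[OF xyz(2,3,5) 2(2), of 1] ev xyz z2 by (simp_all add: e3_def e2_def e1_def)
      have 4: "P e4 = P e3"
        using right[OF 3(2) xyz(1)] ev xyz by (simp add: e4_def e3_def e2_def e1_def)
      have "e4 = ?e" using xyz(4-6) by (auto simp: e4_def e3_def e2_def e1_def fun_eq_iff)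
      then show ?thesis using 1 2 3 4 True by (simp add: Q_def)
    next
      case False
      \<comment> \<open>With the spare unit at x two swaps are enough: pull z to y, push x to y. The
        result is the shifted composition with the spare unit at z.\<close>
      define e1 where "e1 = e(x := e x + 1)"
      define e2 where "e2 = e1(y := e1 y + 1, z := e1 z - 1)"
      define e3 where "e3 = e2(x := e2 x - 1, y := e2 y + 1)"
      have e1: "e1 \<in> comps n s" "P e1 = P (e(1 := e 1 + 1))"
        unfolding e1_def using site[OF e(1) False xyz(1)] site_P[OF e(1) False e(2) xyz(1)] by simp_all
      have 2: "P e2 = P e1" "e2 \<in> comps n s"
        using left[OF e1(1) xyz(2)] comps_move[OF xyz(2,3,5) e1(1), of 1] ev xyz z2 by (simp_all add: e2_def e1_def)
      have 3: "P e3 = P e2"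
        using right[OF 2(2) xyz(1)] ev xyz by (simp add: e3_def e2_def e1_def)
      have "e3 = ?e(z := ?e z + 1)"
        using xyz(4-6) z2 by (auto simp: e3_def e2_def e1_def fun_eq_iff)
      moreover have "\<forall>l. even (?e l)" using e(2) z2 by simp
      ultimately have "P e3 = P (?e(1 := ?e 1 + 1))"
        using site_P[OF e' False _ xyz(3)] by simp
      then show ?thesis using e1 2 3 False by (simp add: Q_def)
    qed
    then show ?thesis by (simp add: y_def z_def)
  qed
  have "P a = Q (top_comp t)" if a: "a \<in> comps n s" for a
  proof -
    obtain c where c: "c \<in> comps n s" "P c = P a" "\<forall>i\<in>{1..<n}. even (c i)" using push[OF a] by blast
    have co: "even (c l)" if "l \<noteq> n" for l
      using c that by (cases "l \<in> {1..<n}") (auto simp: comps_def)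
    have cs: "(\<Sum>l=1..n. c l) = c n + (\<Sum>l\<in>{1..n} - {n}. c l)" using n by (intro sum.remove) auto
    have "even (\<Sum>l\<in>{1..n} - {n}. c l)" using co by (intro dvd_sum) auto
    moreover have "s = (\<Sum>l=1..n. c l)" using c(1) by (simp add: comps_def)
    ultimately have par: "even (c n) \<longleftrightarrow> even s" unfolding cs by simp
    show ?thesis
    proof (cases "even s")
      case True
      then have "\<forall>l. even (c l)" using co par by metis
      then have "Q c = Q (top_comp t)"
        using pair_shift_induct[OF n, of t Q c] shift c(1) t_even[OF True] by blast
      then show ?thesis using c(2) True by (simp add: Q_def)
    next
      case False
      define e where "e = c(n := c n - 1)"
      have cn: "c n \<noteq> 0" using False par by (metis even_zero)
      have ee: "\<forall>l. even (e l)" using co par False by (auto simp: e_def)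
      have "(\<Sum>l=1..n. e l) = e n + (\<Sum>l\<in>{1..n} - {n}. e l)" using n by (intro sum.remove) auto
      also have "(\<Sum>l\<in>{1..n} - {n}. e l) = (\<Sum>l\<in>{1..n} - {n}. c l)" by (intro sum.cong) (auto simp: e_def)
      finally have "(\<Sum>l=1..n. e l) = s - 1"
        using cs c(1) cn by (simp add: e_def comps_def)
      moreover have "t = s - 1" using False by (simp add: t_def odd_iff_mod_2_eq_one)
      ultimately have e: "e \<in> comps n t" using c(1) n by (auto simp: comps_def e_def)
      have "Q e = Q (top_comp t)" using pair_shift_induct[OF n, of t Q e] shift e ee by blast
      moreover have "P (e(n := e n + 1)) = Q e"
        using site_P[OF e False ee, of n] n False by (simp add: Q_def)
      moreover have "e(n := e n + 1) = c" using cn by (auto simp: e_def fun_eq_iff)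
      ultimately show ?thesis using c(2) by simp
    qed
  qed
  from this[OF a] this[OF b] \<open>P a\<close> show ?thesis by simp
qed

section \<open>The combinatorial map\<close>

lemma theta_le: "theta m \<le> m"
  by (auto simp: theta_def elim: oddE)

lemma theta_prim: "i \<in> {1..n} \<Longrightarrow> theta (prim n a i) = theta (a i)"
  using theta_le[of "a (nxt n i)"] by (auto simp: prim_def theta_def)

lemma node_k_theta: "node_k j j' a = a j' + theta (a j)"
  by (simp add: node_k_def theta_def)

text \<open>For (s, 0, ..., 0) the equations at the nodes 2, ..., n - 1 have value 0 and kill the
  entries of b there. As n is at least 3, site 2 is among them; so node 1 gives b 1 = theta s, and
  then node n gives b n = s - theta s.\<close>

lemma prim_eqI:
  assumes n: "3 \<le> n" and b: "b \<in> comps n s"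
    and k: "\<And>i. i \<in> {1..n} \<Longrightarrow> node_k i (nxt n i) (top_comp s) = node_k (nxt n i) i b"
  shows "b = prim n (top_comp s)"
proof -
  have k': "b i + theta (b (nxt n i)) = top_comp s (nxt n i) + theta (top_comp s i)" if "i \<in> {1..n}" for i
    using k[OF that] by (simp add: node_k_theta)
  have mid: "b i = 0 \<and> theta (b (nxt n i)) = 0" if "i \<in> {2..<n}" for i
    using k'[of i] that by (auto simp: top_comp_def nxt_def theta_def)
  have "theta (b n) = 0" 
  proof -
    have "nxt n (n - 1) = n" "n - 1 \<in> {2..<n}" using n by (auto simp: nxt_def)
    then show ?thesis using mid[of "n - 1"] by simp
  qed
  have b1: "b 1 = theta s"
    using k'[of 1] mid[of 2] n by (simp add: top_comp_def nxt_def theta_def numeral_2_eq_2)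
  have bn: "b n = s - theta s"
    using k'[of n] n b1 by (simp add: top_comp_def nxt_def theta_def split: if_splits)
  show ?thesis
  proof
    fix i
    consider "i = 1" | "i = n" | "i \<in> {2..<n}" | "i \<notin> {1..n}" by force
    then show "b i = prim n (top_comp s) i"
    proof cases
      case 4
      then show ?thesis using b unfolding comps_def prim_def by auto
    next
      case 1
      then show ?thesis using n unfolding 1 b1 by (simp add: prim_def top_comp_def nxt_def theta_def)
    next
      case 2
      then show ?thesis using n unfolding 2 bn by (simp add: prim_def top_comp_def nxt_def theta_def)
    next
      case 3
      then have "b i = 0" using mid by blast
      then show ?thesis using 3 by (simp add: prim_def top_comp_def nxt_def theta_def)
    qed
  qed
qed

text \<open>\<open>prim\<close> moves the even part of each entry from i + 1 to i and keeps every
  parity in its place. A swap at i flips the parities at i and i + 1 but leaves the even part at i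
  alone; so entry i - 1 of \<open>prim\<close> is unchanged, and the entries i and i + 1 change as
  in a swap with the two sites exchanged.\<close>

lemma prim_node_swap:
  assumes n: "3 \<le> n" and i: "i \<in> {1..n}" and k: "node_k i (nxt n i) a \<noteq> 0"
  shows "prim n (node_swap i (nxt n i) a) = node_swap (nxt n i) i (prim n a)"
proof
  fix l
  define i' where "i' = nxt n i"
  define c where "c = node_swap i i' a"
  define b where "b = prim n a"
  define d where "d = node_swap i' i b"
  have i': "i' \<in> {1..n}" "i' \<noteq> i" "nxt n i' \<noteq> i" "nxt n i' \<noteq> i'"
    unfolding i'_def using i n by (auto simp: nxt_def)
  have c: "c i = (if even (a i) then a i + 1 else a i - 1)"
    "c i' = (if even (a i) then a i' - 1 else a i' + 1)" "\<And>m. m \<noteq> i \<Longrightarrow> m \<noteq> i' \<Longrightarrow> c m = a m"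
    using i' k by (auto simp: c_def node_swap_def node_k_def i'_def[symmetric])
  have pos: "even (a i) \<Longrightarrow> 0 < a i'" using k by (auto simp: node_k_def i'_def)
  have b: "b m = a (nxt n m) + theta (a m) - theta (a (nxt n m))" if "m \<in> {1..n}" for m
    using that by (simp add: b_def prim_def)
  have bi: "b i = a i' + theta (a i) - theta (a i')" using b[OF i] by (simp add: i'_def)
  have pb: "even (b i') \<longleftrightarrow> even (a i')"
    using theta_prim[OF i'(1), of a] by (simp add: b_def theta_def split: if_splits)
  have b0: "even (a i') \<Longrightarrow> b i \<noteq> 0"
    using bi pos by (auto simp: theta_def)
  have d: "d i' = (if even (a i') then b i' + 1 else b i' - 1)"
    "d i = (if even (a i') then b i - 1 else b i + 1)" "\<And>m. m \<noteq> i \<Longrightarrow> m \<noteq> i' \<Longrightarrow> d m = b m"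
    using i' b0 pb by (auto simp: d_def node_swap_def)
  have pc: "prim n c m = c (nxt n m) + theta (c m) - theta (c (nxt n m))" if "m \<in> {1..n}" for m
    using that by (simp add: prim_def)
  have "prim n c l = d l"
  proof (cases "l \<in> {1..n}")
    case False
    then have "l \<noteq> i" "l \<noteq> i'" using i i' by auto
    then have "d l = b l" by (rule d(3))
    then show ?thesis using False unfolding prim_def b_def by auto
  next
    case l: True
    consider "l = i" | "l = i'" | "l \<noteq> i" "l \<noteq> i'" by blast
    then show ?thesis
    proof cases
      case 1
      have "prim n c i = c i' + theta (c i) - theta (c i')" using pc[OF i] by (simp add: i'_def)
      then show ?thesis unfolding 1 d(2) bi c(1,2) using pos
        by (cases "even (a i)"; cases "even (a i')") (simp_all add: theta_def)
    next
      case 2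
      have "prim n c i' = a (nxt n i') + theta (c i') - theta (a (nxt n i'))"
        using pc[OF i'(1)] c(3)[OF i'(3,4)] by simp
      then show ?thesis unfolding 2 d(1) b[OF i'(1)] c(2)
        using pos theta_le[of "a (nxt n i')"]
        by (cases "even (a i)"; cases "even (a i')") (simp_all add: theta_def)
    next
      case 3
      have ne: "nxt n l \<noteq> i'" using 3 l i by (auto simp: nxt_def i'_def split: if_splits)
      show ?thesis
      proof (cases "nxt n l = i")
        case True
        have "prim n c l = c i + theta (a l) - theta (c i)" "b l = a i + theta (a l) - theta (a i)"
          using pc[OF l] b[OF l] c(3)[OF 3] True by simp_all
        then show ?thesis unfolding d(3)[OF 3] c(1)
          by (cases "even (a i)") (auto simp: theta_def elim: oddE)
      next
        case False
        then show ?thesis using pc[OF l] b[OF l] c(3)[OF 3] c(3)[OF False ne] d(3)[OF 3] by simp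
      qed
    qed
  qed
  then show "prim n (node_swap i (nxt n i) a) l = node_swap (nxt n i) i (prim n a) l"
    by (simp add: c_def d_def b_def i'_def)
qed

lemma prim_comps: assumes n: "1 \<le> n" and a: "a \<in> comps n s" shows "prim n a \<in> comps n s"
proof -
  have bij: "bij_betw (nxt n) {1..n} {1..n}"
    by (rule bij_betwI[where g = "\<lambda>i. if i = 1 then n else i - 1"]) (auto simp: nxt_def)
  have sh: "(\<Sum>i=1..n. f (nxt n i)) = (\<Sum>i=1..n. f i)" for f :: "nat \<Rightarrow> nat"
    by (rule sum.reindex_bij_betw[OF bij])
  have "(\<Sum>i=1..n. prim n a i) + (\<Sum>i=1..n. theta (a (nxt n i)))
      = (\<Sum>i=1..n. a (nxt n i) + theta (a i))"
    unfolding sum.distrib[symmetric] using theta_le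
    by (intro sum.cong) (auto simp: prim_def trans_le_add1)
  then have "(\<Sum>i=1..n. prim n a i) = (\<Sum>i=1..n. a i)"
    unfolding sum.distrib sh[of "\<lambda>i. theta (a i)"] sh[of a] by simp
  then show ?thesis using a by (auto simp: comps_def prim_def)
qed

lemma prim_inj: "inj_on (prim n) (comps n s)"
proof
  fix a b assume a: "a \<in> comps n s" and b: "b \<in> comps n s" and eq: "prim n a = prim n b"
  have th: "theta (a i) = theta (b i)" if "i \<in> {1..n}" for i
    using theta_prim[OF that, of a] theta_prim[OF that, of b] eq by simp
  have "a (nxt n i) = b (nxt n i)" if "i \<in> {1..n}" for i
    using fun_cong[OF eq, of i] that th[OF that] th[OF nxt_in[OF that]]
      theta_le[of "a (nxt n i)"] theta_le[of "b (nxt n i)"] by (simp add: prim_def)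
  moreover have "\<exists>i\<in>{1..n}. nxt n i = l" if "l \<in> {1..n}" for l
    using that by (intro bexI[of _ "if l = 1 then n else l - 1"]) (auto simp: nxt_def)
  ultimately have "a l = b l" if "l \<in> {1..n}" for l using that by blast
  moreover have "a l = b l" if "l \<notin> {1..n}" for l using a b that unfolding comps_def by auto
  ultimately show "a = b" by blast
qed

lemma prim_bij: "1 \<le> n \<Longrightarrow> bij_betw (prim n) (comps n s) (comps n s)"
  using endo_inj_surj[OF finite_comps _ prim_inj] prim_comps prim_inj
  by (fastforce simp: bij_betw_def)

section \<open>The coideal operators on words\<close>

definition letter_swap :: "nat \<Rightarrow> nat \<Rightarrow> nat \<Rightarrow> nat" where
  "letter_swap j j' c = (if c = j then j' else if c = j' then j else c)"

definition letter_B :: "nat \<Rightarrow> nat \<Rightarrow> Cqx \<Rightarrow> nat \<Rightarrow> Cqx" where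
  "letter_B j j' g c = (if c = j then g else if c = j' then inverse g else 0)"

definition letter_Kinv :: "nat \<Rightarrow> nat \<Rightarrow> nat \<Rightarrow> Cqx" where
  "letter_Kinv j j' c = (if c = j then inverse qv else if c = j' then qv else 1)"

text \<open>The iterated coproduct \<open>\<Sum>\<^sub>p 1 \<otimes> \<dots> \<otimes> B \<otimes> K\<inverse> \<otimes> \<dots> \<otimes> K\<inverse>\<close> of \<open>B\<close>, in coordinates.\<close>

definition word_op :: "(nat \<Rightarrow> nat) \<Rightarrow> (nat \<Rightarrow> nat \<Rightarrow> Cqx) \<Rightarrow> (nat \<Rightarrow> nat \<Rightarrow> Cqx) \<Rightarrow>
    nat list vec \<Rightarrow> nat list vec" where
  "word_op sw \<beta> \<kappa> y = (\<lambda>w. \<Sum>p<length w.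
     (\<Prod>r\<in>{p<..<length w}. \<kappa> r (w ! r)) * \<beta> p (w ! p) * y (w[p := sw (w ! p)]))"

lemma word_op_Nil: "word_op sw \<beta> \<kappa> y [] = 0"
  by (simp add: word_op_def)

text \<open>The coproduct of B with the last factor split off: B on an earlier factor meets the
  inverse of K on the last one. This is the recursion behind the inductions over words.\<close>

lemma word_op_snoc:
  "word_op sw \<beta> \<kappa> y (w @ [c]) =
    \<kappa> (length w) c * word_op sw \<beta> \<kappa> (\<lambda>u. y (u @ [c])) w + \<beta> (length w) c * y (w @ [sw c])"
proof -
  let ?s = "length w"
  have pr: "(\<Prod>r\<in>{p<..<Suc ?s}. \<kappa> r ((w @ [c]) ! r)) = \<kappa> ?s c * (\<Prod>r\<in>{p<..<?s}. \<kappa> r (w ! r))"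
    if "p < ?s" for p
  proof -
    have "{p<..<Suc ?s} = insert ?s {p<..<?s}" using that by auto
    moreover have "(\<Prod>r\<in>{p<..<?s}. \<kappa> r ((w @ [c]) ! r)) = (\<Prod>r\<in>{p<..<?s}. \<kappa> r (w ! r))"
      by (intro prod.cong) (auto simp: nth_append)
    ultimately show ?thesis by simp
  qed
  let ?f = "\<lambda>p. (\<Prod>r\<in>{p<..<Suc ?s}. \<kappa> r ((w @ [c]) ! r)) * \<beta> p ((w @ [c]) ! p) * y ((w @ [c])[p := sw ((w @ [c]) ! p)])"
  have "?f p = \<kappa> ?s c * ((\<Prod>r\<in>{p<..<?s}. \<kappa> r (w ! r)) * \<beta> p (w ! p) * y (w[p := sw (w ! p)] @ [c]))"
    if "p < ?s" for p
    unfolding pr[OF that] using that by (simp add: nth_append list_update_append mult.assoc)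
  then have "(\<Sum>p<?s. ?f p) = \<kappa> ?s c * word_op sw \<beta> \<kappa> (\<lambda>u. y (u @ [c])) w"
    unfolding word_op_def sum_distrib_left by (intro sum.cong) auto
  moreover have "{?s<..<Suc ?s} = {}" by auto
  then have "?f ?s = \<beta> ?s c * y (w @ [sw c])" by simp
  moreover have "word_op sw \<beta> \<kappa> y (w @ [c]) = (\<Sum>p<?s. ?f p) + ?f ?s"
    unfolding word_op_def length_append list.size add_0 One_nat_def add_Suc_right add_0_right
    by (rule sum.lessThan_Suc)
  ultimately show ?thesis by (simp only:)
qed

text \<open>The product of the \<kappa> runs over positions after p, so \<kappa> 0 never occurs.
  Thus the first factor may pass from a module to its dual without changing the operator, which is
  what makes the K-matrix on the first factor an intertwiner.\<close>

lemma word_op_cong: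
  assumes "\<And>p c. \<beta> p c = \<beta>' p c" "\<And>p c. p \<noteq> 0 \<Longrightarrow> \<kappa> p c = \<kappa>' p c"
  shows "word_op sw \<beta> \<kappa> y = word_op sw \<beta>' \<kappa>' y"
  unfolding word_op_def using assms by (intro ext sum.cong arg_cong2[where f = times] prod.cong refl) auto

lemma lin_op_word_op: "lin_op (word_op sw \<beta> \<kappa>)"
  by (auto simp: lin_op_def word_op_def algebra_simps sum.distrib sum_distrib_left)

lemma word_op_ext:
  assumes "\<And>p. p < length w \<Longrightarrow> y (w[p := sw (w ! p)]) = y' (w[p := sw (w ! p)])"
  shows "word_op sw \<beta> \<kappa> y w = word_op sw \<beta> \<kappa> y' w"
  unfolding word_op_def using assms by (intro sum.cong) auto

section \<open>The symmetric tensors\<close>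

definition inversions :: "(nat \<Rightarrow> nat) \<Rightarrow> nat list \<Rightarrow> nat" where
  "inversions \<rho> w = card {(p, r). p < r \<and> r < length w \<and> \<rho> (w ! p) > \<rho> (w ! r)}"

text \<open>The number of inversions created by appending the letter c to a word of content
  a.\<close>

definition count_above :: "(nat \<Rightarrow> nat) \<Rightarrow> nat \<Rightarrow> nat \<Rightarrow> comp \<Rightarrow> nat" where
  "count_above \<rho> n c a = (\<Sum>d\<in>{d\<in>{1..n}. \<rho> d > \<rho> c}. a d)"

lemma count_list_snoc: "count_list (w @ [c]) = (count_list w)(c := count_list w c + 1)"
  by auto

lemma count_list_above:
  "set w \<subseteq> {1..n} \<Longrightarrow> card {p. p < length w \<and> \<rho> (w ! p) > \<rho> c} = count_above \<rho> n c (count_list w)"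
proof (induction w rule: rev_induct)
  case (snoc d w)
  let ?X = "{p. p < length w \<and> \<rho> (w ! p) > \<rho> c}"
  have "{p. p < length (w @ [d]) \<and> \<rho> ((w @ [d]) ! p) > \<rho> c}
    = (if \<rho> d > \<rho> c then insert (length w) ?X else ?X)"
    by (auto simp: nth_append less_Suc_eq split: if_splits)
  moreover have "card (insert (length w) ?X) = card ?X + 1"
    using card_insert_disjoint[of ?X "length w"] by simp
  ultimately have "card {p. p < length (w @ [d]) \<and> \<rho> ((w @ [d]) ! p) > \<rho> c}
    = card ?X + (if \<rho> d > \<rho> c then 1 else 0)"
    by simp
  moreover have "count_above \<rho> n c (count_list (w @ [d])) =
     (\<Sum>e\<in>{e\<in>{1..n}. \<rho> e > \<rho> c}. count_list w e + (if d = e then 1 else 0))"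
    unfolding count_above_def by (rule sum.cong) auto
  then have "count_above \<rho> n c (count_list (w @ [d])) = count_above \<rho> n c (count_list w) + (if \<rho> d > \<rho> c then 1 else 0)"
    using snoc.prems unfolding sum.distrib count_above_def[of \<rho> n c "count_list w", symmetric] by simp
  moreover have "card ?X = count_above \<rho> n c (count_list w)" using snoc by simp
  ultimately show ?case by (simp only:)
qed (simp add: count_above_def)

lemma inversions_snoc:
  assumes "set w \<subseteq> {1..n}"
  shows "inversions \<rho> (w @ [c]) = inversions \<rho> w + count_above \<rho> n c (count_list w)"
proof -
  define A where "A = {(p, r). p < r \<and> r < length w \<and> \<rho> (w ! p) > \<rho> (w ! r)}"
  define X where "X = {p. p < length w \<and> \<rho> (w ! p) > \<rho> c}"
  define B where "B = (\<lambda>p. (p, length w)) ` X"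
  have "{(p, r). p < r \<and> r < length (w @ [c]) \<and> \<rho> ((w @ [c]) ! p) > \<rho> ((w @ [c]) ! r)} = A \<union> B"
    by (auto simp: A_def B_def X_def nth_append less_Suc_eq split: if_splits)
  moreover have "card (A \<union> B) = card A + card B"
  proof (rule card_Un_disjoint)
    show "finite A"
      unfolding A_def by (rule finite_subset[of _ "{..<length w} \<times> {..<length w}"]) auto
    show "A \<inter> B = {}" by (auto simp: A_def B_def)
  qed (simp add: B_def X_def)
  moreover have "card B = card X"
    unfolding B_def by (intro card_image) (auto simp: inj_on_def)
  moreover have "card X = count_above \<rho> n c (count_list w)"
    unfolding X_def by (rule count_list_above[OF assms])
  ultimately show ?thesis
    unfolding inversions_def A_def by (simp only:)
qed

definition symm :: "(nat \<Rightarrow> nat) \<Rightarrow> comp vec \<Rightarrow> nat list vec" where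
  "symm \<rho> v = (\<lambda>w. v (count_list w) * inverse qv ^ inversions \<rho> w)"

text \<open>The two cases of a node: \<open>t = 0\<close> if \<open>j'\<close> directly follows \<open>j\<close> in the order \<open>\<rho>\<close>, and
  \<open>t = 1\<close> for the affine node, where \<open>j\<close> is the last and \<open>j'\<close> the first letter.\<close>

definition node_order :: "(nat \<Rightarrow> nat) \<Rightarrow> nat \<Rightarrow> nat \<Rightarrow> nat \<Rightarrow> nat \<Rightarrow> bool" where
  "node_order \<rho> n j j' t \<longleftrightarrow> j \<in> {1..n} \<and> j' \<in> {1..n} \<and> j \<noteq> j' \<and> inj_on \<rho> {1..n} \<and>
     (t = 0 \<and> \<rho> j' = \<rho> j + 1 \<or> t = 1 \<and> (\<forall>c\<in>{1..n}. \<rho> c \<le> \<rho> j \<and> \<rho> j' \<le> \<rho> c))"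

text \<open>The count changes only if c separates the two letters in the order \<rho>: for adjacent
  letters this happens just for c = j, and for the extreme letters of the affine node for every c
  except j.\<close>

lemma above_move:
  assumes "node_order \<rho> n j j' t" "c \<in> {1..n}" "a j' \<noteq> 0"
  shows "count_above \<rho> n c (a(j := a j + 1, j' := a j' - 1)) + (if c = j then 1 else 0) = count_above \<rho> n c a + t"
proof -
  define T where "T = {d\<in>{1..n}. \<rho> d > \<rho> c}"
  have fin: "finite T" by (simp add: T_def)
  have jj: "j \<noteq> j'" and j: "j \<in> {1..n}" "j' \<in> {1..n}" and inj: "inj_on \<rho> {1..n}"
    using assms(1) unfolding node_order_def by blast+
  have "(\<Sum>d\<in>T. (a(j := a j + 1, j' := a j' - 1)) d + (if d = j' then 1 else 0))
      = (\<Sum>d\<in>T. a d + (if d = j then 1 else 0))"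
    using assms(3) jj by (intro sum.cong) auto
  then have "count_above \<rho> n c (a(j := a j + 1, j' := a j' - 1)) + (if j' \<in> T then 1 else 0)
     = count_above \<rho> n c a + (if j \<in> T then 1 else 0)"
    unfolding count_above_def T_def[symmetric] sum.distrib by (simp only: sum.delta[OF fin])
  moreover have "(if j' \<in> T then 1 else 0) + t = (if j \<in> T then 1 else 0) + (if c = j then 1 else (0::nat))"
  proof -
    have eq: "\<rho> c = \<rho> j \<longleftrightarrow> c = j" by (rule inj_on_eq_iff[OF inj assms(2) j(1)])
    have T: "j \<in> T \<longleftrightarrow> \<rho> c < \<rho> j" "j' \<in> T \<longleftrightarrow> \<rho> c < \<rho> j'"
      unfolding T_def using j by simp_all
    have "t = 0 \<and> \<rho> j' = \<rho> j + 1 \<or> t = 1 \<and> \<rho> c \<le> \<rho> j \<and> \<rho> j' \<le> \<rho> c"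
      using assms(1,2) unfolding node_order_def by blast
    then show ?thesis
      unfolding T eq[symmetric] by (elim disjE conjE) simp_all
  qed
  ultimately show ?thesis by linarith
qed

lemma above_ends:
  assumes "node_order \<rho> n j j' t" 
  shows "count_above \<rho> n j' a + a j' = count_above \<rho> n j a + t * (\<Sum>i=1..n. a i)"
proof -
  have j: "j \<in> {1..n}" "j' \<in> {1..n}" and inj: "inj_on \<rho> {1..n}"
    using assms unfolding node_order_def by blast+
  have eq: "\<rho> d = \<rho> j' \<longleftrightarrow> d = j'" if "d \<in> {1..n}" for d by (rule inj_on_eq_iff[OF inj that j(2)])
  consider (adj) "t = 0" "\<rho> j' = \<rho> j + 1"
    | (ends) "t = 1" "\<And>c. c \<in> {1..n} \<Longrightarrow> \<rho> c \<le> \<rho> j" "\<And>c. c \<in> {1..n} \<Longrightarrow> \<rho> j' \<le> \<rho> c"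
    using assms unfolding node_order_def by blast
  then show ?thesis
  proof cases
    case adj
    have "{d\<in>{1..n}. \<rho> d > \<rho> j} = insert j' {d\<in>{1..n}. \<rho> d > \<rho> j'}"
    proof (rule set_eqI)
      fix d
      have "d \<in> {1..n} \<Longrightarrow> \<rho> d > \<rho> j \<longleftrightarrow> \<rho> d = \<rho> j' \<or> \<rho> d > \<rho> j'" using adj(2) by linarith
      then show "d \<in> {d\<in>{1..n}. \<rho> d > \<rho> j} \<longleftrightarrow> d \<in> insert j' {d\<in>{1..n}. \<rho> d > \<rho> j'}"
        using eq[of d] j(2) by blast
    qed
    then show ?thesis using adj(1) by (simp add: count_above_def)
  next
    case ends
    have 1: "{d\<in>{1..n}. \<rho> d > \<rho> j} = {}" using ends(2) by (auto simp: not_less)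
    have 2: "{d\<in>{1..n}. \<rho> d > \<rho> j'} = {1..n} - {j'}"
    proof -
      have "\<rho> j' < \<rho> d \<longleftrightarrow> d \<noteq> j'" if d: "d \<in> {1..n}" for d
        unfolding eq[OF d, symmetric] using ends(3)[OF d] by arith
      then show ?thesis by blast
    qed
    have "(\<Sum>i=1..n. a i) = a j' + (\<Sum>i\<in>{1..n} - {j'}. a i)"
      using j by (intro sum.remove) auto
    then show ?thesis unfolding count_above_def 1 2 using ends(1) by simp
  qed
qed

lemma qint_Suc': "qint (Suc a) = inverse qv * qint a + qv ^ a"
  using qint_add[of a 1] by simp

lemma qint_Suc'': "qint (Suc b) = qv * qint b + inverse qv ^ b"
  using qint_add[of 1 b] by (simp add: add.commute)

text \<open>The inductive step for symmetric tensors, on the level of contents: on the left B acts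
  on a word ending in c, on the right \<open>node_op\<close> acts at the enlarged content. For c = j
  the enlarged entry splits by [a + 1] = q^-1 [a] + q^a, for c = j' by [a + 1] = q [a] + q^-a; one
  summand comes from the prefix, the other from B acting on the last letter.\<close>

lemma node_op_snoc:
  assumes o: "node_order \<rho> n j j' t" and g: "g \<noteq> 0" and c: "c \<in> {1..n}"
    and s: "(\<Sum>i=1..n. a i) = s"
    and vc: "vc = (\<lambda>b. v (b(c := b c + 1)) * inverse qv ^ count_above \<rho> n c b)"
    and g': "g' = g * inverse qv ^ t"
  shows "letter_Kinv j j' c * node_op j j' g' vc a
     + letter_B j j' (qv ^ (t * s) * g) c * (v (a(letter_swap j j' c := a (letter_swap j j' c) + 1))
         * inverse qv ^ count_above \<rho> n (letter_swap j j' c) a)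
   = node_op j j' g v (a(c := a c + 1)) * inverse qv ^ count_above \<rho> n c a"
proof -
  define p where "p = inverse qv"
  define A B where "A = qint (a j)" and "B = qint (a j')"
  define N where "N = count_above \<rho> n c a"
  define a1 where "a1 = a(j := a j + 1, j' := a j' - 1)"
  define a2 where "a2 = a(j := a j - 1, j' := a j' + 1)"
  define Q where "Q = qv powi (1 - int (a j) + int (a j'))"
  define e where "e = (if c = j then 1 else (0::nat))"
  have qp: "qv * p = 1" "p * qv = 1" by (simp_all add: p_def)
  have qpk: "qv ^ k * p ^ k = 1" for k by (simp add: p_def qv_inverse_mult)
  have jj: "j \<noteq> j'" and j: "j \<in> {1..n}" "j' \<in> {1..n}"
    using o unfolding node_order_def by blast+
  have gi: "inverse g' = inverse g * qv ^ t" by (simp add: g' power_inverse)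
  have cancel: "qv ^ x * p ^ y = p ^ z * qv ^ u" if "y + u = z + x" for x y z u
  proof -
    have "qv ^ x * p ^ y = qv ^ x * p ^ y * (qv ^ u * p ^ u)" by (simp add: qpk)
    also have "\<dots> = qv ^ x * qv ^ u * p ^ (y + u)" by (simp add: power_add mult_ac)
    also have "\<dots> = (qv ^ x * p ^ x) * (p ^ z * qv ^ u)" unfolding that by (simp add: power_add mult_ac)
    finally show ?thesis by (simp add: qpk)
  qed
  have t1: "inverse g' * B * vc a1 = p ^ N * (inverse g * (B * qv ^ e) * v (a1(c := a1 c + 1)))"
  proof (cases "a j' = 0")
    case False
    have "count_above \<rho> n c a1 + e = N + t"
      using above_move[OF o c, of a, OF False] by (simp add: a1_def e_def N_def)
    then have "qv ^ t * p ^ count_above \<rho> n c a1 = p ^ N * qv ^ e" by (rule cancel)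
    then show ?thesis unfolding gi vc p_def[symmetric] by (simp add: mult_ac)
  qed (simp add: B_def)
  have t2: "g' * Q * A * vc a2 = p ^ N * (g * Q * (A * p ^ e) * v (a2(c := a2 c + 1)))"
  proof (cases "a j = 0")
    case False
    have "a2(j := a2 j + 1, j' := a2 j' - 1) = a"
      using False jj by (auto simp: a2_def fun_eq_iff)
    moreover have "a2 j' \<noteq> 0" by (simp add: a2_def)
    ultimately have "N + e = count_above \<rho> n c a2 + t"
      using above_move[OF o c, of a2] by (simp add: e_def N_def)
    then have "p ^ t * p ^ count_above \<rho> n c a2 = p ^ N * p ^ e" by (simp flip: power_add add: add.commute)
    then show ?thesis unfolding g' vc p_def[symmetric] by (simp add: mult_ac)
  qed (simp add: A_def)
  have L: "node_op j j' g' vc a = p ^ N * (inverse g * (B * qv ^ e) * v (a1(c := a1 c + 1))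
      + g * Q * (A * p ^ e) * v (a2(c := a2 c + 1)))"
    unfolding distrib_left t1[symmetric] t2[symmetric]
    by (simp only: node_op_def a1_def a2_def A_def B_def Q_def)
  consider (1) "c \<noteq> j" "c \<noteq> j'" | (2) "c = j" | (3) "c = j'" by blast
  then show ?thesis
  proof cases
    case 1
    have "node_op j j' g v (a(c := a c + 1)) = inverse g * B * v (a1(c := a1 c + 1)) + g * Q * A * v (a2(c := a2 c + 1))"
      using 1 by (simp add: node_op_def a1_def a2_def A_def B_def Q_def fun_upd_twist)
    then show ?thesis
      using 1 unfolding L N_def[symmetric] p_def[symmetric]
      by (simp add: letter_Kinv_def letter_B_def e_def mult.commute)
  next
    case 2
    have ends: "count_above \<rho> n j' a + a j' = N + t * s"
      using above_ends[OF o, of a] s 2 by (simp add: N_def)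
    have b: "qv ^ (t * s) * p ^ count_above \<rho> n j' a = p ^ N * qv ^ a j'"
      by (rule cancel[OF ends])
    have x: "A * v (a2(c := a2 c + 1)) = A * v (a(j' := a j' + 1))"
    proof (cases "a j = 0")
      case False
      then have "a2(c := a2 c + 1) = a(j' := a j' + 1)" using jj 2 by (auto simp: a2_def fun_eq_iff)
      then show ?thesis by simp
    qed (simp add: A_def)
    have y: "a1(c := a1 c + 1) = a(j := a j + 2, j' := a j' - 1)" using jj 2 by (auto simp: a1_def fun_eq_iff)
    have R: "node_op j j' g v (a(c := a c + 1)) = inverse g * B * v (a(j := a j + 2, j' := a j' - 1))
       + g * (qv powi (- int (a j) + int (a j')) * qint (Suc (a j))) * v (a(j' := a j' + 1))"
      using 2 jj by (simp add: node_op_def B_def fun_upd_twist mult.assoc)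
    have q1: "qv powi (- int (a j) + int (a j')) = Q * p"
      unfolding Q_def p_def using qv_powi_mult_power(2)[of "1 - int (a j) + int (a j')" 1] by simp
    have q2: "qv powi (- int (a j) + int (a j')) * qv ^ a j = qv ^ a j'"
      using qv_powi_mult_power(1)[of "- int (a j) + int (a j')" "a j"] by simp
    have q3: "qv powi (- int (a j) + int (a j')) * qint (Suc (a j)) = p * (Q * (A * p)) + qv ^ a j'"
      unfolding qint_Suc' distrib_left q2 unfolding q1 p_def[symmetric] A_def by (simp add: mult_ac)
    have B1: "letter_B j j' (qv ^ (t * s) * g) c * (v (a(letter_swap j j' c := a (letter_swap j j' c) + 1))
         * p ^ count_above \<rho> n (letter_swap j j' c) a) = p ^ N * (g * qv ^ a j' * v (a(j' := a j' + 1)))"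
    proof -
      have "letter_B j j' (qv ^ (t * s) * g) c * (v (a(letter_swap j j' c := a (letter_swap j j' c) + 1))
         * p ^ count_above \<rho> n (letter_swap j j' c) a)
        = (qv ^ (t * s) * p ^ count_above \<rho> n j' a) * (g * v (a(j' := a j' + 1)))"
        using 2 jj by (simp add: letter_B_def letter_swap_def mult_ac)
      then show ?thesis unfolding b by (simp add: mult_ac)
    qed
    have "letter_Kinv j j' c = p" "e = 1" using 2 by (simp_all add: letter_Kinv_def p_def e_def)
    note k = this
    have "p * (p ^ N * (inverse g * (B * qv) * V + g * Q * (A * p) * v (a2(c := a2 c + 1))))
        = p ^ N * (inverse g * B * V + g * (p * (Q * (A * p))) * v (a(j' := a j' + 1)))" for V
    proof -
      have "p * (p ^ N * (inverse g * (B * qv) * V + g * Q * (A * p) * v (a2(c := a2 c + 1))))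
        = p ^ N * ((p * qv) * (inverse g * B * V) + g * (p * (Q * p)) * (A * v (a2(c := a2 c + 1))))"
        by (simp add: algebra_simps)
      then show ?thesis unfolding x qp by (simp add: algebra_simps)
    qed
    note m = this
    show ?thesis
      unfolding L R N_def[symmetric] p_def[symmetric] B1 k power_one_right y m q3
      by (simp add: algebra_simps)
  next
    case 3
    have cj: "c \<noteq> j" using 3 jj by simp
    have ends: "N + a j' = count_above \<rho> n j a + t * s"
      using above_ends[OF o, of a] s 3 by (simp add: N_def)
    have x: "B * v (a1(c := a1 c + 1)) = B * v (a(j := a j + 1))"
    proof (cases "a j' = 0")
      case False
      then have "a1(c := a1 c + 1) = a(j := a j + 1)" using jj 3 by (auto simp: a1_def fun_eq_iff)
      then show ?thesis by simp
    qed (simp add: B_def)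
    have y: "a2(c := a2 c + 1) = a(j := a j - 1, j' := a j' + 2)" using jj 3 by (auto simp: a2_def fun_eq_iff)
    have q1: "qv powi (1 - int (a j) + int (a j' + 1)) = Q * qv"
      unfolding Q_def using qv_powi_mult_power(1)[of "1 - int (a j) + int (a j')" 1] by (simp add: add.assoc)
    have R: "node_op j j' g v (a(c := a c + 1)) = inverse g * qint (Suc (a j')) * v (a(j := a j + 1))
       + g * (Q * qv) * A * v (a(j := a j - 1, j' := a j' + 2))"
      unfolding q1[symmetric] using 3 jj by (simp add: node_op_def A_def fun_upd_twist)
    have B1: "letter_B j j' (qv ^ (t * s) * g) c * (v (a(letter_swap j j' c := a (letter_swap j j' c) + 1))
         * p ^ count_above \<rho> n (letter_swap j j' c) a) = p ^ N * (inverse g * p ^ a j' * v (a(j := a j + 1)))"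
    proof -
      have "letter_B j j' (qv ^ (t * s) * g) c * (v (a(letter_swap j j' c := a (letter_swap j j' c) + 1))
         * p ^ count_above \<rho> n (letter_swap j j' c) a)
        = p ^ (count_above \<rho> n j a + t * s) * (inverse g * v (a(j := a j + 1)))"
        using 3 jj by (simp add: letter_B_def letter_swap_def power_add p_def power_inverse mult_ac)
      then show ?thesis unfolding ends[symmetric] by (simp add: power_add mult_ac)
    qed
    have k: "letter_Kinv j j' c = qv" "e = 0" using 3 jj by (simp_all add: letter_Kinv_def e_def)
    have m: "qv * (p ^ N * (inverse g * (B * 1) * v (a1(c := a1 c + 1)) + g * Q * (A * 1) * V))
        = p ^ N * (inverse g * (qv * B) * v (a(j := a j + 1)) + g * (Q * qv) * A * V)" for V
    proof -
      have "qv * (p ^ N * (inverse g * (B * 1) * v (a1(c := a1 c + 1)) + g * Q * (A * 1) * V))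
        = p ^ N * (inverse g * qv * (B * v (a1(c := a1 c + 1))) + g * (Q * qv) * A * V)"
        by (simp add: algebra_simps)
      then show ?thesis unfolding x by (simp add: algebra_simps)
    qed
    show ?thesis
      unfolding L R N_def[symmetric] p_def[symmetric] B1 k power_0 y m qint_Suc''
      by (simp add: B_def p_def algebra_simps)
  qed
qed

lemma symm_snoc:
  assumes "set w \<subseteq> {1..n}"
  shows "symm \<rho> v (w @ [c]) = symm \<rho> (\<lambda>b. v (b(c := b c + 1)) * inverse qv ^ count_above \<rho> n c b) w"
  by (simp only: symm_def count_list_snoc inversions_snoc[OF assms] power_add mult_ac)

definition site_B :: "nat \<Rightarrow> nat \<Rightarrow> nat \<Rightarrow> nat \<Rightarrow> Cqx \<Rightarrow> nat \<Rightarrow> nat \<Rightarrow> Cqx" where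
  "site_B j j' t s g p = letter_B j j' (qv powi (int t * (2 * int p + 1 - int s)) * g)"

lemma symm_node_op:
  assumes o: "node_order \<rho> n j j' t" and g: "g \<noteq> 0" and w: "set w \<subseteq> {1..n}"
  shows "word_op (letter_swap j j') (site_B j j' t (length w) g) (\<lambda>_. letter_Kinv j j') (symm \<rho> v) w
    = symm \<rho> (node_op j j' g v) w"
  using g w
proof (induction w arbitrary: v g rule: rev_induct)
  case Nil
  show ?case by (simp add: word_op_Nil symm_def node_op_def)
next
  case (snoc c w)
  \<comment> \<open>Among s + 1 factors the first s carry the parameters of an s-fold product,
    multiplied at the affine node (t = 1) by q^-1.\<close>
  define g' where "g' = g * inverse qv ^ t"
  define vc where "vc = (\<lambda>b. v (b(c := b c + 1)) * inverse qv ^ count_above \<rho> n c b)"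
  have w: "set w \<subseteq> {1..n}" and c: "c \<in> {1..n}" and g: "g \<noteq> 0" and g'0: "g' \<noteq> 0"
    using snoc.prems by (auto simp: g'_def)
  have j: "j \<in> {1..n}" "j' \<in> {1..n}" using o unfolding node_order_def by blast+
  have sw: "letter_swap j j' d \<in> {1..n}" if "d \<in> {1..n}" for d
    using that j by (simp add: letter_swap_def)
  have len: "(\<Sum>i=1..n. count_list w i) = length w"
    using sum_count_set[OF w] by simp
  have site: "site_B j j' t (length (w @ [c])) g p = site_B j j' t (length w) g' p" for p
  proof -
    have "int t * (2 * int p + 1 - int (Suc (length w))) = int t * (2 * int p + 1 - int (length w)) - int t"
      by (simp add: algebra_simps)
    then have "qv powi (int t * (2 * int p + 1 - int (Suc (length w)))) * g
       = qv powi (int t * (2 * int p + 1 - int (length w))) * g'"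
      unfolding g'_def using qv_powi_mult_power(2)[of "int t * (2 * int p + 1 - int (length w))" t]
      by (simp only: mult_ac)
    then show ?thesis by (simp add: site_B_def)
  qed
  have last: "site_B j j' t (length (w @ [c])) g (length w) = letter_B j j' (qv ^ (t * length w) * g)"
  proof -
    have "int t * (2 * int (length w) + 1 - int (Suc (length w))) = int (t * length w)" by simp
    then show ?thesis unfolding site_B_def by (simp only: length_append_singleton power_int_of_nat)
  qed
  have 1: "word_op (letter_swap j j') (site_B j j' t (length (w @ [c])) g) (\<lambda>_. letter_Kinv j j') (\<lambda>u. symm \<rho> v (u @ [c])) w
     = symm \<rho> (node_op j j' g' vc) w"
  proof -
    have "word_op (letter_swap j j') (site_B j j' t (length (w @ [c])) g) (\<lambda>_. letter_Kinv j j') (\<lambda>u. symm \<rho> v (u @ [c])) w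
      = word_op (letter_swap j j') (site_B j j' t (length w) g') (\<lambda>_. letter_Kinv j j') (\<lambda>u. symm \<rho> v (u @ [c])) w"
      by (subst word_op_cong[where \<beta>' = "site_B j j' t (length w) g'"]) (simp_all only: site)
    also have "\<dots> = word_op (letter_swap j j') (site_B j j' t (length w) g') (\<lambda>_. letter_Kinv j j') (symm \<rho> vc) w"
    proof (rule word_op_ext)
      fix p assume "p < length w"
      then have "set (w[p := letter_swap j j' (w ! p)]) \<subseteq> {1..n}"
        using w sw set_update_subset_insert[of w p] by (metis (no_types, lifting) insert_subset nth_mem order_trans subset_iff)
      then show "symm \<rho> v (w[p := letter_swap j j' (w ! p)] @ [c]) = symm \<rho> vc (w[p := letter_swap j j' (w ! p)])"
        unfolding vc_def by (rule symm_snoc)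
    qed
    also have "\<dots> = symm \<rho> (node_op j j' g' vc) w" by (rule snoc.IH[OF g'0 w])
    finally show ?thesis .
  qed
  let ?a = "count_list w" and ?d = "letter_swap j j' c"
  have 2: "symm \<rho> v (w @ [?d]) = v (?a(?d := ?a ?d + 1)) * inverse qv ^ count_above \<rho> n ?d ?a * inverse qv ^ inversions \<rho> w"
    unfolding symm_def count_list_snoc inversions_snoc[OF w] power_add by (simp only: mult_ac)
  have 3: "symm \<rho> (node_op j j' g v) (w @ [c]) = node_op j j' g v (?a(c := ?a c + 1)) * inverse qv ^ count_above \<rho> n c ?a * inverse qv ^ inversions \<rho> w"
    unfolding symm_def count_list_snoc inversions_snoc[OF w] power_add by (simp only: mult_ac)
  have "word_op (letter_swap j j') (site_B j j' t (length (w @ [c])) g) (\<lambda>_. letter_Kinv j j') (symm \<rho> v) (w @ [c])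
    = (letter_Kinv j j' c * node_op j j' g' vc ?a + letter_B j j' (qv ^ (t * length w) * g) c *
        (v (?a(?d := ?a ?d + 1)) * inverse qv ^ count_above \<rho> n ?d ?a)) * inverse qv ^ inversions \<rho> w"
    unfolding word_op_snoc 1 2 last unfolding symm_def by (simp only: distrib_right mult.assoc)
  also have "\<dots> = symm \<rho> (node_op j j' g v) (w @ [c])"
    unfolding 3 node_op_snoc[OF o g c len vc_def g'_def] ..
  finally show ?case .
qed

section \<open>The embeddings into the tensor power\<close>

definition sym_embed :: "(nat \<Rightarrow> nat) \<Rightarrow> nat \<Rightarrow> nat \<Rightarrow> comp vec \<Rightarrow> nat list vec" where
  "sym_embed \<rho> n s v = (\<lambda>w. if w \<in> words n s then symm \<rho> v w else 0)"

lemma words_update: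
  assumes "\<And>c. sw c \<in> {1..n} \<longleftrightarrow> c \<in> {1..n}" "p < length w"
  shows "w[p := sw (w ! p)] \<in> words n s \<longleftrightarrow> w \<in> words n s"
proof -
  have "set (w[p := sw (w ! p)]) \<subseteq> {1..n} \<longleftrightarrow> (\<forall>r<length w. w[p := sw (w ! p)] ! r \<in> {1..n})"
    by (auto simp: set_conv_nth)
  also have "\<dots> \<longleftrightarrow> (\<forall>r<length w. w ! r \<in> {1..n})"
    using assms by (intro all_cong) (auto simp: nth_list_update)
  also have "\<dots> \<longleftrightarrow> set w \<subseteq> {1..n}" by (auto simp: set_conv_nth)
  finally show ?thesis by (simp add: words_def)
qed

lemma letter_swap_in: "j \<in> {1..n} \<Longrightarrow> j' \<in> {1..n} \<Longrightarrow> letter_swap j j' c \<in> {1..n} \<longleftrightarrow> c \<in> {1..n}"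
  by (auto simp: letter_swap_def)

lemma word_op_vspace:
  assumes "\<And>c. sw c \<in> {1..n} \<longleftrightarrow> c \<in> {1..n}" "y \<in> vspace (words n s)"
  shows "word_op sw \<beta> \<kappa> y \<in> vspace (words n s)"
  using assms words_update[of sw n] by (auto simp: vspace_def word_op_def intro!: sum.neutral)

lemma words_length: "w \<in> words n s \<Longrightarrow> length w = s" and words_set: "w \<in> words n s \<Longrightarrow> set w \<subseteq> {1..n}"
  by (simp_all add: words_def)

lemma words_snoc: "w @ [c] \<in> words n (Suc s) \<longleftrightarrow> w \<in> words n s \<and> c \<in> {1..n}"
  by (auto simp: words_def)

lemma finite_words: "finite (words n s)"
  unfolding words_def using finite_lists_length_eq[of "{1..n}" s] by (simp add: conj_commute)

lemma count_list_comps: "w \<in> words n s \<Longrightarrow> count_list w \<in> comps n s"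
  using sum_count_set[of w "{1..n}"] by (auto simp: words_def comps_def count_list_0_iff)

lemma sym_embed_vspace: "sym_embed \<rho> n s v \<in> vspace (words n s)"
  by (simp add: sym_embed_def vspace_def)

lemma words_of_iff:
  assumes "w \<in> words n s" "a \<in> comps n s" shows "w \<in> words_of n s a \<longleftrightarrow> count_list w = a"
proof -
  have "count_list w i = a i" if "i \<notin> {1..n}" for i
    using assms count_list_comps[OF assms(1)] that unfolding comps_def by auto
  then have "(\<forall>i\<in>{1..n}. count_list w i = a i) \<longleftrightarrow> count_list w = a" by blast
  then show ?thesis using assms(1) by (simp add: words_of_def)
qed

lemma lin_symm:
  assumes E: "\<And>a w. E a w = (if w \<in> words_of n s a then inverse qv ^ inversions \<rho> w else 0)"
  shows "lin (comps n s) E v = sym_embed \<rho> n s v"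
proof
  fix w
  show "lin (comps n s) E v w = sym_embed \<rho> n s v w"
  proof (cases "w \<in> words n s")
    case True
    have "lin (comps n s) E v w = (\<Sum>a\<in>comps n s. if count_list w = a then v (count_list w) * inverse qv ^ inversions \<rho> w else 0)"
      unfolding lin_def E by (intro sum.cong) (auto simp: words_of_iff[OF True])
    then show ?thesis
      using count_list_comps[OF True] finite_comps True by (simp add: sym_embed_def symm_def)
  next
    case False
    then have "w \<notin> words_of n s a" for a by (simp add: words_of_def)
    then show ?thesis using False by (simp add: lin_def E sym_embed_def)
  qed
qed

lemma lin_emb: "lin (comps n s) (emb n s) v = sym_embed (\<lambda>c. c) n s v"
proof (rule lin_symm)
  fix a w
  show "emb n s a w = (if w \<in> words_of n s a then inverse qv ^ inversions (\<lambda>c. c) w else 0)"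
    by (auto simp: emb_def inversions_def words_of_def words_def qv_powi_minus)
qed

lemma lin_embd: "lin (comps n s) (embd n s) v = sym_embed (\<lambda>c. n - c) n s v"
proof (rule lin_symm)
  fix a w
  have "{(p, r). p < r \<and> r < s \<and> w ! p < w ! r} = {(p, r). p < r \<and> r < length w \<and> n - w ! p > n - w ! r}"
    if "w \<in> words n s"
  proof -
    have le: "w ! p \<le> n" if "p < length w" for p
      using \<open>w \<in> words n s\<close> nth_mem[OF that] by (auto simp: words_def)
    then have "w ! p < w ! r \<longleftrightarrow> n - w ! p > n - w ! r" if "p < length w" "r < length w" for p r
      using le[OF that(1)] le[OF that(2)] by arith
    then show ?thesis using words_length[OF that] by auto
  qed
  then show "embd n s a w = (if w \<in> words_of n s a then inverse qv ^ inversions (\<lambda>c. n - c) w else 0)"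
    by (auto simp: embd_def inversions_def words_of_def qv_powi_minus)
qed

lemma sym_embed_node_op:
  assumes o: "node_order \<rho> n j j' t" and g: "g \<noteq> 0"
  shows "word_op (letter_swap j j') (site_B j j' t s g) (\<lambda>_. letter_Kinv j j') (sym_embed \<rho> n s v)
    = sym_embed \<rho> n s (node_op j j' g v)"
proof
  fix w
  have j: "j \<in> {1..n}" "j' \<in> {1..n}" using o unfolding node_order_def by blast+
  note sw = letter_swap_in[OF j]
  show "word_op (letter_swap j j') (site_B j j' t s g) (\<lambda>_. letter_Kinv j j') (sym_embed \<rho> n s v) w
    = sym_embed \<rho> n s (node_op j j' g v) w"
  proof (cases "w \<in> words n s")
    case True
    have "word_op (letter_swap j j') (site_B j j' t s g) (\<lambda>_. letter_Kinv j j') (sym_embed \<rho> n s v) w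
       = word_op (letter_swap j j') (site_B j j' t s g) (\<lambda>_. letter_Kinv j j') (symm \<rho> v) w"
      using True words_update[OF sw] by (intro word_op_ext) (simp add: sym_embed_def)
    then show ?thesis
      using symm_node_op[OF o g words_set[OF True], of v] words_length[OF True] True
      by (simp add: sym_embed_def)
  next
    case False
    then show ?thesis
      using word_op_vspace[where sw = "letter_swap j j'", OF sw sym_embed_vspace]
      by (simp add: vspace_def sym_embed_def)
  qed
qed

lemma comps_word: "a \<in> comps n s \<Longrightarrow> \<exists>w\<in>words n s. count_list w = a"
proof (induction s arbitrary: a)
  case 0
  then have "a i = 0" for i by (cases "i \<in> {1..n}") (auto simp: comps_def)
  then have "count_list [] = a" by (simp add: fun_eq_iff)
  moreover have "[] \<in> words n 0" by (simp add: words_def)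
  ultimately show ?case by blast
next
  case (Suc s)
  then have "(\<Sum>i=1..n. a i) \<noteq> 0" by (simp add: comps_def)
  then obtain i where i: "i \<in> {1..n}" "a i \<noteq> 0" by (meson sum.neutral)
  have "(\<Sum>l=1..n. (a(i := a i - 1)) l + (if l = i then 1 else 0)) = (\<Sum>l=1..n. a l)"
    using i by (intro sum.cong) auto
  then have "a(i := a i - 1) \<in> comps n s"
    using Suc.prems i by (auto simp: sum.distrib comps_def)
  from Suc.IH[OF this] obtain w where w: "w \<in> words n s" "count_list w = a(i := a i - 1)" by blast
  then have "count_list (w @ [i]) = a" unfolding count_list_snoc using i by (simp add: fun_eq_iff)
  then show ?case using w(1) i words_snoc by blast
qed

lemma sym_embed_inj:
  assumes "sym_embed \<rho> n s v = sym_embed \<rho> n s v'" "v \<in> vspace (comps n s)" "v' \<in> vspace (comps n s)"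
  shows "v = v'"
proof
  fix a
  show "v a = v' a"
  proof (cases "a \<in> comps n s")
    case True
    then obtain w where w: "w \<in> words n s" "count_list w = a" using comps_word by blast
    show ?thesis using fun_cong[OF assms(1), of w] w by (simp add: sym_embed_def symm_def)
  qed (use assms in \<open>simp add: vspace_def\<close>)
qed

lemma lin_op_sym_embed: "lin_op (sym_embed \<rho> n s)"
  by (auto simp: lin_op_def sym_embed_def symm_def algebra_simps)

section \<open>Extremal eigenvectors in the tensor power\<close>

lemma qint_middle: "(qv + inverse qv) * qint (Suc k) = qint (Suc (Suc k)) + qint k"
proof -
  define p where "p = inverse qv"
  have qp: "p * qv = 1" by (simp add: p_def)
  have 1: "qint (Suc (Suc k)) = qv * qint (Suc k) + p * p ^ k" using qint_Suc''[of "Suc k"] by (simp add: p_def)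
  have "p * qint (Suc k) = (p * qv) * qint k + p * p ^ k" unfolding qint_Suc'' by (simp add: p_def algebra_simps)
  then show ?thesis unfolding 1 p_def[symmetric] qp by (simp add: algebra_simps)
qed

lemma qint_square: "qint (Suc k) ^ 2 = 1 + qint k * qint (Suc (Suc k))"
proof -
  define p where "p = inverse qv"
  have qp: "p * qv = 1" by (simp add: p_def)
  have "qint (Suc k) - qv * qint k = p ^ k" unfolding qint_Suc'' by (simp add: p_def)
  moreover have "qint (Suc k) - p * qint k = qv ^ k" unfolding qint_Suc' by (simp add: p_def)
  ultimately have "(qint (Suc k) - qv * qint k) * (qint (Suc k) - p * qint k) = p ^ k * qv ^ k"
    by simp
  also have "\<dots> = 1" using qv_inverse_mult[of k] by (simp add: p_def mult.commute)
  finally have "qint (Suc k) ^ 2 - qint k * ((qv + p) * qint (Suc k)) + (p * qv) * qint k * qint k = 1"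
    by (simp add: power2_eq_square algebra_simps)
  moreover have "(qv + p) * qint (Suc k) = qint (Suc (Suc k)) + qint k"
    using qint_middle[of k] by (simp only: p_def)
  ultimately have "qint (Suc k) ^ 2 - qint k * (qint (Suc (Suc k)) + qint k) + 1 * qint k * qint k = 1"
    unfolding qp by (simp only:)
  then show ?thesis by (simp add: algebra_simps)
qed

context
  fixes n j j' :: nat and \<epsilon> :: Cqx
  assumes j: "j \<in> {1..n}" "j' \<in> {1..n}" "j \<noteq> j'" and \<epsilon>: "\<epsilon> * \<epsilon> = 1"
begin

definition flat_op :: "nat list vec \<Rightarrow> nat list vec" where
  "flat_op = word_op (letter_swap j j') (\<lambda>_. letter_B j j' 1) (\<lambda>_. letter_Kinv j j')"

lemma flat_op_snoc:
  "flat_op y (w @ [c]) = letter_Kinv j j' c * flat_op (\<lambda>u. y (u @ [c])) w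
     + letter_B j j' 1 c * y (w @ [letter_swap j j' c])"
  by (simp add: flat_op_def word_op_snoc)

lemma lin_op_flat_op: "lin_op flat_op"
  unfolding flat_op_def by (rule lin_op_word_op)

text \<open>If \<open>y = \<Sum>\<^sub>c y\<^sub>c \<otimes> v\<^sub>c\<close> has eigenvalue \<open>\<epsilon> [k]\<close>, then \<open>(B - \<epsilon> [k - 1]) (B - \<epsilon> [k + 1]) y\<^sub>j = 0\<close>.\<close>

lemma flat_op_eigen_snoc:
  assumes eig: "flat_op y = (\<lambda>w. \<epsilon> * qint (Suc k) * y w)"
  defines "z \<equiv> (\<lambda>u. flat_op (\<lambda>u. y (u @ [j])) u + (- (\<epsilon> * qint k)) * y (u @ [j]))"
  shows "c \<noteq> j \<Longrightarrow> c \<noteq> j' \<Longrightarrow> flat_op (\<lambda>u. y (u @ [c])) = (\<lambda>u. \<epsilon> * qint (Suc k) * y (u @ [c]))"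
    and "y (u @ [j']) = \<epsilon> * qint (Suc k) * y (u @ [j]) - inverse qv * flat_op (\<lambda>u. y (u @ [j])) u"
    and "flat_op z = (\<lambda>u. \<epsilon> * qint (Suc (Suc k)) * z u)"
proof -
  define p where "p = inverse qv"
  have qp: "qv * p = 1" by (simp add: p_def)
  define lam where "lam = \<epsilon> * qint (Suc k)"
  define f where "f c = (\<lambda>u. y (u @ [c]))" for c
  have e: "letter_Kinv j j' c * flat_op (f c) w + letter_B j j' 1 c * f (letter_swap j j' c) w = lam * f c w" for c w
    using fun_cong[OF eig, of "w @ [c]"] unfolding flat_op_snoc f_def lam_def .
  show "flat_op (\<lambda>u. y (u @ [c])) = (\<lambda>u. \<epsilon> * qint (Suc k) * y (u @ [c]))" if "c \<noteq> j" "c \<noteq> j'"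
    using e[of c] that unfolding f_def lam_def by (auto simp: letter_Kinv_def letter_B_def fun_eq_iff)
  have ej: "p * flat_op (f j) w + f j' w = lam * f j w" for w
    using e[of j w] j by (simp add: letter_Kinv_def letter_B_def letter_swap_def p_def)
  have ej': "qv * flat_op (f j') w + f j w = lam * f j' w" for w
    using e[of j' w] j by (simp add: letter_Kinv_def letter_B_def letter_swap_def)
  have fj': "f j' w = lam * f j w + (- p) * flat_op (f j) w" for w
    using ej[of w] by (simp add: algebra_simps)
  then show "y (u @ [j']) = \<epsilon> * qint (Suc k) * y (u @ [j]) - inverse qv * flat_op (\<lambda>u. y (u @ [j])) u"
    by (simp add: f_def lam_def p_def)
  have Bj': "flat_op (f j') w = lam * flat_op (f j) w + (- p) * flat_op (flat_op (f j)) w" for w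
  proof -
    have "f j' = (\<lambda>w. lam * f j w + (- p) * flat_op (f j) w)" using fj' by blast
    then have "flat_op (f j') = flat_op (\<lambda>w. lam * f j w + (- p) * flat_op (f j) w)" by simp
    also have "\<dots> = (\<lambda>w. lam * flat_op (f j) w + (- p) * flat_op (flat_op (f j)) w)"
      by (simp only: lin_op_add[OF lin_op_flat_op, of "\<lambda>w. lam * f j w"] lin_op_smult[OF lin_op_flat_op, of lam]
          lin_op_smult[OF lin_op_flat_op, of "- p"])
    finally show ?thesis by simp
  qed
  \<comment> \<open>Inserting the equation of the j-component into that of the j'-component gives a
    quadratic equation for B on y_j. By \<open>qint_middle\<close> and \<open>qint_square\<close>
    its roots are \<epsilon> [k] and \<epsilon> [k + 2].\<close>
  have BB: "flat_op (flat_op (f j)) w = \<epsilon> * ((qv + p) * qint (Suc k)) * flat_op (f j) w + (1 - qint (Suc k) ^ 2) * f j w" for w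
  proof -
    have "qv * (lam * flat_op (f j) w + (- p) * flat_op (flat_op (f j)) w) + f j w
        = lam * (lam * f j w + (- p) * flat_op (f j) w)"
      using ej'[of w] unfolding Bj' fj' .
    then have "(qv * p) * flat_op (flat_op (f j)) w = lam * (qv + p) * flat_op (f j) w + (1 - lam * lam) * f j w"
      by (simp add: algebra_simps)
    moreover have "lam * lam = (\<epsilon> * \<epsilon>) * qint (Suc k) ^ 2" by (simp add: lam_def power2_eq_square)
    ultimately show ?thesis unfolding qp \<epsilon> by (simp add: lam_def mult_ac)
  qed
  have z: "z = (\<lambda>u. flat_op (f j) u + (- (\<epsilon> * qint k)) * f j u)"
    unfolding z_def f_def ..
  have "flat_op z = (\<lambda>u. flat_op (flat_op (f j)) u + (- (\<epsilon> * qint k)) * flat_op (f j) u)"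
    unfolding z lin_op_add[OF lin_op_flat_op, of "flat_op (f j)"] lin_op_smult[OF lin_op_flat_op, of "- (\<epsilon> * qint k)"] ..
  also have "\<dots> = (\<lambda>u. \<epsilon> * qint (Suc (Suc k)) * z u)"
  proof
    fix u
    have "flat_op (flat_op (f j)) u + (- (\<epsilon> * qint k)) * flat_op (f j) u
       = \<epsilon> * qint (Suc (Suc k)) * flat_op (f j) u - qint k * qint (Suc (Suc k)) * f j u"
      unfolding BB p_def qint_middle qint_square by (simp add: algebra_simps)
    also have "\<dots> = \<epsilon> * qint (Suc (Suc k)) * flat_op (f j) u - (\<epsilon> * \<epsilon>) * qint k * qint (Suc (Suc k)) * f j u"
      unfolding \<epsilon> by simp
    also have "\<dots> = \<epsilon> * qint (Suc (Suc k)) * z u" unfolding z by (simp add: algebra_simps)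
    finally show "flat_op (flat_op (f j)) u + (- (\<epsilon> * qint k)) * flat_op (f j) u = \<epsilon> * qint (Suc (Suc k)) * z u" .
  qed
  finally show "flat_op z = (\<lambda>u. \<epsilon> * qint (Suc (Suc k)) * z u)" .
qed

lemma vspace_snoc:
  "y \<in> vspace (words n (Suc s)) \<Longrightarrow> (\<lambda>u. y (u @ [c])) \<in> vspace (words n s)"
  by (auto simp: vspace_def words_snoc)

lemma flat_op_vspace: "y \<in> vspace (words n s) \<Longrightarrow> flat_op y \<in> vspace (words n s)"
  unfolding flat_op_def by (rule word_op_vspace[OF letter_swap_in[OF j(1,2)]])

lemma vspace_words_eq_0:
  assumes "y \<in> vspace (words n (Suc s))" "\<And>c u. c \<in> {1..n} \<Longrightarrow> y (u @ [c]) = 0"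
  shows "y = (\<lambda>w. 0)"
proof
  fix w
  show "y w = 0"
  proof (cases w rule: rev_cases)
    case Nil
    then show ?thesis using assms(1) by (simp add: vspace_def words_def)
  next
    case (snoc u c)
    then show ?thesis using assms words_snoc by (cases "c \<in> {1..n}") (auto simp: vspace_def)
  qed
qed

text \<open>Removing the last letter lowers k by at most one, so k stays above the number of
  factors. The auxiliary vector z has eigenvalue \<epsilon> [k + 1] and vanishes by induction; then
  y_j is an eigenvector for \<epsilon> [k - 1] and vanishes too, and the other components
  follow.\<close>

lemma flat_op_eigen_zero:
  "y \<in> vspace (words n s) \<Longrightarrow> flat_op y = (\<lambda>w. \<epsilon> * qint k * y w) \<Longrightarrow> s < k \<Longrightarrow> y = (\<lambda>w. 0)"
proof (induction s arbitrary: y k)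
  case 0
  have "\<epsilon> * qint k * y [] = 0"
    using fun_cong[OF 0(2), of "[]"] by (simp add: flat_op_def word_op_Nil)
  moreover have "\<epsilon> \<noteq> 0" using \<epsilon> by auto
  ultimately have "y [] = 0" using 0 by simp
  then have "y w = 0" for w using 0(1) by (cases "w = []") (auto simp: vspace_def words_def)
  then show ?case by blast
next
  case (Suc s)
  then obtain k' where k: "k = Suc k'" by (cases k) auto
  note S = flat_op_eigen_snoc[OF Suc.prems(2)[unfolded k]]
  have v: "(\<lambda>u. y (u @ [c])) \<in> vspace (words n s)" for c using vspace_snoc[OF Suc.prems(1)] .
  have "(\<lambda>u. flat_op (\<lambda>u. y (u @ [j])) u + (- (\<epsilon> * qint k')) * y (u @ [j])) \<in> vspace (words n s)"
    using v[of j] flat_op_vspace[OF v[of j]] by (simp add: vspace_def)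
  then have "(\<lambda>u. flat_op (\<lambda>u. y (u @ [j])) u + (- (\<epsilon> * qint k')) * y (u @ [j])) = (\<lambda>w. 0)"
    using Suc.prems(3) k by (intro Suc.IH[OF _ S(3)]) auto
  then have eq: "flat_op (\<lambda>u. y (u @ [j])) = (\<lambda>u. \<epsilon> * qint k' * y (u @ [j]))"
    by (simp add: fun_eq_iff)
  then have yj: "(\<lambda>u. y (u @ [j])) = (\<lambda>u. 0)"
    using Suc.prems(3) k by (intro Suc.IH[OF v]) auto
  then have y0: "y (u @ [j]) = 0" for u by (rule fun_cong)
  have "y (u @ [c]) = 0" for u c
  proof -
    consider "c = j" | "c = j'" | "c \<noteq> j" "c \<noteq> j'" by blast
    then show ?thesis
    proof cases
      case 2
      then show ?thesis using S(2)[of u] fun_cong[OF eq, of u] y0 by simp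
    next
      case 3
      then have "(\<lambda>u. y (u @ [c])) = (\<lambda>u. 0)"
        using Suc.prems(3) k by (intro Suc.IH[OF v S(1)]) auto
      then show ?thesis by (rule fun_cong)
    qed (use y0 in simp)
  qed
  then show ?case using vspace_words_eq_0[OF Suc.prems(1)] by blast
qed

text \<open>Its symmetrisation takes on a word in j and j' the value \<epsilon>^(a j') times q to
  the sum of the positions, counted from 0, of the letters j'. That sum is a j' (a j' - 1) / 2 plus
  the number of pairs with j before j', and the latter is a j times a j' minus the number of
  inversions.\<close>

definition top_vec :: "comp vec" where
  "top_vec a = (if \<forall>l. l \<noteq> j \<and> l \<noteq> j' \<longrightarrow> a l = 0
     then \<epsilon> ^ a j' * qv ^ (a j * a j' + a j' * (a j' - 1) div 2) else 0)"

text \<open>By the vanishing for larger eigenvalues, the component at the last letter j is again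
  extremal, the component at j' is \<epsilon> q^s times it with s the number of preceding letters,
  and all other components are 0. This is the recursion satisfied by \<open>top_vec\<close>, so the
  eigenspace has dimension at most one.\<close>

lemma flat_op_eigen_top:
  assumes o: "node_order \<rho> n j j' 0"
  shows "y \<in> vspace (words n s) \<Longrightarrow> flat_op y = (\<lambda>w. \<epsilon> * qint s * y w) \<Longrightarrow>
    \<exists>t. y = sym_embed \<rho> n s (\<lambda>a. t * top_vec a)"
proof (induction s arbitrary: y)
  case 0
  have "y w = sym_embed \<rho> n 0 (\<lambda>a. y [] * top_vec a) w" for w
  proof (cases "w = []")
    case True
    have "{(p, r). p < r \<and> r < (0::nat) \<and> \<rho> ([] ! r) < \<rho> ([] ! p)} = {}" by auto
    then show ?thesis using True by (simp add: sym_embed_def words_def symm_def top_vec_def inversions_def)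
  next
    case False
    then show ?thesis using 0(1) by (simp add: sym_embed_def words_def vspace_def)
  qed
  then show ?case by blast
next
  case (Suc s)
  note S = flat_op_eigen_snoc[OF Suc.prems(2)]
  have v: "(\<lambda>u. y (u @ [c])) \<in> vspace (words n s)" for c using vspace_snoc[OF Suc.prems(1)] .
  have "(\<lambda>u. flat_op (\<lambda>u. y (u @ [j])) u + (- (\<epsilon> * qint s)) * y (u @ [j])) \<in> vspace (words n s)"
    using v[of j] flat_op_vspace[OF v[of j]] by (simp add: vspace_def)
  then have "(\<lambda>u. flat_op (\<lambda>u. y (u @ [j])) u + (- (\<epsilon> * qint s)) * y (u @ [j])) = (\<lambda>w. 0)"
    by (intro flat_op_eigen_zero[OF _ S(3)]) auto
  then have eq: "flat_op (\<lambda>u. y (u @ [j])) = (\<lambda>u. \<epsilon> * qint s * y (u @ [j]))"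
    by (simp add: fun_eq_iff)
  from Suc.IH[OF v this] obtain t where t: "(\<lambda>u. y (u @ [j])) = sym_embed \<rho> n s (\<lambda>a. t * top_vec a)" by blast
  have yj: "y (u @ [j]) = t * symm \<rho> top_vec u" if "u \<in> words n s" for u
    using fun_cong[OF t, of u] that by (simp add: sym_embed_def symm_def)
  have yj': "y (u @ [j']) = \<epsilon> * qv ^ s * y (u @ [j])" for u
  proof -
    have "y (u @ [j']) = \<epsilon> * (qint (Suc s) - inverse qv * qint s) * y (u @ [j])"
      using S(2)[of u] fun_cong[OF eq, of u] by (simp add: algebra_simps)
    then show ?thesis by (simp add: qint_Suc')
  qed
  have yc: "y (u @ [c]) = 0" if "c \<noteq> j" "c \<noteq> j'" for u c
  proof -
    have "(\<lambda>u. y (u @ [c])) = (\<lambda>u. 0)"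
      by (rule flat_op_eigen_zero[OF v S(1)[OF that]]) simp
    then show ?thesis by (rule fun_cong)
  qed
  have \<rho>: "\<rho> j' = \<rho> j + 1" using o by (auto simp: node_order_def)
  have above: "count_above \<rho> n j a = a j'" "count_above \<rho> n j' a = 0"
    if "\<forall>l. l \<noteq> j \<and> l \<noteq> j' \<longrightarrow> a l = 0" for a
  proof -
    have "count_above \<rho> n j a = (\<Sum>d\<in>{d\<in>{1..n}. \<rho> d > \<rho> j}. if d = j' then a j' else 0)"
      unfolding count_above_def using that by (intro sum.cong) auto
    then show "count_above \<rho> n j a = a j'" using \<rho> j by simp
    show "count_above \<rho> n j' a = 0"
      unfolding count_above_def
    proof (intro sum.neutral ballI)
      fix d assume "d \<in> {d\<in>{1..n}. \<rho> d > \<rho> j'}"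
      then have "d \<noteq> j" "d \<noteq> j'" using \<rho> by auto
      then show "a d = 0" using that by blast
    qed
  qed
  have tri: "Suc m * m div 2 = m * (m - 1) div 2 + m" for m using triangular_Suc[of m] .
  have supp: "(\<forall>l. l \<noteq> j \<and> l \<noteq> j' \<longrightarrow> (a(c := a c + 1)) l = 0) \<longleftrightarrow> (c = j \<or> c = j') \<and> (\<forall>l. l \<noteq> j \<and> l \<noteq> j' \<longrightarrow> a l = 0)" for a :: comp and c
    by auto
  have cancel: "qv ^ (x + m) * inverse qv ^ m = qv ^ x" for x m
    using qv_inverse_mult[of m] by (simp add: power_add mult.assoc)
  have step: "symm \<rho> top_vec (u @ [c]) =
      (if c = j then symm \<rho> top_vec u else if c = j' then \<epsilon> * qv ^ s * symm \<rho> top_vec u else 0)"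
    if u: "u \<in> words n s" for u c
  proof -
    let ?a = "count_list u"
    have sum: "?a j + ?a j' = s" if "\<forall>l. l \<noteq> j \<and> l \<noteq> j' \<longrightarrow> ?a l = 0"
    proof -
      have "(\<Sum>l\<in>{1..n} - {j, j'}. ?a l) = 0" using that by (intro sum.neutral) auto
      then show ?thesis
        using sum_split_two[OF j, of ?a] count_list_comps[OF u] by (simp add: comps_def)
    qed
    have "top_vec (?a(c := ?a c + 1)) * inverse qv ^ count_above \<rho> n c ?a
      = (if c = j then top_vec ?a else if c = j' then \<epsilon> * qv ^ s * top_vec ?a else 0)"
    proof (cases "(c = j \<or> c = j') \<and> (\<forall>l. l \<noteq> j \<and> l \<noteq> j' \<longrightarrow> ?a l = 0)")
      case False
      then show ?thesis unfolding top_vec_def supp by auto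
    next
      case True
      let ?x = "?a j" and ?y = "?a j'"
      have a0: "\<forall>l. l \<noteq> j \<and> l \<noteq> j' \<longrightarrow> ?a l = 0" using True by blast
      show ?thesis
      proof (cases "c = j")
        case cj: True
        have "Suc ?x * ?y + ?y * (?y - 1) div 2 = (?x * ?y + ?y * (?y - 1) div 2) + ?y" by simp
        then have "top_vec (?a(j := ?x + 1)) = \<epsilon> ^ ?y * qv ^ ((?x * ?y + ?y * (?y - 1) div 2) + ?y)"
          unfolding top_vec_def supp using a0 j by (simp add: add_ac)
        then show ?thesis
          using cj a0 by (simp add: above(1)[OF a0] mult.assoc cancel top_vec_def)
      next
        case False
        then have cj: "c = j'" using True by blast
        have E: "?x * Suc ?y + Suc ?y * (Suc ?y - 1) div 2 = s + (?x * ?y + ?y * (?y - 1) div 2)"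
          using tri[of ?y] sum[OF a0] by simp
        have "top_vec (?a(j' := ?y + 1)) = \<epsilon> ^ Suc ?y * qv ^ (?x * Suc ?y + Suc ?y * (Suc ?y - 1) div 2)"
          unfolding top_vec_def supp using a0 j by simp
        then have "top_vec (?a(j' := ?y + 1)) = \<epsilon> ^ Suc ?y * qv ^ (s + (?x * ?y + ?y * (?y - 1) div 2))"
          unfolding E .
        then show ?thesis
          using cj False a0 by (simp add: above(2)[OF a0] power_add top_vec_def mult_ac)
      qed
    qed
    then show ?thesis
      unfolding symm_snoc[OF words_set[OF u]] by (simp add: symm_def)
  qed
  have "y w = sym_embed \<rho> n (Suc s) (\<lambda>a. t * top_vec a) w" for w
  proof (cases "w \<in> words n (Suc s)")
    case True
    then obtain u c where w: "w = u @ [c]" by (cases w rule: rev_cases) (auto simp: words_def)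
    then have u: "u \<in> words n s" using True words_snoc by blast
    have "sym_embed \<rho> n (Suc s) (\<lambda>a. t * top_vec a) w = t * symm \<rho> top_vec (u @ [c])"
      using True w by (simp add: sym_embed_def symm_def)
    then show ?thesis
      unfolding step[OF u] w using yj[OF u] yj'[of u] yc[of c u] by (simp add: mult_ac)
  next
    case False
    then show ?thesis using Suc.prems(1) by (simp add: sym_embed_def vspace_def)
  qed
  then show ?case by blast
qed

end

section \<open>The K-matrix as a composite of intertwiners\<close>

text \<open>A site \<open>(False, z)\<close> stands for the tensor factor \<open>W(z)\<close> and \<open>(True, z)\<close> for \<open>W\<^sup>\<or>(z\<inverse>)\<close>. With
  this convention \<open>B\<^sub>i\<close> has the same matrix on both, so that \<open>v\<^sub>j \<mapsto> v\<^sub>j\<^sup>\<or>\<close> only changes the flag.\<close>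

definition site_coeff :: "nat \<Rightarrow> nat \<Rightarrow> bool \<times> Cqx \<Rightarrow> nat \<Rightarrow> Cqx" where
  "site_coeff n i S = letter_B i (nxt n i) (spec n (snd S) i)"

definition site_Kinv :: "nat \<Rightarrow> nat \<Rightarrow> bool \<times> Cqx \<Rightarrow> nat \<Rightarrow> Cqx" where
  "site_Kinv n i S = (if fst S then letter_Kinv (nxt n i) i else letter_Kinv i (nxt n i))"

abbreviation node_letter :: "nat \<Rightarrow> nat \<Rightarrow> nat \<Rightarrow> nat" where
  "node_letter n i \<equiv> letter_swap i (nxt n i)"

definition sites_op :: "nat \<Rightarrow> nat \<Rightarrow> (nat \<Rightarrow> bool \<times> Cqx) \<Rightarrow> nat list vec \<Rightarrow> nat list vec" where
  "sites_op n i S = word_op (node_letter n i) (\<lambda>p. site_coeff n i (S p)) (\<lambda>p. site_Kinv n i (S p))"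

definition pair_op :: "nat \<Rightarrow> nat \<Rightarrow> bool \<times> Cqx \<Rightarrow> bool \<times> Cqx \<Rightarrow> (nat \<times> nat) vec \<Rightarrow> (nat \<times> nat) vec" where
  "pair_op n i S T y = (\<lambda>(c, d). site_Kinv n i T d * site_coeff n i S c * y (node_letter n i c, d)
     + site_coeff n i T d * y (c, node_letter n i d))"

definition pair_Kinv :: "nat \<Rightarrow> nat \<Rightarrow> bool \<times> Cqx \<Rightarrow> bool \<times> Cqx \<Rightarrow> (nat \<times> nat) vec \<Rightarrow> (nat \<times> nat) vec" where
  "pair_Kinv n i S T y = (\<lambda>(c, d). site_Kinv n i S c * site_Kinv n i T d * y (c, d))"

text \<open>The consequences of U-linear bijectivity that are used: the action of B on the two
  factors, needed when B hits one of them, and that of the inverse of K on both, needed when B acts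
  further to the left.\<close>

definition swaps_sites :: "nat \<Rightarrow> bool \<times> Cqx \<Rightarrow> bool \<times> Cqx \<Rightarrow> (nat \<times> nat \<Rightarrow> (nat \<times> nat) vec) \<Rightarrow> bool" where
  "swaps_sites n S T R \<longleftrightarrow>
     (\<forall>b\<in>{1..n} \<times> {1..n}. R b \<in> vspace ({1..n} \<times> {1..n})) \<and>
     (\<forall>y\<in>vspace ({1..n} \<times> {1..n}). lin ({1..n} \<times> {1..n}) R y = (\<lambda>_. 0) \<longrightarrow> y = (\<lambda>_. 0)) \<and>
     (\<forall>i\<in>{1..n}. \<forall>y. \<forall>b\<in>{1..n} \<times> {1..n}.
        lin ({1..n} \<times> {1..n}) R (pair_op n i S T y) b = pair_op n i T S (lin ({1..n} \<times> {1..n}) R y) b \<and>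
        lin ({1..n} \<times> {1..n}) R (pair_Kinv n i S T y) b = pair_Kinv n i T S (lin ({1..n} \<times> {1..n}) R y) b)"

definition at_pair :: "nat list vec \<Rightarrow> nat list \<Rightarrow> nat \<Rightarrow> (nat \<times> nat) vec" where
  "at_pair y w p = (\<lambda>(a, b). y (w[p := a, Suc p := b]))"

lemma words_nth: "w \<in> words n s \<Longrightarrow> r < s \<Longrightarrow> w ! r \<in> {1..n}"
  unfolding words_def using nth_mem by blast

text \<open>\<open>R_at\<close> mixes only words that agree outside the positions p and p + 1, so
  everything happens on the two-letter slice \<open>at_pair y w p\<close>. The argument
  \<open>Suc p\<close> numbers the tensor factors from 1, whereas letters are numbered from
  0.\<close>

lemma R_at_eq:
  assumes p: "Suc p < s" and w: "length w = s" and y: "y \<in> vspace (words n s)"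
  shows "R_at n s (Suc p) R y w = lin ({1..n} \<times> {1..n}) R (at_pair y w p) (w ! p, w ! Suc p)"
proof -
  let ?L = "{1..n} \<times> {1..n}"
  let ?h = "\<lambda>(a, b). w[p := a, Suc p := b]"
  let ?q = "(w ! p, w ! Suc p)"
  define Z where "Z = {u \<in> words n s. \<forall>r<s. r \<noteq> p \<and> r \<noteq> Suc p \<longrightarrow> w ! r = u ! r}"
  have nth: "w[p := a, Suc p := b] ! p = a" "w[p := a, Suc p := b] ! Suc p = b" for a b
    using p w by simp_all
  have inj: "inj_on ?h ?L"
  proof (rule inj_onI, clarify)
    fix a b a' b' assume "w[p := a, Suc p := b] = w[p := a', Suc p := b']"
    then show "a = a' \<and> b = b'" using nth by metis
  qed
  have sub: "Z \<subseteq> ?h ` ?L"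
  proof
    fix u assume u: "u \<in> Z"
    then have lu: "length u = s" "set u \<subseteq> {1..n}" by (simp_all add: Z_def words_def)
    have "u = w[p := u ! p, Suc p := u ! Suc p]"
    proof (rule nth_equalityI)
      fix r assume "r < length u"
      then show "u ! r = w[p := u ! p, Suc p := u ! Suc p] ! r"
        using u lu w nth[of "u ! p" "u ! Suc p"]
        by (cases "r = p"; cases "r = Suc p") (simp_all add: Z_def)
    qed (use lu w in simp)
    moreover have "(u ! p, u ! Suc p) \<in> ?L" using u p words_nth[of u n s] unfolding Z_def by (simp del: atLeastAtMost_iff)
    ultimately show "u \<in> ?h ` ?L" by (metis (no_types, lifting) case_prod_conv image_eqI)
  qed
  have out: "y u = 0" if u0: "u \<in> ?h ` ?L - Z" for u
  proof -
    obtain a b where u: "u = w[p := a, Suc p := b]" using u0 by auto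
    have "\<forall>r<s. r \<noteq> p \<and> r \<noteq> Suc p \<longrightarrow> w ! r = u ! r" using w by (simp add: u)
    then have "u \<notin> words n s" using u0 by (simp add: Z_def)
    then show ?thesis using y by (simp add: vspace_def)
  qed
  have "R_at n s (Suc p) R y w = (\<Sum>u\<in>words n s. if u \<in> Z then y u * R (u ! p, u ! Suc p) ?q else 0)"
    unfolding R_at_def lin_def by (intro sum.cong) (auto simp: Z_def w)
  also have "\<dots> = (\<Sum>u\<in>Z. y u * R (u ! p, u ! Suc p) ?q)"
  proof -
    have "words n s \<inter> Z = Z" by (auto simp: Z_def)
    then show ?thesis by (simp flip: sum.inter_restrict[OF finite_words])
  qed
  also have "\<dots> = (\<Sum>u\<in>?h ` ?L. y u * R (u ! p, u ! Suc p) ?q)"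
    using sub out by (intro sum.mono_neutral_left) auto
  also have "\<dots> = (\<Sum>b\<in>?L. y (?h b) * R (?h b ! p, ?h b ! Suc p) ?q)"
    using sum.reindex[OF inj] by simp
  also have "\<dots> = lin ?L R (at_pair y w p) ?q"
    unfolding lin_def at_pair_def using nth by (intro sum.cong) auto
  finally show ?thesis .
qed

lemma at_pair_vspace:
  assumes "Suc p < length w" "y \<in> vspace (words n (length w))"
  shows "at_pair y w p \<in> vspace ({1..n} \<times> {1..n})"
proof -
  have "y (w[p := a, Suc p := b]) = 0" if "\<not> (a \<in> {1..n} \<and> b \<in> {1..n})" for a b
  proof -
    have "w[p := a, Suc p := b] ! p = a" "w[p := a, Suc p := b] ! Suc p = b" using assms(1) by simp_all
    then have "a \<in> set (w[p := a, Suc p := b])" "b \<in> set (w[p := a, Suc p := b])"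
      using assms(1) by (metis Suc_lessD length_list_update nth_mem)+
    then have "w[p := a, Suc p := b] \<notin> words n (length w)" using that by (auto simp: words_def)
    then show ?thesis using assms(2) by (simp add: vspace_def)
  qed
  then show ?thesis by (auto simp: vspace_def at_pair_def)
qed

lemma R_at_vspace:
  assumes p: "Suc p < s" and R: "\<And>b. b \<in> {1..n} \<times> {1..n} \<Longrightarrow> R b \<in> vspace ({1..n} \<times> {1..n})"
    and y: "y \<in> vspace (words n s)"
  shows "R_at n s (Suc p) R y \<in> vspace (words n s)"
  unfolding vspace_def
proof (intro CollectI allI impI)
  fix w assume w: "w \<notin> words n s"
  show "R_at n s (Suc p) R y w = 0"
  proof (cases "length w = s")
    case False
    then show ?thesis by (simp add: R_at_def lin_def)
  next
    case True
    then have "\<not> set w \<subseteq> {1..n}" using w by (simp add: words_def)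
    then obtain x where "x \<in> set w" "x \<notin> {1..n}" by blast
    then obtain r where r: "r < s" "w ! r \<notin> {1..n}"
      using True by (metis in_set_conv_nth)
    show ?thesis
    proof (cases "r = p \<or> r = Suc p")
      case True
      then have "R b (w ! p, w ! Suc p) = 0" if "b \<in> {1..n} \<times> {1..n}" for b
        using R[OF that] r by (auto simp: vspace_def)
      then show ?thesis
        unfolding R_at_eq[OF p \<open>length w = s\<close> y] lin_def by (intro sum.neutral) auto
    next
      case False
      have "y (w[p := a, Suc p := b]) = 0" for a b
      proof -
        have "w[p := a, Suc p := b] ! r \<notin> {1..n}" using False r by simp
        then have "w[p := a, Suc p := b] \<notin> words n s"
          using r(1) words_nth by blast
        then show ?thesis using y by (simp add: vspace_def)
      qed
      then show ?thesis
        unfolding R_at_eq[OF p \<open>length w = s\<close> y] lin_def at_pair_def by (intro sum.neutral) auto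
    qed
  qed
qed

lemma R_at_injective:
  assumes p: "Suc p < s" and R: "swaps_sites n S T R" and y: "y \<in> vspace (words n s)"
    and 0: "R_at n s (Suc p) R y = (\<lambda>_. 0)"
  shows "y = (\<lambda>_. 0)"
proof
  fix w
  show "y w = 0"
  proof (cases "w \<in> words n s")
    case True
    then have w: "length w = s" by (simp add: words_def)
    have R': "R b \<in> vspace ({1..n} \<times> {1..n})" if "b \<in> {1..n} \<times> {1..n}" for b
      using R that unfolding swaps_sites_def by blast
    have "lin ({1..n} \<times> {1..n}) R (at_pair y w p) (c, d) = 0" for c d
    proof -
      let ?u = "w[p := c, Suc p := d]"
      have "at_pair y ?u p = at_pair y w p"
        unfolding at_pair_def by (intro ext) (auto simp: list_update_swap list_update_overwrite split: prod.splits)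
      moreover have "?u ! p = c" "?u ! Suc p = d" using p w by simp_all
      ultimately show ?thesis
        using R_at_eq[OF p _ y, of ?u R] fun_cong[OF 0, of ?u] w by simp
    qed
    then have "lin ({1..n} \<times> {1..n}) R (at_pair y w p) = (\<lambda>_. 0)" by auto
    moreover have "at_pair y w p \<in> vspace ({1..n} \<times> {1..n})"
      using at_pair_vspace[of p w y n] p w y by simp
    ultimately have "at_pair y w p = (\<lambda>_. 0)" using R unfolding swaps_sites_def by blast
    from fun_cong[OF this, of "(w ! p, w ! Suc p)"] show ?thesis by (simp add: at_pair_def)
  qed (use y in \<open>simp add: vspace_def\<close>)
qed

lemma sum_split_pair:
  assumes "Suc p < s"
  shows "(\<Sum>r<s. f r) = (\<Sum>r\<in>{..<s} - {p, Suc p}. f r) + (f p + f (Suc p) :: 'a::comm_monoid_add)"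
proof -
  have "(\<Sum>r<s. f r) = f p + (\<Sum>r\<in>{..<s} - {p}. f r)"
    using assms by (intro sum.remove) auto
  also have "(\<Sum>r\<in>{..<s} - {p}. f r) = f (Suc p) + (\<Sum>r\<in>{..<s} - {p} - {Suc p}. f r)"
    using assms by (intro sum.remove) auto
  also have "{..<s} - {p} - {Suc p} = {..<s} - {p, Suc p}" by auto
  finally show ?thesis by (simp add: add_ac)
qed

text \<open>The iterated coproduct is sorted by the position of B. To the right of the pair, R sees
  the identity; to the left, it sees the inverse of K on both factors; the two terms inside the pair
  together form the coproduct of B. The last two cases are the two relations in
  \<open>swaps_sites\<close>.\<close>

lemma R_at_sites_op:
  assumes p: "Suc p < s" and R: "swaps_sites n (S p) (S (Suc p)) R" and i: "i \<in> {1..n}"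
    and y: "y \<in> vspace (words n s)"
  shows "R_at n s (Suc p) R (sites_op n i S y) = sites_op n i (S(p := S (Suc p), Suc p := S p)) (R_at n s (Suc p) R y)"
    (is "_ = sites_op n i ?S _")
proof
  fix w :: "nat list"
  let ?L = "{1..n} \<times> {1..n}"
  let ?q = "(w ! p, w ! Suc p)"
  let ?R = "R_at n s (Suc p) R"
  define sw where "sw = node_letter n i"
  have sw: "sw c \<in> {1..n} \<longleftrightarrow> c \<in> {1..n}" for c
    unfolding sw_def by (rule letter_swap_in[OF i nxt_in[OF i]])
  have Rv: "R b \<in> vspace ?L" if "b \<in> ?L" for b
    using R that unfolding swaps_sites_def by blast
  have sv: "sites_op n i S y \<in> vspace (words n s)"
    unfolding sites_op_def by (rule word_op_vspace[OF sw[unfolded sw_def] y])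
  have Ry: "?R y \<in> vspace (words n s)" by (rule R_at_vspace[OF p Rv y])
  have sRv: "sites_op n i ?S (?R y) \<in> vspace (words n s)"
    unfolding sites_op_def by (rule word_op_vspace[OF sw[unfolded sw_def] Ry])
  show "?R (sites_op n i S y) w = sites_op n i ?S (?R y) w"
  proof (cases "w \<in> words n s")
    case False
    then show ?thesis using R_at_vspace[OF p Rv sv] sRv by (simp add: vspace_def)
  next
    case True
    then have w: "length w = s" by (simp add: words_def)
    have q: "?q \<in> ?L" using words_nth[OF True] p by (simp del: atLeastAtMost_iff)
    define \<beta> where "\<beta> r = site_coeff n i (S r)" for r
    define \<kappa> where "\<kappa> r = site_Kinv n i (S r)" for r
    define h where "h a b = w[p := a, Suc p := b]" for a b
    define tm where "tm z u r = (\<Prod>l\<in>{r<..<s}. \<kappa> l (u ! l)) * \<beta> r (u ! r) * z (u[r := sw (u ! r)])"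
      for z :: "nat list vec" and u r
    define tm' where "tm' z u r = (\<Prod>l\<in>{r<..<s}. site_Kinv n i (?S l) (u ! l)) * site_coeff n i (?S r) (u ! r) * z (u[r := sw (u ! r)])"
      for z :: "nat list vec" and u r
    have T1: "lin ?L R (pair_op n i (S p) (S (Suc p)) z) ?q = pair_op n i (S (Suc p)) (S p) (lin ?L R z) ?q"
      and T2: "lin ?L R (pair_Kinv n i (S p) (S (Suc p)) z) ?q = pair_Kinv n i (S (Suc p)) (S p) (lin ?L R z) ?q" for z
      using R i q unfolding swaps_sites_def by blast+
    have smul: "lin ?L R (\<lambda>b. c * z b) ?q = c * lin ?L R z ?q" for c z
      by (simp add: lin_def sum_distrib_left mult.assoc)
    have off: "lin ?L R (\<lambda>(a, b). tm y (h a b) r) ?q = tm' (?R y) w r"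
      if r: "r < s" "r \<noteq> p" "r \<noteq> Suc p" for r
    proof -
      define x where "x = sw (w ! r)"
      define Y where "Y = at_pair y (w[r := x]) p"
      have hr: "h a b ! r = w ! r" for a b using r by (simp add: h_def)
      have upd: "(h a b)[r := x] = w[r := x, p := a, Suc p := b]" for a b
        using r by (simp add: h_def list_update_swap)
      have RY: "?R y (w[r := x]) = lin ?L R Y ?q"
        using R_at_eq[OF p _ y, of "w[r := x]" R] w r by (simp add: Y_def)
      show ?thesis
      proof (cases "r < p")
        case False
        then have rp: "r > Suc p" using r by simp
        define C where "C = (\<Prod>l\<in>{r<..<s}. \<kappa> l (w ! l)) * \<beta> r (w ! r)"
        have "(\<Prod>l\<in>{r<..<s}. \<kappa> l (h a b ! l)) = (\<Prod>l\<in>{r<..<s}. \<kappa> l (w ! l))" for a b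
          using rp by (intro prod.cong) (auto simp: h_def)
        then have "(\<lambda>(a, b). tm y (h a b) r) = (\<lambda>b. C * Y b)"
          unfolding tm_def hr x_def[symmetric] upd by (auto simp: C_def Y_def at_pair_def)
        moreover have "(\<Prod>l\<in>{r<..<s}. site_Kinv n i (?S l) (w ! l)) = (\<Prod>l\<in>{r<..<s}. \<kappa> l (w ! l))"
          using rp by (intro prod.cong) (auto simp: \<kappa>_def)
        then have "tm' (?R y) w r = C * ?R y (w[r := x])"
          unfolding tm'_def x_def[symmetric] using rp by (simp add: C_def \<beta>_def)
        ultimately show ?thesis unfolding RY using smul by simp
      next
        case True
        have split: "(\<Prod>l\<in>{r<..<s}. f l) = (\<Prod>l\<in>{r<..<s} - {p, Suc p}. f l) * (f p * f (Suc p))" for f :: "nat \<Rightarrow> Cqx"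
        proof -
          have "(\<Prod>l\<in>{r<..<s}. f l) = f p * (\<Prod>l\<in>{r<..<s} - {p}. f l)"
            using True p by (intro prod.remove) auto
          also have "(\<Prod>l\<in>{r<..<s} - {p}. f l) = f (Suc p) * (\<Prod>l\<in>{r<..<s} - {p} - {Suc p}. f l)"
            using True p by (intro prod.remove) auto
          also have "{r<..<s} - {p} - {Suc p} = {r<..<s} - {p, Suc p}" by auto
          finally show ?thesis by (simp add: mult_ac)
        qed
        define C where "C = (\<Prod>l\<in>{r<..<s} - {p, Suc p}. \<kappa> l (w ! l)) * \<beta> r (w ! r)"
        have P: "(\<Prod>l\<in>{r<..<s}. \<kappa> l (h a b ! l)) = (\<Prod>l\<in>{r<..<s} - {p, Suc p}. \<kappa> l (w ! l)) * (\<kappa> p a * \<kappa> (Suc p) b)" for a b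
        proof -
          have "(\<Prod>l\<in>{r<..<s} - {p, Suc p}. \<kappa> l (h a b ! l)) = (\<Prod>l\<in>{r<..<s} - {p, Suc p}. \<kappa> l (w ! l))"
            by (intro prod.cong) (auto simp: h_def)
          moreover have "h a b ! p = a" "h a b ! Suc p = b" using p w by (simp_all add: h_def)
          ultimately show ?thesis unfolding split by simp
        qed
        have "(\<lambda>(a, b). tm y (h a b) r) = (\<lambda>b. C * pair_Kinv n i (S p) (S (Suc p)) Y b)"
          unfolding tm_def hr x_def[symmetric] upd P
          by (auto simp: C_def Y_def at_pair_def pair_Kinv_def \<kappa>_def mult_ac)
        moreover have "tm' (?R y) w r = C * pair_Kinv n i (S (Suc p)) (S p) (lin ?L R Y) ?q"
        proof -
          have "(\<Prod>l\<in>{r<..<s} - {p, Suc p}. site_Kinv n i (?S l) (w ! l)) = (\<Prod>l\<in>{r<..<s} - {p, Suc p}. \<kappa> l (w ! l))"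
            by (intro prod.cong) (auto simp: \<kappa>_def)
          then show ?thesis
            unfolding tm'_def x_def[symmetric] split RY using r
            by (simp add: C_def \<beta>_def pair_Kinv_def mult_ac)
        qed
        ultimately show ?thesis using smul T2 by simp
      qed
    qed
    define Y where "Y = at_pair y w p"
    define C where "C = (\<Prod>l\<in>{Suc p<..<s}. \<kappa> l (w ! l))"
    have ins: "{p<..<s} = insert (Suc p) {Suc p<..<s}" using p by auto
    have on: "lin ?L R (\<lambda>(a, b). tm y (h a b) p + tm y (h a b) (Suc p)) ?q
       = tm' (?R y) w p + tm' (?R y) w (Suc p)"
    proof -
      have h: "h a b ! p = a" "h a b ! Suc p = b" for a b using p w by (simp_all add: h_def)
      have P: "(\<Prod>l\<in>{Suc p<..<s}. \<kappa> l (h a b ! l)) = C" for a b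
        unfolding C_def by (intro prod.cong) (auto simp: h_def)
      have upd: "(h a b)[p := x] = w[p := x, Suc p := b]" "(h a b)[Suc p := x] = w[p := a, Suc p := x]" for a b x
        by (simp_all add: h_def list_update_swap)
      have "tm y (h a b) p = C * (\<kappa> (Suc p) b * \<beta> p a * y (w[p := sw a, Suc p := b]))" for a b
        unfolding tm_def ins by (simp add: h P upd mult_ac)
      moreover have "tm y (h a b) (Suc p) = C * (\<beta> (Suc p) b * y (w[p := a, Suc p := sw b]))" for a b
        unfolding tm_def by (simp add: h P upd mult_ac)
      ultimately have pair: "(\<lambda>(a, b). tm y (h a b) p + tm y (h a b) (Suc p)) = (\<lambda>b. C * pair_op n i (S p) (S (Suc p)) Y b)"
        by (auto simp: Y_def at_pair_def pair_op_def \<kappa>_def \<beta>_def sw_def distrib_left)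
      have "?R y (w[p := x]) = lin ?L R Y (x, w ! Suc p)" for x
      proof -
        have "at_pair y (w[p := x]) p = Y" by (simp add: at_pair_def Y_def)
        then show ?thesis using R_at_eq[OF p _ y, of "w[p := x]" R] w p by simp
      qed
      moreover have "?R y (w[Suc p := x]) = lin ?L R Y (w ! p, x)" for x
      proof -
        have "at_pair y (w[Suc p := x]) p = Y" by (simp add: at_pair_def Y_def list_update_swap)
        then show ?thesis using R_at_eq[OF p _ y, of "w[Suc p := x]" R] w p by simp
      qed
      ultimately have "tm' (?R y) w p + tm' (?R y) w (Suc p) = C * pair_op n i (S (Suc p)) (S p) (lin ?L R Y) ?q"
        unfolding tm'_def ins by (simp add: C_def \<kappa>_def pair_op_def sw_def distrib_left mult_ac)
      then show ?thesis unfolding pair smul T1 by (rule sym)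
    qed
    have s_op: "at_pair (sites_op n i S y) w p = (\<lambda>(a, b). (\<Sum>r\<in>{..<s} - {p, Suc p}. tm y (h a b) r)
        + (tm y (h a b) p + tm y (h a b) (Suc p)))"
    proof -
      have "sites_op n i S y (h a b) = (\<Sum>r<s. tm y (h a b) r)" for a b
        unfolding sites_op_def word_op_def tm_def \<beta>_def \<kappa>_def sw_def by (simp add: h_def w)
      then show ?thesis unfolding at_pair_def h_def[symmetric] sum_split_pair[OF p] by simp
    qed
    have "?R (sites_op n i S y) w = lin ?L R (at_pair (sites_op n i S y) w p) ?q"
      by (rule R_at_eq[OF p w sv])
    also have "\<dots> = (\<Sum>r\<in>{..<s} - {p, Suc p}. lin ?L R (\<lambda>(a, b). tm y (h a b) r) ?q)
        + lin ?L R (\<lambda>(a, b). tm y (h a b) p + tm y (h a b) (Suc p)) ?q"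
    proof -
      have "lin ?L R (\<lambda>(a, b). \<Sum>r\<in>{..<s} - {p, Suc p}. tm y (h a b) r) ?q
        = (\<Sum>r\<in>{..<s} - {p, Suc p}. lin ?L R (\<lambda>(a, b). tm y (h a b) r) ?q)"
        unfolding lin_def by (subst sum.swap) (auto simp: sum_distrib_right intro!: sum.cong)
      moreover have "lin ?L R (\<lambda>(a, b). f a b + g a b) ?q = lin ?L R (\<lambda>(a, b). f a b) ?q + lin ?L R (\<lambda>(a, b). g a b) ?q"
        for f g :: "nat \<Rightarrow> nat \<Rightarrow> Cqx"
        unfolding lin_def by (auto simp: sum.distrib[symmetric] distrib_right intro!: sum.cong)
      ultimately show ?thesis unfolding s_op by (simp only:)
    qed
    also have "\<dots> = (\<Sum>r\<in>{..<s} - {p, Suc p}. tm' (?R y) w r) + (tm' (?R y) w p + tm' (?R y) w (Suc p))"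
      unfolding on using off by simp
    also have "\<dots> = (\<Sum>r<s. tm' (?R y) w r)" unfolding sum_split_pair[OF p] ..
    also have "\<dots> = sites_op n i ?S (?R y) w"
      unfolding sites_op_def word_op_def tm'_def sw_def w ..
    finally show ?thesis .
  qed
qed

text \<open>Injectivity is carried along because it guarantees that the resulting K-matrix has a
  nonzero entry, as needed for normalising its limit.\<close>

definition site_map :: "nat \<Rightarrow> nat \<Rightarrow> (nat \<Rightarrow> bool \<times> Cqx) \<Rightarrow> (nat \<Rightarrow> bool \<times> Cqx) \<Rightarrow>
    (nat list vec \<Rightarrow> nat list vec) \<Rightarrow> bool" where
  "site_map n s S T f \<longleftrightarrow> lin_op f \<and> (\<forall>y\<in>vspace (words n s). f y \<in> vspace (words n s) \<and>
     (f y = (\<lambda>_. 0) \<longrightarrow> y = (\<lambda>_. 0)) \<and> (\<forall>i\<in>{1..n}. f (sites_op n i S y) = sites_op n i T (f y)))"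

lemma site_mapI:
  assumes "lin_op f" "\<And>y. y \<in> vspace (words n s) \<Longrightarrow> f y \<in> vspace (words n s)"
    "\<And>y. y \<in> vspace (words n s) \<Longrightarrow> f y = (\<lambda>_. 0) \<Longrightarrow> y = (\<lambda>_. 0)"
    "\<And>y i. y \<in> vspace (words n s) \<Longrightarrow> i \<in> {1..n} \<Longrightarrow> f (sites_op n i S y) = sites_op n i T (f y)"
  shows "site_map n s S T f"
  unfolding site_map_def using assms by blast

lemma site_map_id: "site_map n s S S id"
  by (simp add: site_map_def lin_op_def)

lemma lin_op_comp:
  assumes f: "lin_op f" and g: "lin_op g"
  shows "lin_op (g \<circ> f)"
proof -
  have "g (f (\<lambda>x. v x + w x)) = (\<lambda>y. g (f v) y + g (f w) y)" for v w
    by (simp only: lin_op_add[OF f, of v w] lin_op_add[OF g, of "f v" "f w"])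
  moreover have "g (f (\<lambda>x. a * v x)) = (\<lambda>y. a * g (f v) y)" for a v
    by (simp only: lin_op_smult[OF f, of a v] lin_op_smult[OF g, of a "f v"])
  ultimately show ?thesis unfolding lin_op_def o_def by blast
qed

lemma site_map_comp:
  assumes f: "site_map n s S T f" and g: "site_map n s T U g"
  shows "site_map n s S U (g \<circ> f)"
proof -
  have "lin_op f" "lin_op g" using f g unfolding site_map_def by blast+
  then have "lin_op (g \<circ> f)" by (rule lin_op_comp)
  moreover have "g (f y) \<in> vspace (words n s) \<and> (g (f y) = (\<lambda>_. 0) \<longrightarrow> y = (\<lambda>_. 0)) \<and>
      (\<forall>i\<in>{1..n}. g (f (sites_op n i S y)) = sites_op n i U (g (f y)))" if y: "y \<in> vspace (words n s)" for y
  proof -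
    have "f y \<in> vspace (words n s)" "f y = (\<lambda>_. 0) \<Longrightarrow> y = (\<lambda>_. 0)"
      "\<And>i. i \<in> {1..n} \<Longrightarrow> f (sites_op n i S y) = sites_op n i T (f y)"
      using f y unfolding site_map_def by blast+
    then show ?thesis using g unfolding site_map_def by fastforce
  qed
  ultimately show ?thesis unfolding site_map_def o_def by blast
qed

lemma site_map_R_at:
  assumes p: "Suc p < s" and R: "swaps_sites n (S p) (S (Suc p)) R"
  shows "site_map n s S (S(p := S (Suc p), Suc p := S p)) (R_at n s (Suc p) R)"
proof -
  have Rv: "R b \<in> vspace ({1..n} \<times> {1..n})" if "b \<in> {1..n} \<times> {1..n}" for b
    using R that unfolding swaps_sites_def by blast
  show ?thesis
  proof (rule site_mapI)
    show "lin_op (R_at n s (Suc p) R)" unfolding R_at_def by (rule lin_op_lin)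
  next
    fix y assume y: "y \<in> vspace (words n s)"
    show "R_at n s (Suc p) R y \<in> vspace (words n s)" by (rule R_at_vspace[OF p Rv y])
    show "y = (\<lambda>_. 0)" if "R_at n s (Suc p) R y = (\<lambda>_. 0)"
      by (rule R_at_injective[OF p R y that])
    show "R_at n s (Suc p) R (sites_op n i S y)
        = sites_op n i (S(p := S (Suc p), Suc p := S p)) (R_at n s (Suc p) R y)" if "i \<in> {1..n}" for i
      by (rule R_at_sites_op[OF p R that y])
  qed
qed

lemma K_first_id:
  assumes s: "1 \<le> s" and K: "\<forall>j\<in>{1..n}. K j = bvec j" and y: "y \<in> vspace (words n s)"
  shows "K_first n s K y = y"
proof
  fix w
  have "K_first n s K y w = (\<Sum>u\<in>words n s. if w = u then y u else 0)"
    unfolding K_first_def lin_def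
  proof (intro sum.cong refl)
    fix u assume u: "u \<in> words n s"
    then have "K (u ! 0) = bvec (u ! 0)" using K words_nth[OF u, of 0] s by simp
    moreover have "w = u \<longleftrightarrow> length w = s \<and> (\<forall>p<s. p \<noteq> 0 \<longrightarrow> w ! p = u ! p) \<and> w ! 0 = u ! 0"
    proof
      assume "length w = s \<and> (\<forall>p<s. p \<noteq> 0 \<longrightarrow> w ! p = u ! p) \<and> w ! 0 = u ! 0"
      then show "w = u" using words_length[OF u] by (intro nth_equalityI) metis+
    qed (use words_length[OF u] in auto)
    ultimately show "y u * (if length w = s \<and> (\<forall>p<s. p \<noteq> 0 \<longrightarrow> w ! p = u ! p) then K (u ! 0) (w ! 0) else 0)
       = (if w = u then y u else 0)"
      by (auto simp: bvec_def)
  qed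
  then show "K_first n s K y w = y w"
    using y finite_words by (auto simp: vspace_def)
qed

text \<open>In coordinates the map is the identity and only the flag of the first site changes.
  \<open>sites_op\<close> does not see this flag: the coefficients of B are the same for both flags,
  and no inverse of K ever acts on the first factor.\<close>

lemma site_map_K_first:
  assumes s: "1 \<le> s" and K: "\<forall>j\<in>{1..n}. K j = bvec j" and S: "S 0 = (False, z)"
  shows "site_map n s S (S(0 := (True, z))) (K_first n s K)"
proof -
  have op: "sites_op n i (S(0 := (True, z))) = sites_op n i S" for i
    unfolding sites_op_def
    by (intro ext fun_cong[OF word_op_cong]) (auto simp: site_coeff_def S)
  have v: "sites_op n i S y \<in> vspace (words n s)" if "i \<in> {1..n}" "y \<in> vspace (words n s)" for i y
    unfolding sites_op_def
    by (rule word_op_vspace[OF letter_swap_in[OF that(1) nxt_in[OF that(1)]] that(2)])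
  have "lin_op (K_first n s K)" unfolding K_first_def by (rule lin_op_lin)
  then show ?thesis
    unfolding site_map_def op using K_first_id[OF s K] v by simp
qed

text \<open>The state inside stage j: factor j has travelled to place i, counted from 1, through the
  already dualised factors j - 1, ..., 1, which keep their relative order.\<close>

definition mid_sites :: "nat \<Rightarrow> nat \<Rightarrow> nat \<Rightarrow> nat \<Rightarrow> bool \<times> Cqx" where
  "mid_sites s j i p = (if Suc p < i then (True, v_par s (j - 1 - p)) else if Suc p = i then (False, v_par s j)
     else if p < j then (True, v_par s (j - p)) else (False, v_par s (Suc p)))"

text \<open>Each stage puts the newly dualised factor in front, so the duals appear in reverse
  order.\<close>

definition stage_sites :: "nat \<Rightarrow> nat \<Rightarrow> nat \<Rightarrow> bool \<times> Cqx" where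
  "stage_sites s j p = (if p < j then (True, v_par s (j - p)) else (False, v_par s (Suc p)))"

lemma site_map_K_stage:
  assumes j: "j \<in> {1..s}" and K: "\<forall>l\<in>{1..n}. K (v_par s j) l = bvec l"
    and R: "\<And>i. i \<in> {1..<j} \<Longrightarrow>
      swaps_sites n (True, v_par s (j - i)) (False, v_par s j) (R (u_par s j i) (v_par s j))"
  shows "site_map n s (stage_sites s (j - 1)) (stage_sites s j) (K_stage n s R K j)"
proof -
  let ?F = "\<lambda>i f. R_at n s i (R (u_par s j i) (v_par s j)) \<circ> f"
  \<comment> \<open>Downward induction on m, because the composite of the R-matrices applies its
    rightmost factor, at the places j - 1 and j, first.\<close>
  have fold: "site_map n s (mid_sites s j j) (mid_sites s j m) (foldr ?F [m..<j] id)" if "1 \<le> m" "m \<le> j" for m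
    using that(2,1)
  proof (induction m rule: inc_induct)
    case base
    show ?case using site_map_id by (simp add: id_def)
  next
    case (step m)
    obtain p where m: "m = Suc p" using step.prems by (cases m) auto
    let ?S = "mid_sites s j (Suc m)"
    have Sp: "?S p = (True, v_par s (j - m))" "?S m = (False, v_par s j)"
      using step.hyps m by (auto simp: mid_sites_def)
    have "mid_sites s j m = ?S(p := ?S (Suc p), Suc p := ?S p)"
    proof
      fix r
      show "mid_sites s j m r = (?S(p := ?S (Suc p), Suc p := ?S p)) r"
        using step.hyps m Sp by (cases "r = p"; cases "r = m") (auto simp: mid_sites_def)
    qed
    moreover have "swaps_sites n (?S p) (?S (Suc p)) (R (u_par s j m) (v_par s j))"
      using R[of m] step.hyps step.prems Sp m by simp
    ultimately have "site_map n s ?S (mid_sites s j m) (R_at n s m (R (u_par s j m) (v_par s j)))"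
      using site_map_R_at[of p s n ?S "R (u_par s j m) (v_par s j)"] j step.hyps m by simp
    moreover have "site_map n s (mid_sites s j j) ?S (foldr ?F [Suc m..<j] id)"
      by (rule step.IH) simp
    moreover have "foldr ?F [m..<j] id = R_at n s m (R (u_par s j m) (v_par s j)) \<circ> foldr ?F [Suc m..<j] id"
      using step.hyps by (simp only: upt_conv_Cons foldr.simps o_apply)
    ultimately show ?case by (simp only: site_map_comp)
  qed
  have j1: "1 \<le> j" and s1: "1 \<le> s" using j by auto
  have "stage_sites s (j - 1) = mid_sites s j j"
    using j1 by (auto simp: fun_eq_iff stage_sites_def mid_sites_def)
  moreover have "stage_sites s j = (mid_sites s j 1)(0 := (True, v_par s j))"
    using j1 by (auto simp: fun_eq_iff stage_sites_def mid_sites_def)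
  moreover have "mid_sites s j 1 0 = (False, v_par s j)" by (simp add: mid_sites_def)
  ultimately show ?thesis
    unfolding K_stage_def
    using site_map_comp[OF fold[OF order_refl j1] site_map_K_first[OF s1 K]] by simp
qed

lemma site_map_K_total:
  assumes K: "\<And>j. j \<in> {1..s} \<Longrightarrow> \<forall>l\<in>{1..n}. K (v_par s j) l = bvec l"
    and R: "\<And>i j. j \<in> {1..s} \<Longrightarrow> i \<in> {1..<j} \<Longrightarrow>
      swaps_sites n (True, v_par s (j - i)) (False, v_par s j) (R (u_par s j i) (v_par s j))"
  shows "site_map n s (stage_sites s 0) (stage_sites s s) (K_total n s R K)"
proof -
  have "site_map n s (stage_sites s 0) (stage_sites s m)
     (fold (\<lambda>j f. K_stage n s R K j \<circ> f) [1..<m + 1] id)" if "m \<le> s" for m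
    using that
  proof (induction m)
    case 0
    show ?case using site_map_id by (simp add: id_def)
  next
    case (Suc m)
    have "site_map n s (stage_sites s m) (stage_sites s (Suc m)) (K_stage n s R K (Suc m))"
      using site_map_K_stage[of "Suc m" s n K R] K R Suc.prems by simp
    moreover have "site_map n s (stage_sites s 0) (stage_sites s m)
       (fold (\<lambda>j f. K_stage n s R K j \<circ> f) [1..<m + 1] id)"
      by (rule Suc.IH) (use Suc.prems in simp)
    moreover have "[1..<Suc m + 1] = [1..<m + 1] @ [Suc m]" by simp
    then have "fold (\<lambda>j f. K_stage n s R K j \<circ> f) [1..<Suc m + 1] id
       = K_stage n s R K (Suc m) \<circ> fold (\<lambda>j f. K_stage n s R K j \<circ> f) [1..<m + 1] id"
      by (simp only: fold_append fold_simps o_apply)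
    ultimately show ?case by (simp only: site_map_comp)
  qed
  then show ?thesis by (simp add: K_total_def)
qed

section \<open>The tensor products before and after all stages\<close>

lemma word_op_cong_at:
  assumes "y \<in> vspace (words n s)" "\<And>c. sw c \<in> {1..n} \<longleftrightarrow> c \<in> {1..n}"
    "\<And>p c. p < s \<Longrightarrow> \<beta> p c = \<beta>' p c" "\<And>p c. p < s \<Longrightarrow> \<kappa> p c = \<kappa>' p c"
  shows "word_op sw \<beta> \<kappa> y = word_op sw \<beta>' \<kappa>' y"
proof
  fix w
  show "word_op sw \<beta> \<kappa> y w = word_op sw \<beta>' \<kappa>' y w"
  proof (cases "w \<in> words n s")
    case True
    then have "length w = s" by (rule words_length)
    then show ?thesis
      unfolding word_op_def using assms(3,4)
      by (intro sum.cong arg_cong2[where f = times] prod.cong refl) auto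
  next
    case False
    then show ?thesis
      using word_op_vspace[OF assms(2,1), of \<beta> \<kappa>] word_op_vspace[OF assms(2,1), of \<beta>' \<kappa>'] by (simp add: vspace_def)
  qed
qed

definition is_affine :: "nat \<Rightarrow> nat \<Rightarrow> nat" where
  "is_affine n i = (if i = n then 1 else 0)"

lemma node_order_id:
  assumes "2 \<le> n" "i \<in> {1..n}"
  shows "node_order (\<lambda>c. c) n i (nxt n i) (is_affine n i)"
  using assms by (auto simp: node_order_def nxt_def is_affine_def)

lemma node_order_rev:
  assumes "2 \<le> n" "i \<in> {1..n}"
  shows "node_order (\<lambda>c. n - c) n (nxt n i) i (is_affine n i)"
  using assms by (auto simp: node_order_def nxt_def is_affine_def inj_on_def)

lemma letter_swap_commute: "letter_swap j' j = letter_swap j j'"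
  by (auto simp: letter_swap_def)

lemma letter_B_commute: "j \<noteq> j' \<Longrightarrow> letter_B j' j (inverse g) = letter_B j j' g"
  by (auto simp: letter_B_def)

lemma spec_nonzero: "z \<noteq> 0 \<Longrightarrow> spec n z i \<noteq> 0"
  by (simp add: spec_def)

lemma spec_inverse: "spec n (inverse z) i = inverse (spec n z i)"
  by (simp add: spec_def)

lemma spec_v_par: "spec n (v_par s j) i = qv powi (int (is_affine n i) * (2 * int j - int s - 1)) * spec n xv i"
  by (simp add: spec_def v_par_def is_affine_def)

lemma v_par_nonzero [simp]: "v_par s j \<noteq> 0"
  by (simp add: v_par_def)

lemma sites_op_first:
  assumes n: "2 \<le> n" and i: "i \<in> {1..n}"
  shows "sites_op n i (stage_sites s 0) (sym_embed (\<lambda>c. c) n s v)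
    = sym_embed (\<lambda>c. c) n s (node_op i (nxt n i) (spec n xv i) v)"
proof -
  have "sites_op n i (stage_sites s 0) (sym_embed (\<lambda>c. c) n s v)
    = word_op (node_letter n i) (site_B i (nxt n i) (is_affine n i) s (spec n xv i)) (\<lambda>_. letter_Kinv i (nxt n i)) (sym_embed (\<lambda>c. c) n s v)"
    unfolding sites_op_def
  proof (rule word_op_cong_at[OF sym_embed_vspace letter_swap_in[OF i nxt_in[OF i]]])
    fix p c
    have e: "2 * int (Suc p) - int s - 1 = 2 * int p + 1 - int s" by simp
    show "site_coeff n i (stage_sites s 0 p) c = site_B i (nxt n i) (is_affine n i) s (spec n xv i) p c"
      by (simp only: site_coeff_def stage_sites_def site_B_def snd_conv spec_v_par not_less_zero if_False e)
    show "site_Kinv n i (stage_sites s 0 p) c = letter_Kinv i (nxt n i) c"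
      by (simp add: site_Kinv_def stage_sites_def)
  qed
  then show ?thesis
    using sym_embed_node_op[OF node_order_id[OF n i] spec_nonzero[OF xv_nonzero]] by simp
qed

text \<open>At position p, counted from 0, sits the dual of factor s - p, whose parameter is the
  inverse of q^(s-2p-1) x, that is q^(2p+1-s) x^-1. The reversal of the factors thus produces
  exactly the parameters of the embedding of the dual KR module at x^-1.\<close>

lemma sites_op_last:
  assumes n: "2 \<le> n" and i: "i \<in> {1..n}" and y: "y \<in> vspace (words n s)"
  shows "sites_op n i (stage_sites s s) y
    = word_op (letter_swap (nxt n i) i) (site_B (nxt n i) i (is_affine n i) s (inverse (spec n xv i)))
        (\<lambda>_. letter_Kinv (nxt n i) i) y"
  unfolding sites_op_def letter_swap_commute[of "nxt n i"]
proof (rule word_op_cong_at[OF y letter_swap_in[OF i nxt_in[OF i]]])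
  fix p c assume p: "p < s"
  have nn: "i \<noteq> nxt n i" using n nxt_neq by metis
  have e: "2 * int (s - p) - int s - 1 = - (2 * int p + 1 - int s)" using p by simp
  have "qv powi (int (is_affine n i) * - (2 * int p + 1 - int s)) =
     inverse (qv powi (int (is_affine n i) * (2 * int p + 1 - int s)))"
    by (simp only: mult_minus_right power_int_minus)
  then have "spec n (v_par s (s - p)) i = inverse (qv powi (int (is_affine n i) * (2 * int p + 1 - int s)) * inverse (spec n xv i))"
    unfolding spec_v_par e by simp
  then show "site_coeff n i (stage_sites s s p) c = site_B (nxt n i) i (is_affine n i) s (inverse (spec n xv i)) p c"
    using p letter_B_commute[OF nn[symmetric], of "qv powi (int (is_affine n i) * (2 * int p + 1 - int s)) * inverse (spec n xv i)"]
    by (simp add: site_coeff_def stage_sites_def site_B_def)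
  show "site_Kinv n i (stage_sites s s p) c = letter_Kinv (nxt n i) i c"
    using p by (simp add: site_Kinv_def stage_sites_def)
qed

lemma sites_op_last_embed:
  assumes n: "2 \<le> n" and i: "i \<in> {1..n}"
  shows "sites_op n i (stage_sites s s) (sym_embed (\<lambda>c. n - c) n s v)
    = sym_embed (\<lambda>c. n - c) n s (node_op (nxt n i) i (inverse (spec n xv i)) v)"
  unfolding sites_op_last[OF n i sym_embed_vspace]
  using sym_embed_node_op[OF node_order_rev[OF n i]] spec_nonzero[OF xv_nonzero] by simp

section \<open>The action on two tensor factors\<close>

text \<open>The common shape of the two modules: \<open>W\<close> has j = i and j' = i + 1, and
  \<open>Wd\<close> has the two letters exchanged.\<close>

definition acts_simply :: "nat \<Rightarrow> (chev \<Rightarrow> nat \<Rightarrow> nat vec) \<Rightarrow> nat \<Rightarrow> nat \<Rightarrow> nat \<Rightarrow> Cqx \<Rightarrow> bool" where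
  "acts_simply n A i j j' g \<longleftrightarrow> (\<forall>a\<in>{1..n}. \<forall>c.
     A (chE i) a c = (if a = j' \<and> c = j then g else 0) \<and>
     A (chF i) a c = (if a = j \<and> c = j' then inverse g else 0) \<and>
     A (chK i) a c = (if a = c then inverse (letter_Kinv j j' a) else 0) \<and>
     A (chKinv i) a c = (if a = c then letter_Kinv j j' a else 0))"

lemma ee_inject: "ee a = ee b \<longleftrightarrow> a = b"
  by (auto simp: ee_def fun_eq_iff split: if_splits)

lemma vmove_ee:
  assumes "j \<noteq> j'"
  shows "vmove (ee a) j j' (ee c) = (if a = j' \<and> c = j then 1 else 0)"
proof (cases "a = j'")
  case True
  have "(ee j')(j := ee j' j + 1, j' := ee j' j' - 1) = ee j"
    using assms by (auto simp: ee_def fun_eq_iff)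
  then show ?thesis using True by (auto simp: vmove_def bvec_def ee_inject) (simp add: ee_def)
next
  case False
  then show ?thesis by (auto simp: vmove_def ee_def)
qed

lemma qv_powi_wt:
  assumes "2 \<le> n"
  shows "qv powi (- wt n (ee a) i) = letter_Kinv i (nxt n i) a"
    "qv powi (wt n (ee a) i) = inverse (letter_Kinv i (nxt n i) a)"
proof -
  have "nxt n i \<noteq> i" using assms by (rule nxt_neq)
  then show *: "qv powi (- wt n (ee a) i) = letter_Kinv i (nxt n i) a"
    by (auto simp: wt_def ee_def letter_Kinv_def power_int_minus)
  show "qv powi (wt n (ee a) i) = inverse (letter_Kinv i (nxt n i) a)"
    unfolding *[symmetric] by (simp add: power_int_minus)
qed

lemma letter_Kinv_flip: "j \<noteq> j' \<Longrightarrow> letter_Kinv j' j a = inverse (letter_Kinv j j' a)"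
  by (auto simp: letter_Kinv_def)

lemma acts_simply_W:
  assumes n: "2 \<le> n"
  shows "acts_simply n (act (W n z)) i i (nxt n i) (spec n z i)"
  unfolding acts_simply_def
proof (intro ballI allI)
  fix a c
  have nn: "nxt n i \<noteq> i" using n by (rule nxt_neq)
  have q: "x * qint (ee a j + 1) * vmove (ee a) j j' (ee c) = (if a = j' \<and> c = j then x else 0)"
    if "j \<noteq> j'" for x j j'
    unfolding vmove_ee[OF that] using that by (simp add: ee_def)
  have E: "act (W n z) (chE i) a c = (if a = nxt n i \<and> c = i then spec n z i else 0)"
    unfolding W_def by (simp only: umod.select_convs KR_act.simps q[OF nn[symmetric]])
  have F: "act (W n z) (chF i) a c = (if a = i \<and> c = nxt n i then inverse (spec n z i) else 0)"
    unfolding W_def by (simp only: umod.select_convs KR_act.simps q[OF nn])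
  show "act (W n z) (chE i) a c = (if a = nxt n i \<and> c = i then spec n z i else 0) \<and>
     act (W n z) (chF i) a c = (if a = i \<and> c = nxt n i then inverse (spec n z i) else 0) \<and>
     act (W n z) (chK i) a c = (if a = c then inverse (letter_Kinv i (nxt n i) a) else 0) \<and>
     act (W n z) (chKinv i) a c = (if a = c then letter_Kinv i (nxt n i) a else 0)"
    unfolding E F
    by (auto simp: W_def qv_powi_wt[OF n] bvec_def ee_inject)
qed

lemma acts_simply_Wd:
  assumes n: "2 \<le> n"
  shows "acts_simply n (act (Wd n z)) i (nxt n i) i (spec n z i)"
  unfolding acts_simply_def
proof (intro ballI allI)
  fix a c
  have nn: "nxt n i \<noteq> i" using n by (rule nxt_neq)
  have q: "x * qint (ee a j + 1) * vmove (ee a) j j' (ee c) = (if a = j' \<and> c = j then x else 0)"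
    if "j \<noteq> j'" for x j j'
    unfolding vmove_ee[OF that] using that by (simp add: ee_def)
  have E: "act (Wd n z) (chE i) a c = (if a = i \<and> c = nxt n i then spec n z i else 0)"
    unfolding Wd_def by (simp only: umod.select_convs KRd_act.simps q[OF nn])
  have F: "act (Wd n z) (chF i) a c = (if a = nxt n i \<and> c = i then inverse (spec n z i) else 0)"
    unfolding Wd_def by (simp only: umod.select_convs KRd_act.simps q[OF nn[symmetric]])
  show "act (Wd n z) (chE i) a c = (if a = i \<and> c = nxt n i then spec n z i else 0) \<and>
     act (Wd n z) (chF i) a c = (if a = nxt n i \<and> c = i then inverse (spec n z i) else 0) \<and>
     act (Wd n z) (chK i) a c = (if a = c then inverse (letter_Kinv (nxt n i) i a) else 0) \<and>
     act (Wd n z) (chKinv i) a c = (if a = c then letter_Kinv (nxt n i) i a else 0)"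
    unfolding E F letter_Kinv_flip[OF nn[symmetric]]
    by (auto simp: Wd_def qv_powi_wt[OF n] bvec_def ee_inject)
qed

lemma letter_Kinv_nonzero [simp]: "letter_Kinv j j' a \<noteq> 0"
  by (simp add: letter_Kinv_def)

text \<open>Each generator acts on a product basis vector with at most two terms; the first column
  of terms lists the input pairs, the second the coefficients.\<close>

lemma tensor_act_simple:
  assumes A: "acts_simply n A i j j' g" and D: "acts_simply n D i l l' h"
    and ab: "a \<in> {1..n}" "b \<in> {1..n}"
  shows "tensor_act A D (chE i) (a, b) (c, d) =
      (if (a, b) = (j', d) then (if c = j then g else 0) else 0)
      + (if (a, b) = (c, l') then (if d = l then h * inverse (letter_Kinv j j' c) else 0) else 0)"
    and "tensor_act A D (chF i) (a, b) (c, d) =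
      (if (a, b) = (j, d) then (if c = j' then inverse g * letter_Kinv l l' d else 0) else 0)
      + (if (a, b) = (c, l) then (if d = l' then inverse h else 0) else 0)"
    and "tensor_act A D (chK i) (a, b) (c, d) =
      (if (a, b) = (c, d) then inverse (letter_Kinv j j' c * letter_Kinv l l' d) else 0)"
    and "tensor_act A D (chKinv i) (a, b) (c, d) =
      (if (a, b) = (c, d) then letter_Kinv j j' c * letter_Kinv l l' d else 0)"
  using A D ab by (auto simp: acts_simply_def outer_def bvec_def)

lemma lin_two:
  assumes "finite L" and "\<And>p. p \<in> L \<Longrightarrow> M p x = (if p = q then k else 0) + (if p = q' then k' else 0)"
  shows "lin L M y x = (if q \<in> L then y q * k else 0) + (if q' \<in> L then y q' * k' else 0)"
proof -
  have "lin L M y x = (\<Sum>p\<in>L. (if p = q then y q * k else 0) + (if p = q' then y q' * k' else 0))"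
    unfolding lin_def using assms(2) by (intro sum.cong) (auto simp: distrib_left)
  then show ?thesis using assms(1) by (simp add: sum.distrib)
qed

lemma lin_one:
  assumes "finite L" and "\<And>p. p \<in> L \<Longrightarrow> M p x = (if p = q then k else 0)"
  shows "lin L M y x = (if q \<in> L then y q * k else 0)"
proof -
  have "lin L M y x = (\<Sum>p\<in>L. (if p = q then y q * k else 0))"
    unfolding lin_def using assms(2) by (intro sum.cong) auto
  then show ?thesis using assms(1) by simp
qed

lemma lin_lin:
  "finite S \<Longrightarrow> finite T \<Longrightarrow> lin T R (lin S A y) = lin S (\<lambda>b. lin T R (A b)) y"
  unfolding lin_def by (auto simp: sum_distrib_left sum_distrib_right mult.assoc sum.swap[of _ T S])

lemma lin_cong:
  "(\<And>b. b \<in> S \<Longrightarrow> A b = A' b) \<Longrightarrow> (\<And>b. b \<in> S \<Longrightarrow> y b = y' b) \<Longrightarrow> lin S A y = lin S A' y'"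
  by (simp add: lin_def)

lemma U_linear_op:
  assumes "U_linear n M N T" "finite (labels M)" "finite (labels N)" "g \<in> generators n"
  shows "lin (labels M) T (lin (labels M) (act M g) y) = lin (labels N) (act N g) (lin (labels M) T y)"
proof -
  have "lin (labels M) T (lin (labels M) (act M g) y) = lin (labels M) (\<lambda>b. lin (labels M) T (act M g b)) y"
    using assms by (simp add: lin_lin)
  also have "\<dots> = lin (labels M) (\<lambda>b. lin (labels N) (act N g) (T b)) y"
    using assms(1,4) unfolding U_linear_def by (intro lin_cong) auto
  also have "\<dots> = lin (labels N) (act N g) (lin (labels M) T y)"
    using assms by (simp add: lin_lin)
  finally show ?thesis .
qed

lemma lin_tensor_act:
  fixes y :: "(nat \<times> nat) vec"
  assumes A: "acts_simply n A i j j' g" and D: "acts_simply n D i l l' h"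
    and j: "j \<in> {1..n}" "j' \<in> {1..n}" and l: "l \<in> {1..n}" "l' \<in> {1..n}"
    and b: "c \<in> {1..n}" "d \<in> {1..n}"
  defines "L \<equiv> {1..n} \<times> {1..n}"
  shows "lin L (tensor_act A D (chE i)) y (c, d) = (if c = j then g * y (j', d) else 0)
      + (if d = l then h * inverse (letter_Kinv j j' c) * y (c, l') else 0)"
    and "lin L (tensor_act A D (chF i)) y (c, d) = (if c = j' then inverse g * letter_Kinv l l' d * y (j, d) else 0)
      + (if d = l' then inverse h * y (c, l) else 0)"
    and "lin L (tensor_act A D (chK i)) y (c, d) = inverse (letter_Kinv j j' c * letter_Kinv l l' d) * y (c, d)"
    and "lin L (tensor_act A D (chKinv i)) y (c, d) = letter_Kinv j j' c * letter_Kinv l l' d * y (c, d)"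
proof -
  have fin: "finite L" by (simp add: L_def)
  note T = tensor_act_simple[OF A D, of _ _ c d]
  show "lin L (tensor_act A D (chE i)) y (c, d) = (if c = j then g * y (j', d) else 0)
      + (if d = l then h * inverse (letter_Kinv j j' c) * y (c, l') else 0)"
    using lin_two[OF fin, of "tensor_act A D (chE i)" "(c, d)" "(j', d)" _ "(c, l')", OF _, of _ _ y]
      T(1) j l b by (auto simp: L_def mult_ac)
  show "lin L (tensor_act A D (chF i)) y (c, d) = (if c = j' then inverse g * letter_Kinv l l' d * y (j, d) else 0)
      + (if d = l' then inverse h * y (c, l) else 0)"
    using lin_two[OF fin, of "tensor_act A D (chF i)" "(c, d)" "(j, d)" _ "(c, l)", OF _, of _ _ y]
      T(2) j l b by (auto simp: L_def mult_ac)
  show "lin L (tensor_act A D (chK i)) y (c, d) = inverse (letter_Kinv j j' c * letter_Kinv l l' d) * y (c, d)"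
    using lin_one[OF fin, of "tensor_act A D (chK i)" "(c, d)" "(c, d)" "inverse (letter_Kinv j j' c * letter_Kinv l l' d)" y] T(3) b
    by (auto simp: L_def mult_ac)
  show "lin L (tensor_act A D (chKinv i)) y (c, d) = letter_Kinv j j' c * letter_Kinv l l' d * y (c, d)"
    using lin_one[OF fin, of "tensor_act A D (chKinv i)" "(c, d)" "(c, d)" "letter_Kinv j j' c * letter_Kinv l l' d" y] T(4) b
    by (auto simp: L_def mult_ac)
qed

lemma pair_op_chevalley:
  fixes y :: "(nat \<times> nat) vec"
  assumes A: "acts_simply n A i j j' g" and D: "acts_simply n D i l l' h"
    and j: "j \<in> {1..n}" "j' \<in> {1..n}" "j \<noteq> j'" and l: "l \<in> {1..n}" "l' \<in> {1..n}" "l \<noteq> l'"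
    and b: "c \<in> {1..n}" "d \<in> {1..n}"
  defines "L \<equiv> {1..n} \<times> {1..n}"
  shows "lin L (tensor_act A D (chF i)) y (c, d)
      + inverse qv * lin L (tensor_act A D (chE i)) (lin L (tensor_act A D (chKinv i)) y) (c, d)
      = letter_Kinv l l' d * letter_B j j' g c * y (letter_swap j j' c, d) + letter_B l l' h d * y (c, letter_swap l l' d)"
    and "lin L (tensor_act A D (chKinv i)) y (c, d) = letter_Kinv j j' c * letter_Kinv l l' d * y (c, d)"
proof -
  note T = lin_tensor_act[OF A D j(1,2) l(1,2), folded L_def]
  show "lin L (tensor_act A D (chKinv i)) y (c, d) = letter_Kinv j j' c * letter_Kinv l l' d * y (c, d)"
    by (rule T(4)[OF b])
  have Kj: "letter_Kinv j j' j' = qv" "letter_Kinv l l' l' = qv" using j l by (auto simp: letter_Kinv_def)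
  have cancel: "inverse qv * (h * inverse k * (k * qv * v)) = h * v" if "k \<noteq> 0" for k v :: Cqx
    using that by (simp add: field_simps)
  have E: "inverse qv * lin L (tensor_act A D (chE i)) (lin L (tensor_act A D (chKinv i)) y) (c, d)
     = (if c = j then g * letter_Kinv l l' d * y (j', d) else 0) + (if d = l then h * y (c, l') else 0)"
    unfolding T(1)[OF b] T(4)[OF j(2) b(2)] T(4)[OF b(1) l(2)] Kj distrib_left
    using cancel[of "letter_Kinv j j' c" "y (c, l')"] by (auto simp: field_simps)
  show "lin L (tensor_act A D (chF i)) y (c, d)
      + inverse qv * lin L (tensor_act A D (chE i)) (lin L (tensor_act A D (chKinv i)) y) (c, d)
      = letter_Kinv l l' d * letter_B j j' g c * y (letter_swap j j' c, d) + letter_B l l' h d * y (c, letter_swap l l' d)"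
    unfolding E T(2)[OF b] using j l by (auto simp: letter_B_def letter_swap_def mult_ac)
qed

text \<open>The coideal generator only sees the unordered pair \<open>{i, i + 1}\<close> and the product of the
  spectral parameter with its orientation, which is how \<open>W(z)\<close> and \<open>W\<^sup>\<or>(z\<inverse>)\<close> are matched.\<close>

lemma pair_op_site:
  assumes n: "2 \<le> n" and i: "i \<in> {1..n}" and cd: "c \<in> {1..n}" "d \<in> {1..n}"
  defines "L \<equiv> {1..n} \<times> {1..n}"
  defines "MM \<equiv> (\<lambda>S. act (if fst S then Wd n (inverse (snd S)) else W n (snd S)))"
  shows "lin L (tensor_act (MM S) (MM T) (chF i)) y (c, d)
      + inverse qv * lin L (tensor_act (MM S) (MM T) (chE i)) (lin L (tensor_act (MM S) (MM T) (chKinv i)) y) (c, d)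
      = pair_op n i S T y (c, d)"
    and "lin L (tensor_act (MM S) (MM T) (chKinv i)) y (c, d) = pair_Kinv n i S T y (c, d)"
proof -
  have nn: "nxt n i \<noteq> i" using n by (rule nxt_neq)
  have i': "nxt n i \<in> {1..n}" by (rule nxt_in[OF i])
  define J where "J S = (if fst S then nxt n i else i)" for S :: "bool \<times> Cqx"
  define J' where "J' S = (if fst S then i else nxt n i)" for S :: "bool \<times> Cqx"
  define G where "G S = (if fst S then inverse (spec n (snd S) i) else spec n (snd S) i)" for S
  have A: "acts_simply n (MM S) i (J S) (J' S) (G S)" for S
    using acts_simply_W[OF n, of "snd S" i] acts_simply_Wd[OF n, of "inverse (snd S)" i]
    by (simp add: MM_def J_def J'_def G_def spec_inverse)
  have J: "J S \<in> {1..n}" "J' S \<in> {1..n}" "J S \<noteq> J' S" for S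
    using i i' nn by (auto simp: J_def J'_def)
  have B: "letter_B (J S) (J' S) (G S) = site_coeff n i S" for S
    using letter_B_commute[OF nn[symmetric], of "spec n (snd S) i"]
    by (simp add: J_def J'_def G_def site_coeff_def)
  have K: "letter_Kinv (J S) (J' S) = site_Kinv n i S" for S
    by (simp add: J_def J'_def site_Kinv_def)
  have sw: "letter_swap (J S) (J' S) = node_letter n i" for S
    using letter_swap_commute[of i "nxt n i"] by (simp add: J_def J'_def)
  show "lin L (tensor_act (MM S) (MM T) (chF i)) y (c, d)
      + inverse qv * lin L (tensor_act (MM S) (MM T) (chE i)) (lin L (tensor_act (MM S) (MM T) (chKinv i)) y) (c, d)
      = pair_op n i S T y (c, d)"
    using pair_op_chevalley(1)[OF A[of S] A[of T] J[of S] J[of T] cd, of y]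
    unfolding L_def B K sw by (simp only: pair_op_def case_prod_conv)
  show "lin L (tensor_act (MM S) (MM T) (chKinv i)) y (c, d) = pair_Kinv n i S T y (c, d)"
    using pair_op_chevalley(2)[OF A[of S] A[of T] J[of S] J[of T] cd, of y]
    unfolding L_def B K sw by (simp only: pair_Kinv_def case_prod_conv)
qed

text \<open>Linearity for E_i, F_i and the inverse of K_i combines to linearity for B_i. The first
  parameter is written as an inverse because a site (True, z) stands for the dual module at
  z^-1.\<close>

lemma is_R_swaps_sites:
  assumes n: "2 \<le> n" and R: "is_R n (inverse z) v R"
  shows "swaps_sites n (True, z) (False, v) R"
proof -
  let ?L = "{1..n} \<times> {1..n}"
  let ?M = "tensor (Wd n (inverse z)) (W n v)" and ?N = "tensor (W n v) (Wd n (inverse z))"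
  have lab: "labels ?M = ?L" "labels ?N = ?L" by (simp_all add: tensor_def W_def Wd_def)
  have acts: "act ?M = tensor_act (act (Wd n (inverse z))) (act (W n v))"
    "act ?N = tensor_act (act (W n v)) (act (Wd n (inverse z)))" by (simp_all add: tensor_def)
  have U: "U_linear n ?M ?N R" and bij: "bij_betw (lin ?L R) (vspace ?L) (vspace ?L)"
    using R unfolding is_R_def U_iso_def lab by blast+
  have gen: "chE i \<in> generators n" "chF i \<in> generators n" "chKinv i \<in> generators n" if "i \<in> {1..n}" for i
    using that by (auto simp: generators_def)
  have op: "lin ?L R (lin ?L (act ?M g) y) = lin ?L (act ?N g) (lin ?L R y)" if "g \<in> generators n" for g y
    using U_linear_op[OF U _ _ that, of y] unfolding lab by simp
  show ?thesis
    unfolding swaps_sites_def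
  proof (intro conjI ballI impI allI)
    show "R b \<in> vspace ?L" if "b \<in> ?L" for b
      using U that unfolding U_linear_def lab by blast
    show "y = (\<lambda>_. 0)" if "y \<in> vspace ?L" "lin ?L R y = (\<lambda>_. 0)" for y
    proof -
      have "lin ?L R (\<lambda>_. 0) = (\<lambda>_. 0)" by (simp add: lin_def)
      moreover have "(\<lambda>_. 0) \<in> vspace ?L" by (simp add: vspace_def)
      ultimately show ?thesis using bij that unfolding bij_betw_def inj_on_def by metis
    qed
  next
    fix i y b assume i: "i \<in> {1..n}" and b: "b \<in> ?L"
    then obtain c d where cd: "b = (c, d)" "c \<in> {1..n}" "d \<in> {1..n}" by blast
    have P: "pair_op n i (True, z) (False, v) y x = lin ?L (act ?M (chF i)) y x
        + inverse qv * lin ?L (act ?M (chE i)) (lin ?L (act ?M (chKinv i)) y) x" if "x \<in> ?L" for x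
      using pair_op_site(1)[OF n i, of "fst x" "snd x" "(True, z)" "(False, v)" y] that
      unfolding acts by (auto simp del: atLeastAtMost_iff)
    have P': "pair_op n i (False, v) (True, z) y' (c, d) = lin ?L (act ?N (chF i)) y' (c, d)
        + inverse qv * lin ?L (act ?N (chE i)) (lin ?L (act ?N (chKinv i)) y') (c, d)" for y'
      using pair_op_site(1)[OF n i cd(2,3), of "(False, v)" "(True, z)" y']
      unfolding acts by (simp del: atLeastAtMost_iff)
    have "lin ?L R (pair_op n i (True, z) (False, v) y) = lin ?L R (\<lambda>x. lin ?L (act ?M (chF i)) y x
        + inverse qv * lin ?L (act ?M (chE i)) (lin ?L (act ?M (chKinv i)) y) x)"
      using P by (intro lin_cong) auto
    also have "\<dots> = (\<lambda>x. lin ?L R (lin ?L (act ?M (chF i)) y) x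
        + inverse qv * lin ?L R (lin ?L (act ?M (chE i)) (lin ?L (act ?M (chKinv i)) y)) x)"
      unfolding lin_op_add[OF lin_op_lin, of _ _ "lin ?L (act ?M (chF i)) y"]
        lin_op_smult[OF lin_op_lin, of _ _ "inverse qv"] ..
    also have "\<dots> = (\<lambda>x. lin ?L (act ?N (chF i)) (lin ?L R y) x
        + inverse qv * lin ?L (act ?N (chE i)) (lin ?L (act ?N (chKinv i)) (lin ?L R y)) x)"
      unfolding op[OF gen(1)[OF i]] op[OF gen(2)[OF i]] op[OF gen(3)[OF i]] ..
    finally show "lin ?L R (pair_op n i (True, z) (False, v) y) b = pair_op n i (False, v) (True, z) (lin ?L R y) b"
      unfolding cd(1) P' by (rule fun_cong)
    have "lin ?L R (pair_Kinv n i (True, z) (False, v) y) = lin ?L R (lin ?L (act ?M (chKinv i)) y)"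
    proof (rule lin_cong[OF refl])
      fix x assume "x \<in> ?L"
      then show "pair_Kinv n i (True, z) (False, v) y x = lin ?L (act ?M (chKinv i)) y x"
        using pair_op_site(2)[OF n i, of "fst x" "snd x" "(True, z)" "(False, v)" y]
        unfolding acts by (auto simp del: atLeastAtMost_iff)
    qed
    then have "lin ?L R (pair_Kinv n i (True, z) (False, v) y) (c, d) = lin ?L (act ?N (chKinv i)) (lin ?L R y) (c, d)"
      unfolding op[OF gen(3)[OF i]] by (rule fun_cong)
    then show "lin ?L R (pair_Kinv n i (True, z) (False, v) y) b = pair_Kinv n i (False, v) (True, z) (lin ?L R y) b"
      using pair_op_site(2)[OF n i cd(2,3), of "(False, v)" "(True, z)" "lin ?L R y"]
      unfolding acts cd(1) by (simp del: atLeastAtMost_iff)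
  qed
qed

section \<open>Existence of the R-matrix\<close>

text \<open>Going once around the cycle multiplies z by the product of the a i, which is not
  1.\<close>

lemma twisted_cycle_zero:
  fixes z :: "nat \<Rightarrow> 'a::field"
  assumes rec: "\<And>i. i \<in> {1..n} \<Longrightarrow> z (nxt n i) = a i * z i" and prod: "(\<Prod>i=1..n. a i) \<noteq> 1"
    and i: "i \<in> {1..n}"
  shows "z i = 0"
proof -
  have step: "m < n \<Longrightarrow> z (Suc m) = (\<Prod>i=1..m. a i) * z 1" for m
  proof (induction m)
    case (Suc m)
    have "z (Suc (Suc m)) = a (Suc m) * z (Suc m)" using rec[of "Suc m"] Suc.prems by (simp add: nxt_def)
    then show ?case using Suc by (simp add: mult_ac)
  qed simp
  obtain m where m: "n = Suc m" using i by (cases n) auto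
  have "z 1 = a n * z n" using rec[of n] i by (simp add: nxt_def)
  also have "z n = (\<Prod>i=1..m. a i) * z 1" using step[of m] m by simp
  finally have "(1 - (\<Prod>i=1..n. a i)) * z 1 = 0" unfolding m by (simp add: algebra_simps)
  then have "z 1 = 0" using prod by simp
  then show ?thesis using step[of "i - 1"] i by (cases i) auto
qed

text \<open>C is the solution of the recursion along the line with initial value 0. Adding the
  homogeneous solution with initial value t makes it periodic when t is C n divided by 1 minus the
  product of the a i.\<close>

lemma twisted_cycle_solution:
  fixes a h :: "nat \<Rightarrow> 'a::field"
  assumes prod: "(\<Prod>i=1..n. a i) \<noteq> 1"
  shows "\<exists>z. \<forall>i\<in>{1..n}. z (nxt n i) = a i * z i + h i"
proof -
  define C where "C = rec_nat 0 (\<lambda>m c. a (Suc m) * c + h (Suc m))"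
  have C: "C (Suc m) = a (Suc m) * C m + h (Suc m)" for m by (simp add: C_def)
  define t where "t = C n / (1 - (\<Prod>i=1..n. a i))"
  define Z where "Z m = (\<Prod>i=1..m. a i) * t + C m" for m
  have Z: "Z (Suc m) = a (Suc m) * Z m + h (Suc m)" for m
    by (simp add: Z_def C algebra_simps)
  have "(1 - (\<Prod>i=1..n. a i)) * t = C n" using prod by (simp add: t_def)
  then have Zn: "Z n = Z 0" by (simp add: Z_def C_def algebra_simps)
  have "Z (nxt n i - 1) = a i * Z (i - 1) + h i" if "i \<in> {1..n}" for i
  proof -
    have "Z (nxt n i - 1) = Z i" using Zn by (simp add: nxt_def)
    then show ?thesis using Z[of "i - 1"] that by simp
  qed
  then show ?thesis by (intro exI[of _ "\<lambda>i. Z (i - 1)"]) blast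
qed

context
  fixes n :: nat and r :: Cqx
  assumes n: "3 \<le> n" and generic: "r * (- qv) ^ n \<noteq> 1" "r \<noteq> (- qv) ^ n"
begin

definition mq :: Cqx where "mq = - qv"

definition R_scale :: Cqx where
  "R_scale = 1 - r * mq ^ n"

text \<open>The entry of R from v_a of the dual tensor v_a to v_c tensor v_c of the dual, all of
  weight zero. Off the diagonal it is geometric of ratio -q as c runs around the cycle from a, with
  an extra factor r once the affine node is passed; this solves the recursions imposed by E_i and
  F_i. All entries are scaled so that R is \<open>R_scale\<close> times the flip on the other basis
  tensors.\<close>

definition R_diag :: "nat \<Rightarrow> nat \<Rightarrow> Cqx" where
  "R_diag a c = (if c = a then qv + mq ^ (n - 1) * r
     else if a < c then (1 - qv ^ 2) * mq ^ (c - a - 1)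
     else (1 - qv ^ 2) * mq ^ (n + c - a - 1) * r)"

definition R_mat :: "nat \<times> nat \<Rightarrow> (nat \<times> nat) vec" where
  "R_mat = (\<lambda>(a, b) (c, d). if a \<noteq> b then (if c = b \<and> d = a then R_scale else 0)
     else if c = d \<and> c \<in> {1..n} then R_diag a c else 0)"

definition site_ratio :: "nat \<Rightarrow> Cqx" where "site_ratio i = (if i = n then r else 1)"

lemma R_scale_nonzero: "R_scale \<noteq> 0"
  using generic(1) by (simp add: R_scale_def mq_def)

lemma R_diag_less: "a < c \<Longrightarrow> R_diag a c = (1 - qv ^ 2) * mq ^ (c - a - 1)"
  and R_diag_greater: "c < a \<Longrightarrow> R_diag a c = (1 - qv ^ 2) * mq ^ (n + c - a - 1) * r"
  and R_diag_same: "R_diag a a = qv + mq ^ (n - 1) * r"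
  by (simp_all add: R_diag_def)

lemma mq_powers: "mq ^ (n - 1) = mq * mq ^ (n - 2)" "mq ^ n = mq * (mq * mq ^ (n - 2))"
  using n by (simp_all flip: power_Suc add: Suc_diff_Suc numeral_2_eq_2)

text \<open>This is equivariance on inputs of weight zero. Where the right-hand side vanishes it is
  the rule that the entries multiply by -q, and by -q r at the affine node.\<close>

lemma R_diag_column:
  assumes i: "i \<in> {1..n}" and a: "a \<in> {1..n}"
  shows "R_diag a (nxt n i) + qv * site_ratio i * R_diag a i
    = R_scale * ((if a = i then site_ratio i else 0) + (if a = nxt n i then qv else 0))"
proof -
  define P where "P = mq ^ (n - 2)"
  note pw = mq_powers[folded P_def]
  have same: "R_diag b b = qv + mq * P * r" for b unfolding R_diag_same pw ..
  have nn: "nxt n i \<noteq> i" using n by (intro nxt_neq) simp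
  show ?thesis
  proof (cases "i = n")
    case False
    then have nx: "nxt n i = Suc i" and site_ratio: "site_ratio i = 1" by (simp_all add: nxt_def site_ratio_def)
    have in': "i < n" using i False by simp
    consider "a < i" | "a = i" | "a = Suc i" | "Suc i < a" by linarith
    then show ?thesis
    proof cases
      case 1
      define E where "E = mq ^ (i - a - 1)"
      have "Suc i - a - 1 = Suc (i - a - 1)" using 1 by simp
      then have X: "R_diag a (nxt n i) = (1 - qv ^ 2) * (mq * E)" using R_diag_less[of a "Suc i"] 1 by (simp add: E_def nx)
      have Y: "R_diag a i = (1 - qv ^ 2) * E" using R_diag_less[of a i] 1 by (simp add: E_def)
      show ?thesis unfolding X Y site_ratio using 1 nx by (simp add: mq_def algebra_simps)
    next
      case 2
      have X: "R_diag a (nxt n i) = 1 - qv ^ 2" using R_diag_less[of a "Suc i"] 2 by (simp add: nx)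
      have Y: "R_diag a i = qv + mq * P * r" using same[of a] 2 by simp
      show ?thesis unfolding X Y site_ratio R_scale_def pw using 2 nn by (simp add: mq_def algebra_simps power2_eq_square)
    next
      case 3
      have X: "R_diag a (nxt n i) = qv + mq * P * r" using same[of a] 3 nx by simp
      have "n + i - a - 1 = n - 2" using 3 by simp
      then have Y: "R_diag a i = (1 - qv ^ 2) * P * r" using R_diag_greater[of i a] 3 by (simp add: P_def)
      show ?thesis unfolding X Y site_ratio R_scale_def pw using 3 nn nx by (simp add: mq_def algebra_simps power2_eq_square)
    next
      case 4
      define E where "E = mq ^ (n + i - a - 1)"
      have "n + Suc i - a - 1 = Suc (n + i - a - 1)" using 4 a i by (simp only: atLeastAtMost_iff) arith
      then have X: "R_diag a (nxt n i) = (1 - qv ^ 2) * (mq * E) * r"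
        using R_diag_greater[of "Suc i" a] 4 by (simp add: E_def nx)
      have Y: "R_diag a i = (1 - qv ^ 2) * E * r" using R_diag_greater[of i a] 4 by (simp add: E_def)
      show ?thesis unfolding X Y site_ratio using 4 nx by (simp add: mq_def algebra_simps)
    qed
  next
    case True
    then have nx: "nxt n i = 1" and site_ratio: "site_ratio i = r" by (simp_all add: nxt_def site_ratio_def)
    consider "a = n" | "a = 1" "a \<noteq> n" | "1 < a" "a < n" using a by force
    then show ?thesis
    proof cases
      case 1
      have X: "R_diag a (nxt n i) = (1 - qv ^ 2) * r" using R_diag_greater[of 1 a] 1 n by (simp add: nx)
      have Y: "R_diag a i = qv + mq * P * r" using same[of a] 1 True by simp
      show ?thesis unfolding X Y site_ratio R_scale_def pw using 1 nn True
        by (simp add: mq_def algebra_simps power2_eq_square)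
    next
      case 2
      have X: "R_diag a (nxt n i) = qv + mq * P * r" using same[of a] 2 nx by simp
      have "n - a - 1 = n - 2" using 2 by simp
      then have Y: "R_diag a i = (1 - qv ^ 2) * P" using R_diag_less[of a n] 2 n True by (simp add: P_def)
      show ?thesis unfolding X Y site_ratio R_scale_def pw using 2 nn nx True
        by (simp add: mq_def algebra_simps power2_eq_square)
    next
      case 3
      define E where "E = mq ^ (n - a - 1)"
      have "n + 1 - a - 1 = Suc (n - a - 1)" using 3 by simp
      then have X: "R_diag a (nxt n i) = (1 - qv ^ 2) * (mq * E) * r"
        using R_diag_greater[of 1 a] 3 by (simp add: E_def nx)
      have Y: "R_diag a i = (1 - qv ^ 2) * E" using R_diag_less[of a n] 3 True by (simp add: E_def)
      show ?thesis unfolding X Y site_ratio using 3 nx True by (simp add: mq_def algebra_simps)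
    qed
  qed
qed

text \<open>This is equivariance on the inputs that E_i or F_i sends into the zero weight
  space.\<close>

lemma R_diag_row:
  assumes i: "i \<in> {1..n}" and c: "c \<in> {1..n}"
  shows "qv * site_ratio i * R_diag (nxt n i) c + R_diag i c
    = R_scale * ((if c = i then qv else 0) + (if c = nxt n i then site_ratio i else 0))"
proof -
  define P where "P = mq ^ (n - 2)"
  note pw = mq_powers[folded P_def]
  have same: "R_diag b b = qv + mq * P * r" for b unfolding R_diag_same pw ..
  have nn: "nxt n i \<noteq> i" using n by (intro nxt_neq) simp
  show ?thesis
  proof (cases "i = n")
    case False
    then have nx: "nxt n i = Suc i" and site_ratio: "site_ratio i = 1" by (simp_all add: nxt_def site_ratio_def)
    have in': "i < n" using i False by simp
    consider "c < i" | "c = i" | "c = Suc i" | "Suc i < c" by linarith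
    then show ?thesis
    proof cases
      case 1
      define E where "E = mq ^ (n + c - Suc i - 1)"
      have "n + c - i - 1 = Suc (n + c - Suc i - 1)" using 1 in' c by (simp only: atLeastAtMost_iff) arith
      then have X: "R_diag i c = (1 - qv ^ 2) * (mq * E) * r" using R_diag_greater[of c i] 1 by (simp add: E_def)
      have Y: "R_diag (nxt n i) c = (1 - qv ^ 2) * E * r" using R_diag_greater[of c "Suc i"] 1 by (simp add: E_def nx)
      show ?thesis unfolding X Y site_ratio using 1 nx by (simp add: mq_def algebra_simps)
    next
      case 2
      have X: "R_diag i c = qv + mq * P * r" using same[of i] 2 by simp
      have "n + c - Suc i - 1 = n - 2" using 2 by simp
      then have Y: "R_diag (nxt n i) c = (1 - qv ^ 2) * P * r"
        using R_diag_greater[of c "Suc i"] 2 by (simp add: P_def nx)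
      show ?thesis unfolding X Y site_ratio R_scale_def pw using 2 nn by (simp add: mq_def algebra_simps power2_eq_square)
    next
      case 3
      have X: "R_diag i c = 1 - qv ^ 2" using R_diag_less[of i c] 3 by simp
      have Y: "R_diag (nxt n i) c = qv + mq * P * r" using same[of "nxt n i"] 3 nx by simp
      show ?thesis unfolding X Y site_ratio R_scale_def pw using 3 nn nx by (simp add: mq_def algebra_simps power2_eq_square)
    next
      case 4
      define E where "E = mq ^ (c - Suc i - 1)"
      have "c - i - 1 = Suc (c - Suc i - 1)" using 4 by simp
      then have X: "R_diag i c = (1 - qv ^ 2) * (mq * E)" using R_diag_less[of i c] 4 by (simp add: E_def)
      have Y: "R_diag (nxt n i) c = (1 - qv ^ 2) * E" using R_diag_less[of "Suc i" c] 4 by (simp add: E_def nx)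
      show ?thesis unfolding X Y site_ratio using 4 nx by (simp add: mq_def algebra_simps)
    qed
  next
    case True
    then have nx: "nxt n i = 1" and site_ratio: "site_ratio i = r" by (simp_all add: nxt_def site_ratio_def)
    consider "c = n" | "c = 1" "c \<noteq> n" | "1 < c" "c < n" using c by force
    then show ?thesis
    proof cases
      case 1
      have X: "R_diag i c = qv + mq * P * r" using same[of i] 1 True by simp
      have "c - 1 - 1 = n - 2" using 1 by simp
      then have Y: "R_diag (nxt n i) c = (1 - qv ^ 2) * P" using R_diag_less[of 1 c] 1 n by (simp add: P_def nx)
      show ?thesis unfolding X Y site_ratio R_scale_def pw using 1 nn True
        by (simp add: mq_def algebra_simps power2_eq_square)
    next
      case 2
      have X: "R_diag i c = (1 - qv ^ 2) * r" using R_diag_greater[of c i] 2 True n by simp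
      have Y: "R_diag (nxt n i) c = qv + mq * P * r" using same[of 1] 2 nx by simp
      show ?thesis unfolding X Y site_ratio R_scale_def pw using 2 nn nx True
        by (simp add: mq_def algebra_simps power2_eq_square)
    next
      case 3
      define E where "E = mq ^ (c - 1 - 1)"
      have "n + c - n - 1 = Suc (c - 1 - 1)" using 3 by simp
      then have X: "R_diag i c = (1 - qv ^ 2) * (mq * E) * r" using R_diag_greater[of c n] 3 True by (simp add: E_def)
      have Y: "R_diag (nxt n i) c = (1 - qv ^ 2) * E" using R_diag_less[of 1 c] 3 by (simp add: E_def nx)
      show ?thesis unfolding X Y site_ratio using 3 nx True by (simp add: mq_def algebra_simps)
    qed
  qed
qed

lemma prod_site_ratio: "(\<Prod>i=1..n. k * site_ratio i) = k ^ n * r"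
proof -
  have "(\<Prod>i=1..n. k * site_ratio i) = k ^ n * (\<Prod>i=1..n. site_ratio i)" by (simp add: prod.distrib)
  also have "(\<Prod>i=1..n. site_ratio i) = (\<Prod>i=1..n. if i = n then r else 1)"
    by (simp only: site_ratio_def)
  also have "\<dots> = r" using n by (simp add: prod.delta)
  finally show ?thesis .
qed

text \<open>The column relation turns the equations for z into a cyclic recursion for z itself, with
  ratio product r / (-q)^n; since this is not 1, z exists and is unique. That the z found solves the
  original equations holds because the error satisfies a homogeneous cyclic recursion with ratio
  product r (-q)^n, which is not 1 either.\<close>

lemma R_diag_bij:
  assumes y: "\<And>c. c \<notin> {1..n} \<Longrightarrow> y c = 0"
  shows "\<exists>!z. (\<forall>c. c \<notin> {1..n} \<longrightarrow> z c = 0) \<and> (\<forall>c\<in>{1..n}. (\<Sum>a=1..n. z a * R_diag a c) = y c)"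
proof -
  let ?T = "\<lambda>z c. \<Sum>a=1..n. z a * R_diag a c"
  have T: "?T z (nxt n i) + qv * site_ratio i * ?T z i = R_scale * (site_ratio i * z i + qv * z (nxt n i))"
    if i: "i \<in> {1..n}" for z i
  proof -
    have "?T z (nxt n i) + qv * site_ratio i * ?T z i = (\<Sum>a=1..n. z a * (R_diag a (nxt n i) + qv * site_ratio i * R_diag a i))"
      by (simp add: sum.distrib sum_distrib_left algebra_simps)
    also have "\<dots> = (\<Sum>a=1..n. R_scale * ((if a = i then site_ratio i * z i else 0) + (if a = nxt n i then qv * z (nxt n i) else 0)))"
    proof (intro sum.cong refl)
      fix a assume a: "a \<in> {1..n}"
      have "nxt n i \<noteq> i" using n by (intro nxt_neq) simp
      then show "z a * (R_diag a (nxt n i) + qv * site_ratio i * R_diag a i)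
        = R_scale * ((if a = i then site_ratio i * z i else 0) + (if a = nxt n i then qv * z (nxt n i) else 0))"
        unfolding R_diag_column[OF i a] by (cases "a = i"; cases "a = nxt n i") (simp_all add: mult_ac)
    qed
    also have "\<dots> = R_scale * (site_ratio i * z i + qv * z (nxt n i))"
      using i nxt_in[OF i] by (simp add: sum_distrib_left[symmetric] sum.distrib)
    finally show ?thesis .
  qed
  have p1: "(\<Prod>i=1..n. inverse mq * site_ratio i) \<noteq> 1"
  proof
    assume "(\<Prod>i=1..n. inverse mq * site_ratio i) = 1"
    then have "mq ^ n * (inverse mq ^ n * r) = mq ^ n" unfolding prod_site_ratio by simp
    then have "(mq * inverse mq) ^ n * r = mq ^ n" by (simp only: power_mult_distrib mult.assoc)
    then show False using generic(2) by (simp add: mq_def)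
  qed
  have p2: "(\<Prod>i=1..n. mq * site_ratio i) \<noteq> 1"
    using generic(1) unfolding prod_site_ratio by (simp add: mq_def mult.commute)
  obtain z0 where z0: "\<forall>i\<in>{1..n}. z0 (nxt n i) = inverse mq * site_ratio i * z0 i
      + (y (nxt n i) + qv * site_ratio i * y i) / (R_scale * qv)"
    using twisted_cycle_solution[OF p1, of "\<lambda>i. (y (nxt n i) + qv * site_ratio i * y i) / (R_scale * qv)"] by blast
  define z where "z c = (if c \<in> {1..n} then z0 c else 0)" for c
  have zr: "qv * z (nxt n i) + site_ratio i * z i = (y (nxt n i) + qv * site_ratio i * y i) / R_scale" if "i \<in> {1..n}" for i
  proof -
    have "z (nxt n i) = inverse mq * site_ratio i * z i + (y (nxt n i) + qv * site_ratio i * y i) / (R_scale * qv)"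
      using z0 that nxt_in[OF that] unfolding z_def by simp
    then have "qv * z (nxt n i) = (qv * inverse mq) * site_ratio i * z i + qv * ((y (nxt n i) + qv * site_ratio i * y i) / (R_scale * qv))"
      by (simp only: distrib_left mult.assoc)
    moreover have "qv * inverse mq = -1" by (simp add: mq_def)
    ultimately show ?thesis by simp
  qed
  have "?T z c - y c = 0" if c: "c \<in> {1..n}" for c
  proof (rule twisted_cycle_zero[OF _ p2 c, of "\<lambda>c. ?T z c - y c"])
    fix i assume i: "i \<in> {1..n}"
    have "?T z (nxt n i) + qv * site_ratio i * ?T z i = R_scale * (qv * z (nxt n i) + site_ratio i * z i)"
      using T[OF i, of z] by (simp only: add.commute)
    also have "\<dots> = y (nxt n i) + qv * site_ratio i * y i"
      unfolding zr[OF i] using R_scale_nonzero by simp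
    finally show "?T z (nxt n i) - y (nxt n i) = mq * site_ratio i * (?T z i - y i)"
      by (simp add: mq_def algebra_simps)
  qed
  then have ex: "(\<forall>c. c \<notin> {1..n} \<longrightarrow> z c = 0) \<and> (\<forall>c\<in>{1..n}. ?T z c = y c)"
    by (simp add: z_def)
  have unique: "z1 = z2" if z1: "(\<forall>c. c \<notin> {1..n} \<longrightarrow> z1 c = 0) \<and> (\<forall>c\<in>{1..n}. ?T z1 c = y c)"
    and z2: "(\<forall>c. c \<notin> {1..n} \<longrightarrow> z2 c = 0) \<and> (\<forall>c\<in>{1..n}. ?T z2 c = y c)" for z1 z2
  proof
    fix c
    define w where "w c = z1 c - z2 c" for c
    have Tw: "?T w c = 0" if "c \<in> {1..n}" for c
      using z1 z2 that by (simp add: w_def left_diff_distrib sum_subtractf)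
    have "w c = 0" if c: "c \<in> {1..n}"
    proof (rule twisted_cycle_zero[OF _ p1 c])
      fix i assume i: "i \<in> {1..n}"
      have "R_scale * (site_ratio i * w i + qv * w (nxt n i)) = 0"
        unfolding T[OF i, symmetric] Tw[OF i] Tw[OF nxt_in[OF i]] by simp
      then have "qv * w (nxt n i) = - (site_ratio i * w i)"
        using R_scale_nonzero by (simp add: eq_neg_iff_add_eq_0 add.commute)
      then have "inverse qv * (qv * w (nxt n i)) = inverse qv * - (site_ratio i * w i)" by simp
      then show "w (nxt n i) = inverse mq * site_ratio i * w i"
        by (simp add: mult.assoc[symmetric] mq_def)
    qed
    then show "z1 c = z2 c" using z1 z2 by (cases "c \<in> {1..n}") (auto simp: w_def)
  qed
  show ?thesis using ex unique by blast
qed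

lemma lin_R_mat:
  assumes "y \<in> vspace ({1..n} \<times> {1..n})"
  shows "lin ({1..n} \<times> {1..n}) R_mat y (c, d) =
    (if c \<noteq> d then R_scale * y (d, c) else if c \<in> {1..n} then (\<Sum>a=1..n. y (a, a) * R_diag a c) else 0)"
proof (cases "c = d")
  case False
  have "lin ({1..n} \<times> {1..n}) R_mat y (c, d) = (\<Sum>p\<in>{1..n} \<times> {1..n}. if p = (d, c) then y (d, c) * R_scale else 0)"
    unfolding lin_def
  proof (intro sum.cong refl)
    fix p :: "nat \<times> nat"
    obtain a b where "p = (a, b)" by (cases p)
    then show "y p * R_mat p (c, d) = (if p = (d, c) then y (d, c) * R_scale else 0)"
      using False by (cases "a = d"; cases "b = c"; cases "a = b") (simp_all add: R_mat_def)
  qed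
  also have "\<dots> = (if (d, c) \<in> {1..n} \<times> {1..n} then y (d, c) * R_scale else 0)"
    by (rule sum.delta) simp
  also have "\<dots> = R_scale * y (d, c)" using assms by (auto simp: vspace_def mult.commute)
  finally show ?thesis using False by simp
next
  case True
  have "lin ({1..n} \<times> {1..n}) R_mat y (c, c)
    = (\<Sum>a=1..n. \<Sum>b=1..n. if b = a then (if c \<in> {1..n} then y (a, a) * R_diag a c else 0) else 0)"
    unfolding lin_def sum.cartesian_product
  proof (intro sum.cong refl)
    fix p :: "nat \<times> nat"
    obtain a b where "p = (a, b)" by (cases p)
    then show "y p * R_mat p (c, c) = (case p of (a, b) \<Rightarrow> if b = a then (if c \<in> {1..n} then y (a, a) * R_diag a c else 0) else 0)"
      by (cases "b = a"; cases "c = a") (simp_all add: R_mat_def)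
  qed
  also have "\<dots> = (\<Sum>a=1..n. if c \<in> {1..n} then y (a, a) * R_diag a c else 0)"
    by (intro sum.cong) auto
  finally show ?thesis unfolding True[symmetric] by (cases "c \<in> {1..n}") (simp_all del: atLeastAtMost_iff)
qed

lemma R_mat_vspace: "b \<in> {1..n} \<times> {1..n} \<Longrightarrow> R_mat b \<in> vspace ({1..n} \<times> {1..n})"
  by (cases b) (simp add: R_mat_def vspace_def del: atLeastAtMost_iff)

lemma R_mat_bij: "bij_betw (lin ({1..n} \<times> {1..n}) R_mat) (vspace ({1..n} \<times> {1..n})) (vspace ({1..n} \<times> {1..n}))"
proof -
  let ?L = "{1..n} \<times> {1..n}"
  have v: "lin ?L R_mat y \<in> vspace ?L" for y
    unfolding vspace_def lin_def
  proof (intro CollectI allI impI sum.neutral ballI)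
    fix p b assume "p \<notin> ?L" "b \<in> ?L"
    then have "R_mat b p = 0" using R_mat_vspace[of b] unfolding vspace_def by blast
    then show "y b * R_mat b p = 0" by simp
  qed
  have U: "\<exists>!z. z \<in> vspace ?L \<and> lin ?L R_mat z = y" if y: "y \<in> vspace ?L" for y
  proof -
    have yd: "y (c, c) = 0" if "c \<notin> {1..n}" for c using y that by (simp add: vspace_def)
    have EX: "\<exists>!z. (\<forall>c. c \<notin> {1..n} \<longrightarrow> z c = 0) \<and> (\<forall>c\<in>{1..n}. (\<Sum>a=1..n. z a * R_diag a c) = y (c, c))"
      by (rule R_diag_bij) (rule yd)
    from EX obtain z0 where
      z0: "\<And>c. c \<notin> {1..n} \<Longrightarrow> z0 c = 0" "\<And>c. c \<in> {1..n} \<Longrightarrow> (\<Sum>a=1..n. z0 a * R_diag a c) = y (c, c)"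
      and uniq: "\<And>z1. (\<forall>c. c \<notin> {1..n} \<longrightarrow> z1 c = 0) \<and> (\<forall>c\<in>{1..n}. (\<Sum>a=1..n. z1 a * R_diag a c) = y (c, c)) \<Longrightarrow> z1 = z0"
      by (elim ex1E) blast
    define z where "z = (\<lambda>(a, b). if a = b then z0 a else y (b, a) / R_scale)"
    have zv: "z \<in> vspace ?L" using z0(1) y by (auto simp: z_def vspace_def)
    have "lin ?L R_mat z p = y p" for p
    proof -
      obtain c d where p: "p = (c, d)" by (cases p)
      show ?thesis unfolding p lin_R_mat[OF zv] using z0(2) yd R_scale_nonzero by (auto simp: z_def)
    qed
    then have 1: "lin ?L R_mat z = y" by blast
    have "z' = z" if z': "z' \<in> vspace ?L" "lin ?L R_mat z' = y" for z'
    proof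
      fix p :: "nat \<times> nat"
      obtain a b where p: "p = (a, b)" by (cases p)
      have "(\<lambda>a. z' (a, a)) = z0"
      proof (rule uniq, intro conjI allI ballI impI)
        show "z' (c, c) = 0" if "c \<notin> {1..n}" for c using z'(1) that by (simp add: vspace_def)
        show "(\<Sum>a=1..n. z' (a, a) * R_diag a c) = y (c, c)" if "c \<in> {1..n}" for c
          using lin_R_mat[OF z'(1), of c c] that unfolding z'(2) by simp
      qed
      moreover have "a \<noteq> b \<Longrightarrow> R_scale * z' (a, b) = y (b, a)"
        using lin_R_mat[OF z'(1), of b a] unfolding z'(2) by auto
      ultimately show "z' p = z p"
        unfolding p using R_scale_nonzero by (auto simp: z_def fun_eq_iff field_simps)
    qed
    then show ?thesis using 1 zv by blast
  qed
  show ?thesis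
  proof (rule bij_betwI')
    show "lin ?L R_mat x = lin ?L R_mat y \<longleftrightarrow> x = y" if "x \<in> vspace ?L" "y \<in> vspace ?L" for x y
      using U[OF v[of y]] that by blast
    show "\<exists>x\<in>vspace ?L. y = lin ?L R_mat x" if "y \<in> vspace ?L" for y
      using U[OF that] by blast
  qed (rule v)
qed

lemma R_mat_off: "a \<noteq> b \<Longrightarrow> R_mat (a, b) (c, d) = (if c = b \<and> d = a then R_scale else 0)"
  and R_mat_diag: "R_mat (a, a) (c, d) = (if c = d \<and> c \<in> {1..n} then R_diag a c else 0)"
  by (simp_all add: R_mat_def)

text \<open>U and V are the parameters of the dual factor and of the other one. Only two kinds of
  input carry content: (i, i'), which E_i sends into weight zero, settled by
  \<open>R_diag_row\<close>, and a = b, settled by \<open>R_diag_column\<close>. On the remaining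
  inputs only the off-diagonal part of R occurs, a multiple of the flip.\<close>

lemma R_mat_E:
  assumes i: "i \<in> {1..n}" and ab: "a \<in> {1..n}" "b \<in> {1..n}" and cd: "c \<in> {1..n}" "d \<in> {1..n}"
    and U: "U = site_ratio i * V"
  defines "i' \<equiv> nxt n i"
  shows "(if a = i then U * R_mat (i', b) (c, d) else 0)
      + (if b = i' then V * inverse (letter_Kinv i' i a) * R_mat (a, i) (c, d) else 0)
    = (if c = i then V * R_mat (a, b) (i', d) else 0)
      + (if d = i' then U * inverse (letter_Kinv i i' c) * R_mat (a, b) (c, i) else 0)"
proof -
  have ii: "i' \<noteq> i" unfolding i'_def using n by (intro nxt_neq) simp
  have i': "i' \<in> {1..n}" unfolding i'_def by (rule nxt_in[OF i])
  have K: "letter_Kinv i' i i = qv" "letter_Kinv i' i i' = inverse qv"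
    "letter_Kinv i i' i = inverse qv" "letter_Kinv i i' i' = qv"
    "\<And>m. m \<noteq> i \<Longrightarrow> m \<noteq> i' \<Longrightarrow> letter_Kinv i i' m = 1" "\<And>m. m \<noteq> i \<Longrightarrow> m \<noteq> i' \<Longrightarrow> letter_Kinv i' i m = 1"
    using ii by (auto simp: letter_Kinv_def)
  consider (1) "a = i" "b = i'" | (2) "a = b" | (3) "a \<noteq> b" "a = i" "b \<noteq> i'" | (4) "a \<noteq> b" "a \<noteq> i" by blast
  then show ?thesis
  proof cases
    case 1
    have row: "qv * site_ratio i * R_diag i' c + R_diag i c = R_scale * ((if c = i then qv else 0) + (if c = i' then site_ratio i else 0))"
      using R_diag_row[OF i cd(1)] by (simp add: i'_def)
    have "U * R_diag i' c + V * inverse qv * R_diag i c = V * inverse qv * (qv * site_ratio i * R_diag i' c + R_diag i c)"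
      unfolding U by (simp add: algebra_simps)
    also have "\<dots> = R_scale * ((if c = i then V else 0) + (if c = i' then U * inverse qv else 0))"
      unfolding row U using ii by (simp add: mult_ac)
    finally show ?thesis
      using 1 ii cd by (cases "c = d") (auto simp: R_mat_off R_mat_diag K)
  next
    case 2
    have col: "R_diag a i' + qv * site_ratio i * R_diag a i = R_scale * ((if a = i then site_ratio i else 0) + (if a = i' then qv else 0))"
      using R_diag_column[OF i ab(1)] by (simp add: i'_def)
    have e: "V * R_diag a i' + U * qv * R_diag a i = R_scale * ((if a = i then U else 0) + (if a = i' then V * qv else 0))"
    proof -
      have "V * R_diag a i' + U * qv * R_diag a i = V * (R_diag a i' + qv * site_ratio i * R_diag a i)"
        unfolding U by (simp add: algebra_simps)
      then show ?thesis unfolding col U using ii by (simp add: mult_ac)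
    qed
    show ?thesis
    proof (cases "c = i \<and> d = i'")
      case True
      then show ?thesis using 2 ii i i' e by (auto simp: R_mat_off R_mat_diag K mult_ac simp del: atLeastAtMost_iff)
    next
      case False
      then show ?thesis using 2 ii by (auto simp: R_mat_off R_mat_diag simp del: atLeastAtMost_iff)
    qed
  next
    case 3
    then show ?thesis using ii by (auto simp: R_mat_off K)
  next
    case 4
    then show ?thesis using ii by (auto simp: R_mat_off K)
  qed
qed

lemma R_mat_F:
  assumes i: "i \<in> {1..n}" and ab: "a \<in> {1..n}" "b \<in> {1..n}" and cd: "c \<in> {1..n}" "d \<in> {1..n}"
    and U: "U = site_ratio i * V" "U \<noteq> 0" "V \<noteq> 0"
  defines "i' \<equiv> nxt n i"
  shows "(if a = i' then inverse U * letter_Kinv i i' b * R_mat (i, b) (c, d) else 0)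
      + (if b = i then inverse V * R_mat (a, i') (c, d) else 0)
    = (if c = i' then inverse V * letter_Kinv i' i d * R_mat (a, b) (i, d) else 0)
      + (if d = i then inverse U * R_mat (a, b) (c, i') else 0)"
proof -
  have ii: "i' \<noteq> i" unfolding i'_def using n by (intro nxt_neq) simp
  have i': "i' \<in> {1..n}" unfolding i'_def by (rule nxt_in[OF i])
  have K: "letter_Kinv i' i i = qv" "letter_Kinv i' i i' = inverse qv"
    "letter_Kinv i i' i = inverse qv" "letter_Kinv i i' i' = qv"
    "\<And>m. m \<noteq> i \<Longrightarrow> m \<noteq> i' \<Longrightarrow> letter_Kinv i i' m = 1" "\<And>m. m \<noteq> i \<Longrightarrow> m \<noteq> i' \<Longrightarrow> letter_Kinv i' i m = 1"
    using ii by (auto simp: letter_Kinv_def)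
  have VU: "inverse V = inverse U * site_ratio i" using U by (simp add: field_simps)
  consider (1) "a = i'" "b = i" | (2) "a = b" | (3) "a \<noteq> b" "a = i'" "b \<noteq> i" | (4) "a \<noteq> b" "a \<noteq> i'" by blast
  then show ?thesis
  proof cases
    case 1
    have row: "qv * site_ratio i * R_diag i' c + R_diag i c = R_scale * ((if c = i then qv else 0) + (if c = i' then site_ratio i else 0))"
      using R_diag_row[OF i cd(1)] by (simp add: i'_def)
    have "inverse U * inverse qv * R_diag i c + inverse V * R_diag i' c = inverse U * inverse qv * (qv * site_ratio i * R_diag i' c + R_diag i c)"
      unfolding VU by (simp add: algebra_simps)
    also have "\<dots> = R_scale * ((if c = i then inverse U else 0) + (if c = i' then inverse V * inverse qv else 0))"
      unfolding row VU using ii by (simp add: mult_ac)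
    finally show ?thesis
      using 1 ii cd by (cases "c = d") (auto simp: R_mat_off R_mat_diag K)
  next
    case 2
    have col: "R_diag a i' + qv * site_ratio i * R_diag a i = R_scale * ((if a = i then site_ratio i else 0) + (if a = i' then qv else 0))"
      using R_diag_column[OF i ab(1)] by (simp add: i'_def)
    have e: "inverse V * qv * R_diag a i + inverse U * R_diag a i' = R_scale * ((if a = i then inverse V else 0) + (if a = i' then inverse U * qv else 0))"
    proof -
      have "inverse V * qv * R_diag a i + inverse U * R_diag a i' = inverse U * (R_diag a i' + qv * site_ratio i * R_diag a i)"
        unfolding VU by (simp add: algebra_simps)
      then show ?thesis unfolding col VU using ii by (simp add: mult_ac)
    qed
    show ?thesis
    proof (cases "c = i' \<and> d = i")
      case True
      then show ?thesis using 2 ii i i' e by (auto simp: R_mat_off R_mat_diag K mult_ac simp del: atLeastAtMost_iff)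
    next
      case False
      then show ?thesis using 2 ii by (auto simp: R_mat_off R_mat_diag simp del: atLeastAtMost_iff)
    qed
  next
    case 3
    then show ?thesis using ii by (auto simp: R_mat_off K)
  next
    case 4
    then show ?thesis using ii by (auto simp: R_mat_off K)
  qed
qed

lemma R_mat_K:
  assumes "j \<noteq> j'"
  shows "letter_Kinv j' j a * letter_Kinv j j' b * R_mat (a, b) (c, d)
    = letter_Kinv j j' c * letter_Kinv j' j d * R_mat (a, b) (c, d)"
proof (cases "a = b")
  case True
  then show ?thesis by (simp add: letter_Kinv_flip[OF assms] R_mat_diag)
next
  case False
  then show ?thesis by (simp add: R_mat_off mult.commute)
qed

end

section \<open>Equivariance of the explicit matrix and genericity of the parameters\<close>

lemma lin_act_vector:
  assumes "finite L" and "\<And>p. p \<in> L \<Longrightarrow> f p = (if p = q then k else 0) + (if p = q' then k' else 0)"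
  shows "lin L R f x = (if q \<in> L then k * R q x else 0) + (if q' \<in> L then k' * R q' x else 0)"
proof -
  have "lin L R f x = (\<Sum>p\<in>L. (if p = q then k * R q x else 0) + (if p = q' then k' * R q' x else 0))"
    unfolding lin_def using assms(2) by (intro sum.cong) (auto simp: distrib_right)
  then show ?thesis using assms(1) by (simp add: sum.distrib)
qed

lemma act_tensor_vector:
  assumes A: "acts_simply n A i j j' g" and D: "acts_simply n D i l l' h"
    and j: "j \<in> {1..n}" "j' \<in> {1..n}" and l: "l \<in> {1..n}" "l' \<in> {1..n}"
    and ab: "a \<in> {1..n}" "b \<in> {1..n}"
  defines "L \<equiv> {1..n} \<times> {1..n}"
  shows "lin L R (tensor_act A D (chE i) (a, b)) x = (if a = j' then g * R (j, b) x else 0)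
      + (if b = l' then h * inverse (letter_Kinv j j' a) * R (a, l) x else 0)"
    and "lin L R (tensor_act A D (chF i) (a, b)) x = (if a = j then inverse g * letter_Kinv l l' b * R (j', b) x else 0)
      + (if b = l then inverse h * R (a, l') x else 0)"
    and "lin L R (tensor_act A D (chK i) (a, b)) x = inverse (letter_Kinv j j' a * letter_Kinv l l' b) * R (a, b) x"
    and "lin L R (tensor_act A D (chKinv i) (a, b)) x = letter_Kinv j j' a * letter_Kinv l l' b * R (a, b) x"
proof -
  have fin: "finite L" by (simp add: L_def)
  note T = tensor_act_simple[OF A D ab]
  have 1: "tensor_act A D (chE i) (a, b) p = (if p = (j, b) then (if a = j' then g else 0) else 0)
     + (if p = (a, l) then (if b = l' then h * inverse (letter_Kinv j j' a) else 0) else 0)" for p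
    by (cases p) (simp only: T, auto)
  have 2: "tensor_act A D (chF i) (a, b) p = (if p = (j', b) then (if a = j then inverse g * letter_Kinv l l' b else 0) else 0)
     + (if p = (a, l') then (if b = l then inverse h else 0) else 0)" for p
    by (cases p) (simp only: T, auto)
  have 3: "tensor_act A D (chK i) (a, b) p = (if p = (a, b) then inverse (letter_Kinv j j' a * letter_Kinv l l' b) else 0)
     + (if p = (a, b) then 0 else 0)" for p
    by (cases p) (simp only: T, auto)
  have 4: "tensor_act A D (chKinv i) (a, b) p = (if p = (a, b) then letter_Kinv j j' a * letter_Kinv l l' b else 0)
     + (if p = (a, b) then 0 else 0)" for p
    by (cases p) (simp only: T, auto)
  show "lin L R (tensor_act A D (chE i) (a, b)) x = (if a = j' then g * R (j, b) x else 0)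
      + (if b = l' then h * inverse (letter_Kinv j j' a) * R (a, l) x else 0)"
    using lin_act_vector[OF fin 1, of R x] j l ab by (auto simp: L_def)
  show "lin L R (tensor_act A D (chF i) (a, b)) x = (if a = j then inverse g * letter_Kinv l l' b * R (j', b) x else 0)
      + (if b = l then inverse h * R (a, l') x else 0)"
    using lin_act_vector[OF fin 2, of R x] j l ab by (auto simp: L_def)
  show "lin L R (tensor_act A D (chK i) (a, b)) x = inverse (letter_Kinv j j' a * letter_Kinv l l' b) * R (a, b) x"
    using lin_act_vector[OF fin 3, of R x] ab by (auto simp: L_def)
  show "lin L R (tensor_act A D (chKinv i) (a, b)) x = letter_Kinv j j' a * letter_Kinv l l' b * R (a, b) x"
    using lin_act_vector[OF fin 4, of R x] ab by (auto simp: L_def)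
qed

lemma tensor_act_outside:
  assumes A: "acts_simply n A i j j' g" and D: "acts_simply n D i l l' h"
    and j: "j \<in> {1..n}" "j' \<in> {1..n}" and l: "l \<in> {1..n}" "l' \<in> {1..n}"
    and ab: "a \<in> {1..n}" "b \<in> {1..n}" and cd: "(c, d) \<notin> {1..n} \<times> {1..n}"
    and x: "x \<in> {chE i, chF i, chK i, chKinv i}"
  shows "tensor_act A D x (a, b) (c, d) = 0"
proof -
  have ne: "\<not> ((a, b) = (j', d) \<and> c = j)" "\<not> ((a, b) = (c, l') \<and> d = l)"
    "\<not> ((a, b) = (j, d) \<and> c = j')" "\<not> ((a, b) = (c, l) \<and> d = l')" "(a, b) \<noteq> (c, d)"
    using j l ab cd by blast+
  note T = tensor_act_simple[OF A D ab]
  from x consider "x = chE i" | "x = chF i" | "x = chK i" | "x = chKinv i" by blast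
  then show ?thesis
  proof cases
    case 1
    show ?thesis unfolding 1 T(1) using ne(1,2) by auto
  next
    case 2
    show ?thesis unfolding 2 T(2) using ne(3,4) by auto
  next
    case 3
    show ?thesis unfolding 3 T(3) using ne(5) by auto
  next
    case 4
    show ?thesis unfolding 4 T(4) using ne(5) by auto
  qed
qed

lemma is_R_R_mat:
  assumes n: "3 \<le> n" and uv: "u \<noteq> 0" "v \<noteq> 0"
    and generic: "u / v * (- qv) ^ n \<noteq> 1" "u / v \<noteq> (- qv) ^ n"
  shows "is_R n u v (R_mat n (u / v))"
proof -
  let ?L = "{1..n} \<times> {1..n}" and ?R = "R_mat n (u / v)"
  let ?M = "tensor (Wd n u) (W n v)" and ?N = "tensor (W n v) (Wd n u)"
  have n2: "2 \<le> n" using n by simp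
  have lab: "labels ?M = ?L" "labels ?N = ?L" by (simp_all add: tensor_def W_def Wd_def)
  have acts: "act ?M = tensor_act (act (Wd n u)) (act (W n v))"
    "act ?N = tensor_act (act (W n v)) (act (Wd n u))" by (simp_all add: tensor_def)
  have Rv: "?R b \<in> vspace ?L" if "b \<in> ?L" for b
    using R_mat_vspace[OF n generic that] .
  have eq: "lin ?L ?R (act ?M g p) = lin ?L (act ?N g) (?R p)" if g: "g \<in> generators n" and p: "p \<in> ?L" for g p
  proof
    fix x :: "nat \<times> nat"
    obtain i where i: "i \<in> {1..n}" and gi: "g \<in> {chE i, chF i, chK i, chKinv i}"
      using g unfolding generators_def by blast
    obtain a b where ab: "p = (a, b)" "a \<in> {1..n}" "b \<in> {1..n}" using p by blast
    obtain c d where x: "x = (c, d)" by (cases x)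
    have i': "nxt n i \<in> {1..n}" by (rule nxt_in[OF i])
    have nn: "nxt n i \<noteq> i" using n2 by (rule nxt_neq)
    note A = acts_simply_W[OF n2, of v i] and D = acts_simply_Wd[OF n2, of u i]
    define U V where "U = spec n u i" and "V = spec n v i"
    have U: "U = site_ratio n (u / v) i * V" "U \<noteq> 0" "V \<noteq> 0"
      using uv by (simp_all add: U_def V_def spec_def site_ratio_def[OF n generic])
    show "lin ?L ?R (act ?M g p) x = lin ?L (act ?N g) (?R p) x"
    proof (cases "x \<in> ?L")
      case True
      then have cd: "c \<in> {1..n}" "d \<in> {1..n}" using x by auto
      note V1 = act_tensor_vector[OF D A i' i i i' ab(2,3), of ?R x, folded U_def V_def]
        and V2 = lin_tensor_act[OF A D i i' i' i cd, of "?R p", folded U_def V_def]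
      have K: "letter_Kinv (nxt n i) i a * letter_Kinv i (nxt n i) b * ?R (a, b) (c, d)
        = letter_Kinv i (nxt n i) c * letter_Kinv (nxt n i) i d * ?R (a, b) (c, d)"
        by (rule R_mat_K[OF n generic nn[symmetric]])
      have K': "inverse (letter_Kinv (nxt n i) i a * letter_Kinv i (nxt n i) b) * ?R (a, b) (c, d)
        = inverse (letter_Kinv i (nxt n i) c * letter_Kinv (nxt n i) i d) * ?R (a, b) (c, d)"
        using K by (auto simp: field_simps)
      from gi consider "g = chE i" | "g = chF i" | "g = chK i" | "g = chKinv i" by blast
      then show ?thesis
      proof cases
        case 1
        show ?thesis
          using R_mat_E[OF n generic i ab(2,3) cd U(1)] V1(1) V2(1)
          unfolding 1 acts ab(1) x by (simp only:)
      next
        case 2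
        show ?thesis
          using R_mat_F[OF n generic i ab(2,3) cd U] V1(2) V2(2)
          unfolding 2 acts ab(1) x by (simp only:)
      next
        case 3
        show ?thesis using K' V1(3) V2(3) unfolding 3 acts ab(1) x by (simp only:)
      next
        case 4
        show ?thesis using K V1(4) V2(4) unfolding 4 acts ab(1) x by (simp only:)
      qed
    next
      case False
      have "act ?N g b' x = 0" if bL: "b' \<in> ?L" for b'
      proof -
        obtain a' b'' where b': "b' = (a', b'')" "a' \<in> {1..n}" "b'' \<in> {1..n}" using bL by blast
        show ?thesis
          unfolding acts b'(1) x using False x gi
          by (intro tensor_act_outside[OF A D i i' i' i b'(2,3)]) simp_all
      qed
      then have "lin ?L (act ?N g) (?R p) x = 0" unfolding lin_def by (intro sum.neutral) simp
      moreover have "?R b' x = 0" if "b' \<in> ?L" for b'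
        using Rv[OF that] False unfolding vspace_def by blast
      then have "lin ?L ?R (act ?M g p) x = 0" unfolding lin_def by (intro sum.neutral) simp
      ultimately show ?thesis by simp
    qed
  qed
  then have "U_linear n ?M ?N ?R"
    unfolding U_linear_def lab using Rv by blast
  then show ?thesis
    unfolding is_R_def U_iso_def lab using R_mat_bij[OF n generic] by blast
qed

text \<open>A nonzero k would equate a power of x, which has nonzero residue, with a positive power
  of q^-1, which has residue 0. So k = 0, and x has infinite order.\<close>

lemma qv_xv_independent: "qv powi k * xv powi l = 1 \<Longrightarrow> l = 0"
proof -
  assume eq: "qv powi k * xv powi l = 1"
  have small: "residue (qv powi (- int m)) = 0" if "0 < m" for m
    unfolding qv_powi_minus using that by (simp add: residue_power)
  have x0: "x0 powi m \<noteq> 0" for m using x0_nonzero by simp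
  consider "k = 0" | m where "0 < m" "k = int m" | m where "0 < m" "k = - int m"
    by (cases k rule: int_cases3) auto
  then show "l = 0"
  proof cases
    case 1
    then have "xv powi l = 1" using eq by simp
    then have "x0 powi l = 1" using residue_xv_powi[of l] by simp
    then show ?thesis by (rule x0_powi_eq_1)
  next
    case 2
    have "qv powi (- int m) * (qv powi k * xv powi l) = qv powi (- int m)" using eq by simp
    then have "xv powi l = qv powi (- int m)"
      by (simp only: mult.assoc[symmetric] qv_powi_mult 2(2) add.left_inverse power_int_0_right mult_1_left)
    then show ?thesis using residue_xv_powi[of l] small[OF 2(1)] x0 by simp
  next
    case 3
    have "xv powi (- l) = (qv powi k * xv powi l) * xv powi (- l)" using eq by simp
    also have "\<dots> = qv powi k * (xv powi l * xv powi (- l))" by (simp only: mult.assoc)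
    also have "xv powi l * xv powi (- l) = 1" by (simp add: power_int_minus)
    finally have "xv powi (- l) = qv powi (- int m)" using 3 by simp
    then show ?thesis using residue_xv_powi[of "- l"] small[OF 3(1)] x0 by simp
  qed
qed

lemma R_exists:
  assumes n: "3 \<le> n"
  shows "is_R n (u_par s j i) (v_par s j) (R_mat n (u_par s j i / v_par s j))"
proof (rule is_R_R_mat[OF n])
  define e where "e = (int s - 2 * int j + 2 * int i + 1) - (2 * int j - int s - 1)"
  have r: "u_par s j i / v_par s j = qv powi e * xv powi (- 2)"
  proof -
    have "qv powi e = qv powi (int s - 2 * int j + 2 * int i + 1) / qv powi (2 * int j - int s - 1)"
      unfolding e_def by (rule power_int_diff) simp
    moreover have "xv powi (- 2) = inverse xv / xv"
      by (simp add: power_int_minus power2_eq_square field_simps)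
    ultimately show ?thesis unfolding u_par_def v_par_def by simp
  qed
  \<comment> \<open>The ratio of the parameters contains x^-2, so it is never a power of -q.
    Squaring removes the sign in (-q)^n and makes \<open>qv_xv_independent\<close>
    applicable.\<close>
  have sq: "((- qv) ^ n) ^ 2 = qv powi (2 * int n)"
  proof -
    have "((- qv) ^ n) ^ 2 = ((- qv) ^ 2) ^ n" by (simp only: power_mult [symmetric] mult.commute)
    also have "\<dots> = qv ^ (2 * n)" by (simp only: power2_minus power_mult)
    also have "\<dots> = qv powi int (2 * n)" by (simp only: power_int_of_nat)
    finally show ?thesis by (simp only: of_nat_mult of_nat_numeral)
  qed
  have r2: "(u_par s j i / v_par s j) ^ 2 = qv powi (2 * e) * xv powi (- 4)"
  proof -
    have "xv powi (- 2) * xv powi (- 2) = xv powi (- 2 + - 2)"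
      by (rule power_int_add [symmetric]) simp
    then have x4: "xv powi (- 2) * xv powi (- 2) = xv powi (- 4)" by simp
    have "(u_par s j i / v_par s j) ^ 2 = (qv powi e * qv powi e) * (xv powi (- 2) * xv powi (- 2))"
      unfolding r power2_eq_square by (simp only: mult_ac)
    then show ?thesis unfolding x4 qv_powi_mult by (simp only: mult_2)
  qed
  show "u_par s j i / v_par s j * (- qv) ^ n \<noteq> 1"
  proof
    assume "u_par s j i / v_par s j * (- qv) ^ n = 1"
    then have "(u_par s j i / v_par s j) ^ 2 * ((- qv) ^ n) ^ 2 = 1"
      by (simp only: power_mult_distrib [symmetric] power_one)
    then have "qv powi (2 * e + 2 * int n) * xv powi (- 4) = 1"
      unfolding r2 sq qv_powi_mult[symmetric] by (simp only: mult_ac)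
    from qv_xv_independent[OF this] show False by simp
  qed
  show "u_par s j i / v_par s j \<noteq> (- qv) ^ n"
  proof
    assume "u_par s j i / v_par s j = (- qv) ^ n"
    then have "qv powi (- (2 * int n)) * (qv powi (2 * e) * xv powi (- 4)) = qv powi (- (2 * int n)) * qv powi (2 * int n)"
      unfolding r2[symmetric] sq[symmetric] by simp
    then have "qv powi (- (2 * int n) + 2 * e) * xv powi (- 4) = 1"
      unfolding qv_powi_mult mult.assoc[symmetric] by simp
    from qv_xv_independent[OF this] show False by simp
  qed
qed (simp_all add: u_par_def)

text \<open>Passing to the dual at the inverse parameter exchanges the two letters of node i and
  inverts the coefficient; B_i treats the two directions alike, so its matrix stays the
  same.\<close>

lemma is_K_bvec:
  assumes n: "2 \<le> n"
  shows "is_K n z bvec"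
proof -
  let ?S = "{1..n}"
  have lab: "labels (W n z) = ?S" "labels (Wd n (inverse z)) = ?S" by (simp_all add: W_def Wd_def)
  have B: "actB M i b c = (if b = j \<and> c = j' then inverse g else 0) + (if b = j' \<and> c = j then g else 0)"
    if A: "acts_simply n (act M) i j j' g" and M: "labels M = ?S" and b: "b \<in> ?S" and j: "j \<noteq> j'"
    for M i b c j j' g
  proof -
    have "lin ?S (act M (chE i)) (act M (chKinv i) b) c = (\<Sum>a\<in>?S. if b = a then letter_Kinv j j' b * (if b = j' \<and> c = j then g else 0) else 0)"
      unfolding lin_def using A b by (intro sum.cong) (auto simp: acts_simply_def)
    also have "\<dots> = letter_Kinv j j' b * (if b = j' \<and> c = j then g else 0)"
      using b by (simp del: atLeastAtMost_iff)
    also have "\<dots> = qv * (if b = j' \<and> c = j then g else 0)" using j by (simp add: letter_Kinv_def)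
    finally have "inverse qv * lin ?S (act M (chE i)) (act M (chKinv i) b) c = (if b = j' \<and> c = j then g else 0)" by simp
    moreover have "act M (chF i) b c = (if b = j \<and> c = j' then inverse g else 0)"
      using A b unfolding acts_simply_def by blast
    ultimately show ?thesis unfolding actB_def M by simp
  qed
  have eq: "actB (W n z) i b = actB (Wd n (inverse z)) i b" if "i \<in> ?S" "b \<in> ?S" for i b
  proof
    fix c
    have nn: "nxt n i \<noteq> i" using n by (rule nxt_neq)
    show "actB (W n z) i b c = actB (Wd n (inverse z)) i b c"
      unfolding B[OF acts_simply_W[OF n] lab(1) that(2) nn[symmetric]]
        B[OF acts_simply_Wd[OF n] lab(2) that(2) nn] spec_inverse
      by simp
  qed
  have v: "actB (W n z) i b \<in> vspace ?S" if i: "i \<in> ?S" and b: "b \<in> ?S" for i b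
    using nxt_in[OF i] i nxt_neq[OF n, of i]
    unfolding vspace_def B[OF acts_simply_W[OF n] lab(1) b nxt_neq[OF n, symmetric]] by auto
  have id: "lin ?S bvec y = y" if "y \<in> vspace ?S" for y
    using lincomb_bvec[OF _ that] by (simp add: lin_def lincomb_def)
  have sel: "lin ?S A (bvec b) = A b" if "b \<in> ?S" for A :: "nat \<Rightarrow> nat vec" and b
  proof
    fix x
    have "lin ?S A (bvec b) x = (\<Sum>a\<in>?S. if a = b then A b x else 0)"
      unfolding lin_def bvec_def by (intro sum.cong) auto
    then show "lin ?S A (bvec b) x = A b x" using that by (simp del: atLeastAtMost_iff)
  qed
  show ?thesis
    unfolding is_K_def Ui_linear_def lab
  proof (intro conjI ballI)
    show "bvec b \<in> vspace ?S" if "b \<in> ?S" for b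
      using that by (auto simp: vspace_def bvec_def)
    show "lin ?S bvec (actB (W n z) i b) = lin ?S (actB (Wd n (inverse z)) i) (bvec b)"
      if "i \<in> ?S" "b \<in> ?S" for i b
      unfolding id[OF v[OF that]] sel[OF that(2)] by (rule eq[OF that])
  qed simp
qed

lemma u_par_inverse:
  assumes "i < j"
  shows "u_par s j i = inverse (v_par s (j - i))"
proof -
  have "int s - 2 * int j + 2 * int i + 1 = - (2 * int (j - i) - int s - 1)" using assms by simp
  then show ?thesis unfolding u_par_def v_par_def by (simp only: power_int_minus inverse_mult_distrib)
qed

lemma site_map_K_choice:
  assumes n: "2 \<le> n" and R: "R_choice n s R" and K: "K_choice n s K"
  shows "site_map n s (stage_sites s 0) (stage_sites s s) (K_total n s R K)"
proof (rule site_map_K_total)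
  show "\<forall>l\<in>{1..n}. K (v_par s j) l = bvec l" if "j \<in> {1..s}" for j
    using K that unfolding K_choice_def is_K_def by blast
  show "swaps_sites n (True, v_par s (j - i)) (False, v_par s j) (R (u_par s j i) (v_par s j))"
    if "j \<in> {1..s}" "i \<in> {1..<j}" for i j
  proof -
    have eq: "u_par s j i = inverse (v_par s (j - i))" using that by (intro u_par_inverse) simp
    have "is_R n (u_par s j i) (v_par s j) (R (u_par s j i) (v_par s j))"
      using R that unfolding R_choice_def by blast
    then have "is_R n (inverse (v_par s (j - i))) (v_par s j) (R (u_par s j i) (v_par s j))"
      by (simp only: eq)
    then show ?thesis by (rule is_R_swaps_sites[OF n])
  qed
qed

section \<open>From the tensor power to matrices on compositions\<close>

lemma node_op_vspace:
  assumes j: "j \<in> {1..n}" "j' \<in> {1..n}" "j \<noteq> j'" and v: "v \<in> vspace (comps n s)"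
  shows "node_op j j' g v \<in> vspace (comps n s)"
  unfolding vspace_def
proof (intro CollectI allI impI)
  fix c assume c: "c \<notin> comps n s"
  have "v (c(j := c j + 1, j' := c j' - 1)) = 0" if "c j' \<noteq> 0"
  proof -
    have "same_string j j' (c(j := c j + 1, j' := c j' - 1)) c"
      using that j by (auto simp: same_string_def)
    then show ?thesis using same_string_comps[OF j] c v unfolding vspace_def by blast
  qed
  moreover have "v (c(j := c j - 1, j' := c j' + 1)) = 0" if "c j \<noteq> 0"
  proof -
    have "same_string j j' (c(j := c j - 1, j' := c j' + 1)) c"
      using that j by (auto simp: same_string_def)
    then show ?thesis using same_string_comps[OF j] c v unfolding vspace_def by blast
  qed
  ultimately show "node_op j j' g v c = 0"
    unfolding node_op_def by (cases "c j = 0"; cases "c j' = 0") simp_all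
qed

text \<open>The relation between M and the coideal generators, freed from the tensor power. It is
  stable under multiplying M by a scalar, as used when M is normalised.\<close>

definition intertwines_nodes :: "nat \<Rightarrow> nat \<Rightarrow> (comp \<Rightarrow> comp vec) \<Rightarrow> bool" where
  "intertwines_nodes n s M \<longleftrightarrow> (\<forall>a\<in>comps n s. M a \<in> vspace (comps n s)) \<and>
     (\<forall>i\<in>{1..n}. \<forall>v\<in>vspace (comps n s).
        lin (comps n s) M (node_op i (nxt n i) (spec n xv i) v)
        = node_op (nxt n i) i (inverse (spec n xv i)) (lin (comps n s) M v))"

lemma lin_vspace: "(\<And>a. a \<in> S \<Longrightarrow> M a \<in> vspace T) \<Longrightarrow> lin S M v \<in> vspace T"
  unfolding vspace_def lin_def by (auto intro!: sum.neutral)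

lemma lin_bvec: "finite S \<Longrightarrow> a \<in> S \<Longrightarrow> lin S M (bvec a) = M a"
proof
  fix x assume "finite S" "a \<in> S"
  have "lin S M (bvec a) x = (\<Sum>b\<in>S. if b = a then M a x else 0)"
    unfolding lin_def bvec_def by (intro sum.cong) auto
  then show "lin S M (bvec a) x = M a x" using \<open>finite S\<close> \<open>a \<in> S\<close> by simp
qed

lemma bvec_vspace: "a \<in> S \<Longrightarrow> bvec a \<in> vspace S"
  by (auto simp: vspace_def bvec_def)

lemma K_total_node_op:
  assumes n: "2 \<le> n" and f: "site_map n s (stage_sites s 0) (stage_sites s s) f" and i: "i \<in> {1..n}"
  shows "f (sym_embed (\<lambda>c. c) n s (node_op i (nxt n i) (spec n xv i) v))
    = sites_op n i (stage_sites s s) (f (sym_embed (\<lambda>c. c) n s v))"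
  unfolding sites_op_first[OF n i, symmetric]
  using f i sym_embed_vspace unfolding site_map_def by blast

text \<open>The composite intertwines the actions on the tensor products, and
  \<open>sym_embed\<close> is injective on vectors supported on compositions, so the relation can be
  read off from M. Nonvanishing is inherited from the injectivity of the composite.\<close>

lemma quantum_K_matrix_intertwines:
  assumes n: "2 \<le> n" and M: "quantum_K_matrix n s M"
  shows "intertwines_nodes n s M" and "a \<in> comps n s \<Longrightarrow> \<exists>b\<in>comps n s. M a b \<noteq> 0"
proof -
  let ?C = "comps n s"
  obtain R K where RK: "R_choice n s R" "K_choice n s K"
    and Mv: "\<And>a. a \<in> ?C \<Longrightarrow> M a \<in> vspace ?C"
    and MK: "\<And>a. a \<in> ?C \<Longrightarrow> K_total n s R K (emb n s a) = lin ?C (embd n s) (M a)"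
    using M unfolding quantum_K_matrix_def by blast
  define f where "f = K_total n s R K"
  have f: "site_map n s (stage_sites s 0) (stage_sites s s) f"
    unfolding f_def by (rule site_map_K_choice[OF n RK])
  then have lf: "lin_op f" unfolding site_map_def by blast
  have ext: "f (sym_embed (\<lambda>c. c) n s v) = sym_embed (\<lambda>c. n - c) n s (lin ?C M v)" for v
  proof -
    have "f (lin ?C (emb n s) v) = lincomb ?C v (\<lambda>a. f (emb n s a))"
      using lin_op_lincomb[OF lf, of ?C v "emb n s"] by (simp add: lin_def lincomb_def)
    also have "\<dots> = lincomb ?C v (\<lambda>a. lin ?C (embd n s) (M a))"
      using MK by (intro lincomb_cong) (simp_all add: f_def)
    also have "\<dots> = lin ?C (embd n s) (lin ?C M v)"
      unfolding lin_lin[OF finite_comps finite_comps] by (simp add: lincomb_def lin_def)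
    finally show ?thesis unfolding lin_emb lin_embd .
  qed
  show "intertwines_nodes n s M"
    unfolding intertwines_nodes_def
  proof (intro conjI ballI)
    show "M a \<in> vspace ?C" if "a \<in> ?C" for a using Mv[OF that] .
    fix i v assume i: "i \<in> {1..n}" and v: "v \<in> vspace ?C"
    have nn: "nxt n i \<noteq> i" using n by (rule nxt_neq)
    let ?B = "node_op i (nxt n i) (spec n xv i)" and ?B' = "node_op (nxt n i) i (inverse (spec n xv i))"
    have "sym_embed (\<lambda>c. n - c) n s (lin ?C M (?B v)) = sym_embed (\<lambda>c. n - c) n s (?B' (lin ?C M v))"
      unfolding ext[symmetric] K_total_node_op[OF n f i]
      unfolding ext by (rule sites_op_last_embed[OF n i])
    moreover have "lin ?C M (?B v) \<in> vspace ?C" by (rule lin_vspace[OF Mv])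
    moreover have "?B' (lin ?C M v) \<in> vspace ?C"
      by (rule node_op_vspace[OF nxt_in[OF i] i nn lin_vspace[OF Mv]])
    ultimately show "lin ?C M (?B v) = ?B' (lin ?C M v)" by (rule sym_embed_inj)
  qed
  show "\<exists>b\<in>?C. M a b \<noteq> 0" if a: "a \<in> ?C"
  proof (rule ccontr)
    assume "\<not> (\<exists>b\<in>?C. M a b \<noteq> 0)"
    then have "M a b = 0" for b using Mv[OF a] unfolding vspace_def by blast
    then have "M a = (\<lambda>_. 0)" by blast
    then have "f (sym_embed (\<lambda>c. c) n s (bvec a)) = sym_embed (\<lambda>c. n - c) n s (\<lambda>_. 0)"
      unfolding ext lin_bvec[OF finite_comps a] by simp
    also have "\<dots> = (\<lambda>_. 0)" by (auto simp: sym_embed_def symm_def)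
    finally have "sym_embed (\<lambda>c. c) n s (bvec a) = (\<lambda>_. 0)"
      using f sym_embed_vspace unfolding site_map_def by blast
    also have "\<dots> = sym_embed (\<lambda>c. c) n s (\<lambda>_. 0)" by (auto simp: sym_embed_def symm_def)
    finally have "(bvec a :: comp vec) = (\<lambda>_. 0)"
      by (rule sym_embed_inj) (use bvec_vspace[OF a] in \<open>simp_all add: vspace_def\<close>)
    from fun_cong[OF this, of a] show False by (simp add: bvec_def)
  qed
qed

section \<open>The limit of the K-matrix\<close>

lemma node_k_prim:
  assumes "i \<in> {1..n}"
  shows "node_k (nxt n i) i (prim n a) = node_k i (nxt n i) a"
proof -
  have "prim n a i = a (nxt n i) + theta (a i) - theta (a (nxt n i))" using assms by (simp add: prim_def)
  then show ?thesis
    using theta_prim[OF nxt_in[OF assms], of a] theta_le[of "a (nxt n i)"] by (simp add: node_k_theta)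
qed

text \<open>The exponents of x in the limit must satisfy these relations along swaps. The affine
  node contributes x^(a n) from the source basis and x to the power minus (prim a) 1 from the target
  basis; in the swap relation the target factors of a and a' appear on opposite sides, which turns
  this into the stated sum.\<close>

lemma Istat_node_swap:
  assumes n: "3 \<le> n" and i: "i \<in> {1..n}" and k: "node_k i (nxt n i) a \<noteq> 0"
  defines "a' \<equiv> node_swap i (nxt n i) a"
  shows "i \<noteq> n \<Longrightarrow> Istat a' = Istat a"
    and "i = n \<Longrightarrow> Istat a + a n + prim n a 1 = Istat a' + a' n + prim n a' 1"
proof -
  assume "i \<noteq> n"
  then have nx: "nxt n i = i + 1" by (simp add: nxt_def)
  have "a' 1 = a 1 \<or> (even (a 1) \<and> a' 1 = a 1 + 1) \<or> (odd (a 1) \<and> a' 1 = a 1 - 1)"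
    unfolding a'_def node_swap_def nx using i by auto
  then show "Istat a' = Istat a" unfolding Istat_def by (elim disjE) (auto elim!: oddE evenE)
next
  assume "i = n"
  have nx: "nxt n n = 1" by (simp add: nxt_def)
  have n1: "(1::nat) \<noteq> n" using n by simp
  have p: "prim n a' = node_swap 1 n (prim n a)"
    using prim_node_swap[OF n i k] unfolding a'_def \<open>i = n\<close> nx .
  have k': "node_k 1 n (prim n a) \<noteq> 0"
    using node_k_prim[OF i, of a] k unfolding \<open>i = n\<close> nx by (simp only: not_False_eq_True)
  have par: "even (prim n a 1) \<longleftrightarrow> even (a 1)"
  proof -
    have "theta (prim n a 1) = theta (a 1)" using n by (intro theta_prim) simp
    then show ?thesis unfolding theta_def by (cases "even (prim n a 1)"; cases "even (a 1)") simp_all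
  qed
  have p1: "prim n a' 1 = (if even (a 1) then prim n a 1 + 1 else prim n a 1 - 1)"
    unfolding p using n1 k' par by (auto simp: node_swap_def node_k_def)
  have a1: "a' n = (if even (a n) then a n + 1 else a n - 1)" "a' 1 = (if even (a n) then a 1 - 1 else a 1 + 1)"
    "even (a n) \<Longrightarrow> a 1 \<noteq> 0"
    using n1 k unfolding a'_def \<open>i = n\<close> nx by (auto simp: node_swap_def node_k_def)
  have o: "odd (prim n a 1) \<Longrightarrow> prim n a 1 \<noteq> 0" "odd (a n) \<Longrightarrow> a n \<noteq> 0" by (auto simp: odd_pos)
  show "Istat a + a n + prim n a 1 = Istat a' + a' n + prim n a' 1"
  proof (cases "even (a n)"; cases "even (a 1)")
    assume e: "even (a n)" "even (a 1)"
    then obtain m where m: "a 1 = 2 * Suc m" using a1(3) by (metis evenE mult_0_right not0_implies_Suc)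
    then have "Istat a = Istat a' + 2" using a1(2) e by (simp add: Istat_def)
    then show ?thesis using e a1(1) p1 by simp
  next
    assume e: "even (a n)" "odd (a 1)"
    then have "Istat a = Istat a'" using a1(2) by (auto simp: Istat_def elim!: oddE)
    then show ?thesis using e a1(1) p1 o(1) par by simp
  next
    assume e: "odd (a n)" "even (a 1)"
    then have "Istat a = Istat a'" using a1(2) by (auto simp: Istat_def elim!: evenE)
    then show ?thesis using e a1(1) p1 o(2) by simp
  next
    assume e: "odd (a n)" "odd (a 1)"
    then have "Istat a' = Istat a + 2" using a1(2) by (auto simp: Istat_def elim!: oddE)
    then show ?thesis using e a1(1) p1 o par by simp
  qed
qed

lemma spec_xv_residue:
  "spec n xv i \<in> Ax" "residue (spec n xv i) = (if i = n then x0 else 1)"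
  "inverse (spec n xv i) \<in> Ax" "residue (inverse (spec n xv i)) = (if i = n then inverse x0 else 1)"
  using Ax_inverse[of "cst x0"] x0_nonzero by (simp_all add: spec_def xv_cst)

lemma intertwiner_limit:
  assumes n: "3 \<le> n" and M: "intertwines_nodes n s M"
    and A: "\<And>a b. a \<in> comps n s \<Longrightarrow> b \<in> comps n s \<Longrightarrow> M a b \<in> Ax"
  obtains c where "\<And>a b. a \<in> comps n s \<Longrightarrow> b \<in> comps n s \<Longrightarrow>
    residue (M a b) = (if b = prim n a then c * x0 ^ Istat a else 0)"
proof -
  let ?C = "comps n s"
  define F where "F a b = residue (M a b)" for a b
  \<comment> \<open>The leading factors of the adapted bases: the gauge leaves x^(a n) on the source
    and x^-(b 1) on the target at the affine node, and 1 at all other nodes.\<close>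
  define dd where "dd i a = (if i = n then x0 else 1) ^ a i" for i and a :: comp
  define dd' where "dd' i b = (if i = n then inverse x0 else 1) ^ b (nxt n i)" for i and b :: comp
  have d0: "dd i a \<noteq> 0" "dd' i a \<noteq> 0" for i a using x0_nonzero by (simp_all add: dd_def dd'_def)
  have I: "(F a b \<noteq> 0 \<longrightarrow> node_k i (nxt n i) a = node_k (nxt n i) i b) \<and>
      (node_k i (nxt n i) a = node_k (nxt n i) i b \<longrightarrow> node_k i (nxt n i) a \<noteq> 0 \<longrightarrow>
        F (node_swap i (nxt n i) a) (node_swap (nxt n i) i b) * dd i (node_swap i (nxt n i) a) * dd' i b
        = F a b * dd i a * dd' i (node_swap (nxt n i) i b))"
    if i: "i \<in> {1..n}" and ab: "a \<in> ?C" "b \<in> ?C" for i a b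
  proof -
    let ?g = "spec n xv i"
    have nn: "nxt n i \<noteq> i" using n by (intro nxt_neq) simp
    have i': "nxt n i \<in> {1..n}" by (rule nxt_in[OF i])
    have g0: "?g \<noteq> 0" "inverse ?g \<noteq> 0" using spec_nonzero[OF xv_nonzero] by simp_all
    have r0: "residue ?g \<noteq> 0" "residue (inverse ?g) \<noteq> 0" using x0_nonzero by (simp_all add: spec_xv_residue)
    have w: "lattice_basis ?C (dd i) (node_basis i (nxt n i) ?g)"
      using lattice_basis_node[OF i i' nn[symmetric] spec_xv_residue(1) r0(1)]
      unfolding spec_xv_residue dd_def .
    have w': "lattice_basis ?C (dd' i) (node_basis (nxt n i) i (inverse ?g))"
      using lattice_basis_node[OF i' i nn spec_xv_residue(3) r0(2)]
      unfolding spec_xv_residue dd'_def .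
    have e: "eigen_swap ?C (node_op i (nxt n i) ?g) (node_k i (nxt n i)) (node_swap i (nxt n i)) (node_basis i (nxt n i) ?g)"
      by (rule eigen_swap_node[OF i i' nn[symmetric] g0(1)])
    have e': "eigen_swap ?C (node_op (nxt n i) i (inverse ?g)) (node_k (nxt n i) i) (node_swap (nxt n i) i) (node_basis (nxt n i) i (inverse ?g))"
      by (rule eigen_swap_node[OF i' i nn g0(2)])
    have Mv: "M a \<in> vspace ?C" if "a \<in> ?C" for a using M that unfolding intertwines_nodes_def by blast
    have f: "lin ?C M (node_op i (nxt n i) ?g v) = node_op (nxt n i) i (inverse ?g) (lin ?C M v)"
      if "v \<in> vspace ?C" for v
      using M that i unfolding intertwines_nodes_def by blast
    note IR = intertwiner_residue[OF lin_op_node_op lin_op_node_op w w' e e' Mv A f ab]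
    show ?thesis unfolding F_def using IR by blast
  qed
  have sup: "b = prim n (top_comp s)" if b: "b \<in> ?C" "F (top_comp s) b \<noteq> 0" for b
    using I[OF _ top_comp_in b(1)] b(2) n by (intro prim_eqI[OF n b(1)]) auto
  define c where "c = F (top_comp s) (prim n (top_comp s)) / x0 ^ Istat (top_comp s)"
  define P where "P a \<longleftrightarrow> (\<forall>b\<in>?C. F a b = (if b = prim n a then c * x0 ^ Istat a else 0))" for a
  have top: "P (top_comp s)" unfolding P_def using sup x0_nonzero by (auto simp: c_def)
  have closed: "P (node_swap i (nxt n i) a)"
    if a: "a \<in> ?C" and i: "i \<in> {1..n}" and k: "node_k i (nxt n i) a \<noteq> 0" and Pa: "P a" for a i
    unfolding P_def
  proof
    fix b assume b: "b \<in> ?C"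
    have nn: "nxt n i \<noteq> i" using n by (intro nxt_neq) simp
    have i': "nxt n i \<in> {1..n}" by (rule nxt_in[OF i])
    define a' where "a' = node_swap i (nxt n i) a"
    define b' where "b' = node_swap (nxt n i) i b"
    have a'C: "a' \<in> ?C" unfolding a'_def by (rule node_swap_comps[OF i i' nn[symmetric] a])
    have b'C: "b' \<in> ?C" unfolding b'_def by (rule node_swap_comps[OF i' i nn b])
    have sa: "node_swap i (nxt n i) a' = a" "node_k i (nxt n i) a' = node_k i (nxt n i) a"
      unfolding a'_def using node_swap_swap[OF nn[symmetric] k] by simp_all
    have pa': "prim n a' = node_swap (nxt n i) i (prim n a)"
      unfolding a'_def by (rule prim_node_swap[OF n i k])
    show "F (node_swap i (nxt n i) a) b = (if b = prim n (node_swap i (nxt n i) a) then c * x0 ^ Istat (node_swap i (nxt n i) a) else 0)"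
      unfolding a'_def[symmetric]
    proof (cases "node_k i (nxt n i) a' = node_k (nxt n i) i b")
      case False
      then have "F a' b = 0" using I[OF i a'C b] by blast
      moreover have "b \<noteq> prim n a'" using False node_k_prim[OF i, of a'] by metis
      ultimately show "F a' b = (if b = prim n a' then c * x0 ^ Istat a' else 0)" by simp
    next
      case True
      then have kb: "node_k (nxt n i) i b \<noteq> 0" using sa(2) k by simp
      have sb: "node_swap (nxt n i) i b' = b" unfolding b'_def by (rule node_swap_swap[OF nn kb])
      \<comment> \<open>The swap relation at (a', b), read backwards: swapping leads to (a, b'),
        where the entry is already known.\<close>
      have rel: "F a b' * dd i a * dd' i b = F a' b * dd i a' * dd' i b'"
        using I[OF i a'C b] True sa k unfolding b'_def[symmetric] sa(1) by simp
      have Fab: "F a b' = (if b' = prim n a then c * x0 ^ Istat a else 0)"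
        using Pa b'C unfolding P_def by blast
      have iff: "b' = prim n a \<longleftrightarrow> b = prim n a'"
      proof
        assume "b' = prim n a" then show "b = prim n a'" using sb pa' by simp
      next
        assume "b = prim n a'"
        then have "b' = node_swap (nxt n i) i (node_swap (nxt n i) i (prim n a))" unfolding b'_def pa' by simp
        then show "b' = prim n a"
          using node_swap_swap(1)[OF nn, of "prim n a"] node_k_prim[OF i, of a] k by simp
      qed
      show "F a' b = (if b = prim n a' then c * x0 ^ Istat a' else 0)"
      proof (cases "b = prim n a'")
        case False
        then have "F a' b * dd i a' * dd' i b' = 0" using rel Fab iff by simp
        then show ?thesis using False d0 by simp
      next
        case bp: True
        then have bp': "b' = prim n a" using iff by blast
        have "x0 ^ Istat a * dd i a * dd' i b = x0 ^ Istat a' * dd i a' * dd' i b'"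
        proof (cases "i = n")
          case False
          then show ?thesis using Istat_node_swap(1)[OF n i k] by (simp add: dd_def dd'_def a'_def)
        next
          case True
          have nat: "Istat a + a n + prim n a 1 = Istat a' + a' n + prim n a' 1"
            unfolding a'_def by (rule Istat_node_swap(2)[OF n i k True])
          have cancel: "x0 ^ m * inverse x0 ^ m = 1" for m
            using x0_nonzero by (simp flip: power_mult_distrib)
          have "x0 ^ Istat a * x0 ^ a n * inverse x0 ^ prim n a' 1
              = x0 ^ Istat a * x0 ^ a n * inverse x0 ^ prim n a' 1 * (x0 ^ prim n a 1 * inverse x0 ^ prim n a 1)"
            unfolding cancel by simp
          also have "\<dots> = x0 ^ (Istat a + a n + prim n a 1) * inverse x0 ^ prim n a' 1 * inverse x0 ^ prim n a 1"
            unfolding power_add by (simp only: mult_ac)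
          also have "\<dots> = x0 ^ Istat a' * x0 ^ a' n * (x0 ^ prim n a' 1 * inverse x0 ^ prim n a' 1) * inverse x0 ^ prim n a 1"
            unfolding nat power_add by (simp only: mult_ac)
          also have "\<dots> = x0 ^ Istat a' * x0 ^ a' n * inverse x0 ^ prim n a 1"
            unfolding cancel by simp
          finally show ?thesis
            using True bp bp' by (simp add: dd_def dd'_def nxt_def)
        qed
        then have "c * x0 ^ Istat a * dd i a * dd' i b = c * x0 ^ Istat a' * dd i a' * dd' i b'"
          by (simp only: mult.assoc)
        then have "F a' b * dd i a' * dd' i b' = c * x0 ^ Istat a' * dd i a' * dd' i b'"
          using rel unfolding Fab if_P[OF bp'] by (rule trans[OF sym, rotated])
        then show ?thesis using bp d0 by simp
      qed
    qed
  qed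
  have "P a" if "a \<in> ?C" for a
    using swap_connected[of n s P "top_comp s" a, OF n closed top_comp_in that top] n by simp
  then show ?thesis using that[of c] unfolding P_def F_def by simp
qed

section \<open>Existence of the K-matrix\<close>

lemma sym_embed_restrict: "sym_embed h n s v = sym_embed h n s (\<lambda>a. if a \<in> comps n s then v a else 0)"
  using count_list_comps by (auto simp: sym_embed_def symm_def fun_eq_iff)

lemma Cx_two_nonzero: "(1::Cx) + 1 \<noteq> 0"
  by (simp add: One_fract_def Zero_fract_def eq_fract)

lemma quantum_K_matrix_exists:
  assumes n: "3 \<le> n" and s: "1 \<le> s"
  shows "\<exists>M. quantum_K_matrix n s M"
proof -
  let ?C = "comps n s"
  have n2: "2 \<le> n" using n by simp
  define R where "R = (\<lambda>u v. R_mat n (u / v))"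
  define K where "K = (\<lambda>_::Cqx. bvec :: nat \<Rightarrow> nat vec)"
  have RC: "R_choice n s R" unfolding R_choice_def R_def using R_exists[OF n] by blast
  have KC: "K_choice n s K" unfolding K_choice_def K_def using is_K_bvec[OF n2] by blast
  define f where "f = K_total n s R K"
  have f: "site_map n s (stage_sites s 0) (stage_sites s s) f"
    unfolding f_def by (rule site_map_K_choice[OF n2 RC KC])
  then have lf: "lin_op f" unfolding site_map_def by blast
  let ?e = "sym_embed (\<lambda>c. c) n s" and ?d = "sym_embed (\<lambda>c. n - c) n s"
  define N where "N = {v \<in> vspace ?C. \<exists>v'\<in>vspace ?C. f (?e v) = ?d v'}"
  have N: "subspace_of ?C N"
    unfolding subspace_of_def
  proof (intro conjI ballI allI)
    show "N \<subseteq> vspace ?C" by (auto simp: N_def)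
    have "f (?e (\<lambda>_. 0)) = ?d (\<lambda>_. 0)"
      using lin_op_0[OF lf] lin_op_0[OF lin_op_sym_embed[of "\<lambda>c. c" n s]] lin_op_0[OF lin_op_sym_embed[of "\<lambda>c. n - c" n s]] by simp
    moreover have "(\<lambda>_. 0) \<in> vspace ?C" by (simp add: vspace_def)
    ultimately show "(\<lambda>_. 0) \<in> N" unfolding N_def by blast
    fix v u t assume "v \<in> N" "u \<in> N"
    then obtain v' u' where vu: "v \<in> vspace ?C" "u \<in> vspace ?C" "v' \<in> vspace ?C" "u' \<in> vspace ?C"
      "f (?e v) = ?d v'" "f (?e u) = ?d u'" unfolding N_def by blast
    have comb: "L (\<lambda>x. t * p x + q x) = (\<lambda>y. t * L p y + L q y)" if "lin_op L"
      for L :: "'x vec \<Rightarrow> 'y vec" and p q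
      by (simp only: lin_op_add[OF that, of "\<lambda>x. t * p x"] lin_op_smult[OF that, of t])
    have "f (?e (\<lambda>x. t * v x + u x)) = ?d (\<lambda>x. t * v' x + u' x)"
      unfolding comb[OF lin_op_sym_embed] comb[OF lf] vu(5,6) ..
    moreover have "(\<lambda>x. t * v x + u x) \<in> vspace ?C" "(\<lambda>x. t * v' x + u' x) \<in> vspace ?C"
      using vu by (simp_all add: vspace_def)
    ultimately show "(\<lambda>x. t * v x + u x) \<in> N" unfolding N_def by blast
  qed
  have NB: "node_op i (nxt n i) (spec n xv i) v \<in> N" if i: "i \<in> {1..n}" and v: "v \<in> N" for i v
  proof -
    obtain v' where v': "v \<in> vspace ?C" "v' \<in> vspace ?C" "f (?e v) = ?d v'" using v unfolding N_def by blast
    have nn: "nxt n i \<noteq> i" using n2 by (rule nxt_neq)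
    have "f (?e (node_op i (nxt n i) (spec n xv i) v)) = ?d (node_op (nxt n i) i (inverse (spec n xv i)) v')"
      unfolding K_total_node_op[OF n2 f i] v'(3) by (rule sites_op_last_embed[OF n2 i])
    then show ?thesis
      unfolding N_def
      using node_op_vspace[OF i nxt_in[OF i] nn[symmetric] v'(1)] node_op_vspace[OF nxt_in[OF i] i nn v'(2)] by blast
  qed
  have i1: "1 \<in> {1..n}" "2 \<in> {1..n}" and nx1: "nxt n 1 = 2" and sp1: "spec n xv 1 = 1"
    using n by (auto simp: nxt_def spec_def)
  define w where "w = node_basis 1 2 1"
  \<comment> \<open>All s units at site 2: its string for node 1 has the extremal factor k = s, for
    which the eigenvectors of the target are known to be symmetric.\<close>
  define a0 :: comp where "a0 = (\<lambda>l. if l = 2 then s else 0)"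
  define a1 where "a1 = node_swap 1 2 a0"
  have a0: "a0 \<in> ?C" using i1 by (auto simp: a0_def comps_def sum.delta)
  have ka: "node_k 1 2 a0 = s" by (simp add: node_k_def a0_def)
  have sw: "node_swap 1 2 a1 = a0" "node_k 1 2 a1 = s"
    unfolding a1_def using node_swap_swap[of 1 2 a0] ka s by simp_all
  have a1: "a1 \<in> ?C" unfolding a1_def by (rule node_swap_comps[OF i1 _ a0]) simp
  have Bw: "node_op 1 2 1 (w a0) = (\<lambda>c. qint s * w a1 c)" "node_op 1 2 1 (w a1) = (\<lambda>c. qint s * w a0 c)"
    unfolding w_def using node_op_basis[of 1 2 1 a0] node_op_basis[of 1 2 1 a1] ka sw
    by (simp_all add: a1_def)
  have L: "lattice_basis ?C (\<lambda>a. residue 1 ^ a 1) w"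
    unfolding w_def by (rule lattice_basis_node[OF i1]) simp_all
  \<comment> \<open>B_1 exchanges w a0 and w a1 with factor [s], so this combination has eigenvalue
    \<epsilon> [s], and its image is symmetric by \<open>flat_op_eigen_top\<close>.\<close>
  have ev: "(\<lambda>x. w a0 x + \<epsilon> * w a1 x) \<in> N" if \<epsilon>: "\<epsilon> * \<epsilon> = 1" for \<epsilon>
  proof -
    define y where "y = (\<lambda>x. w a0 x + \<epsilon> * w a1 x)"
    have yv: "y \<in> vspace ?C"
      using lattice_basisD(2)[OF L a0] lattice_basisD(2)[OF L a1] by (simp add: y_def vspace_def)
    have "node_op 1 2 1 y = (\<lambda>x. node_op 1 2 1 (w a0) x + \<epsilon> * node_op 1 2 1 (w a1) x)"
      unfolding y_def lin_op_add[OF lin_op_node_op, of _ _ _ "w a0"] lin_op_smult[OF lin_op_node_op, of _ _ _ \<epsilon>] ..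
    also have "\<dots> = (\<lambda>x. \<epsilon> * qint s * y x)"
    proof
      fix x
      have "qint s * w a1 x + \<epsilon> * (qint s * w a0 x) = (\<epsilon> * \<epsilon>) * qint s * w a1 x + \<epsilon> * qint s * w a0 x"
        unfolding \<epsilon> by simp
      then show "node_op 1 2 1 (w a0) x + \<epsilon> * node_op 1 2 1 (w a1) x = \<epsilon> * qint s * y x"
        unfolding Bw y_def by (simp add: algebra_simps)
    qed
    finally have By: "node_op 1 (nxt n 1) (spec n xv 1) y = (\<lambda>x. \<epsilon> * qint s * y x)" unfolding nx1 sp1 .
    have fv: "f (?e y) \<in> vspace (words n s)" using f sym_embed_vspace unfolding site_map_def by blast
    have eig: "sites_op n 1 (stage_sites s s) (f (?e y)) = (\<lambda>w. \<epsilon> * qint s * f (?e y) w)"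
      unfolding K_total_node_op[OF n2 f i1(1), symmetric] By
        lin_op_smult[OF lin_op_sym_embed, of _ _ _ "\<epsilon> * qint s"] lin_op_smult[OF lf, of "\<epsilon> * qint s"] ..
    \<comment> \<open>On the dual side node 1 has j = 2 and j' = 1. These are adjacent in the
      reversed order n - c, so \<open>flat_op_eigen_top\<close> applies with t = 0.\<close>
    have j21: "2 \<in> {1..n}" "1 \<in> {1..n}" "(2::nat) \<noteq> 1" using i1 by simp_all
    have "flat_op 2 1 (f (?e y)) = (\<lambda>w. \<epsilon> * qint s * f (?e y) w)"
    proof -
      have af: "is_affine n 1 = 0" using n by (simp add: is_affine_def)
      have "site_B 2 1 0 s (inverse 1) = (\<lambda>_. letter_B 2 1 1)" by (simp add: site_B_def fun_eq_iff)
      then show ?thesis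
        using eig sites_op_last[OF n2 i1(1) fv]
        unfolding nx1 sp1 af flat_op_def[OF j21 \<epsilon>] by simp
    qed
    moreover have "node_order (\<lambda>c. n - c) n 2 1 0"
      using node_order_rev[OF n2 i1(1)] n unfolding nx1 by (simp add: is_affine_def)
    ultimately obtain t where "f (?e y) = ?d (\<lambda>a. t * top_vec 2 1 \<epsilon> a)"
      using flat_op_eigen_top[OF j21 \<epsilon> _ fv] by blast
    then have "f (?e y) = ?d (\<lambda>a. if a \<in> ?C then t * top_vec 2 1 \<epsilon> a else 0)"
      by (simp only: sym_embed_restrict[of _ _ _ "\<lambda>a. t * top_vec 2 1 \<epsilon> a"])
    moreover have "(\<lambda>a. if a \<in> ?C then t * top_vec 2 1 \<epsilon> a else 0) \<in> vspace ?C" by (simp add: vspace_def)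
    ultimately show ?thesis using yv unfolding N_def y_def by blast
  qed
  \<comment> \<open>Adding the vectors for \<epsilon> = 1 and \<epsilon> = -1 isolates 2 w a0, whose
    reduction is nonzero since 2 is invertible.\<close>
  have "(\<lambda>x. 1 * (w a0 x + 1 * w a1 x) + (w a0 x + (- 1) * w a1 x)) \<in> N"
    using N ev[of 1] ev[of "- 1"] unfolding subspace_of_def by fastforce
  then have two: "(\<lambda>x. w a0 x + w a0 x) \<in> N" by (simp add: algebra_simps)
  have r0: "reaches ?C N a0"
    unfolding reaches_def
  proof (intro bexI[OF _ two] exI[of _ "1 + 1"] conjI ballI)
    show "(1::Cx) + 1 \<noteq> 0" by (rule Cx_two_nonzero)
    fix b assume b: "b \<in> ?C"
    note A = lattice_basisD(4)[OF L a0 b]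
    show "w a0 b + w a0 b \<in> Ax" using A A by (rule Ax_add)
    show "residue (w a0 b + w a0 b) = (if b = a0 then 1 + 1 else 0)"
      unfolding residue_add lattice_basisD(5)[OF L a0 b] by simp
  qed
  have "reaches ?C N a" if "a \<in> ?C" for a
  proof (rule swap_connected[where P = "reaches ?C N", OF n _ a0 that r0])
    fix a i assume a: "a \<in> ?C" and i: "i \<in> {1..n}" and k: "node_k i (nxt n i) a \<noteq> 0" and r: "reaches ?C N a"
    have nn: "nxt n i \<noteq> i" using n2 by (rule nxt_neq)
    have res: "residue (spec n xv i) \<noteq> 0" using x0_nonzero by (simp add: spec_xv_residue)
    show "reaches ?C N (node_swap i (nxt n i) a)"
      by (rule reaches_swap[OF lin_op_node_op
            lattice_basis_node[OF i nxt_in[OF i] nn[symmetric] spec_xv_residue(1) res]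
            eigen_swap_node[OF i nxt_in[OF i] nn[symmetric] spec_nonzero[OF xv_nonzero]] N NB[OF i] a k r])
  qed
  then have N_all: "N = vspace ?C" by (rule reaches_all[OF finite_comps N])
  have "\<exists>v'. v' \<in> vspace ?C \<and> f (?e (bvec a)) = ?d v'" if "a \<in> ?C" for a
  proof -
    have "bvec a \<in> N" unfolding N_all by (rule bvec_vspace[OF that])
    then show ?thesis unfolding N_def by blast
  qed
  then obtain M where M: "\<forall>a\<in>?C. M a \<in> vspace ?C \<and> f (?e (bvec a)) = ?d (M a)"
    using bchoice[of ?C "\<lambda>a v'. v' \<in> vspace ?C \<and> f (?e (bvec a)) = ?d v'"] by blast
  have "quantum_K_matrix n s M"
    unfolding quantum_K_matrix_def
  proof (intro exI conjI ballI)
    fix a assume a: "a \<in> ?C"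
    show "M a \<in> vspace ?C" using M a by blast
    have "emb n s a = ?e (bvec a)" unfolding lin_emb[symmetric] lin_bvec[OF finite_comps a] ..
    then show "K_total n s R K (emb n s a) = lin ?C (embd n s) (M a)"
      unfolding lin_embd f_def[symmetric] using M a by simp
  qed (rule RC KC)+
  then show ?thesis by blast
qed

section \<open>The combinatorial K-matrix\<close>

lemma crystal_bij:
  assumes n: "1 \<le> n"
    and K: "\<And>d a. a \<in> comps n s \<Longrightarrow> Kbar (xb d a) = xb (d + int (Istat a)) (prim n a)"
  shows "bij_betw Kbar (crystal n s) (crystal n s)"
proof (rule bij_betwI')
  fix x y assume "x \<in> crystal n s" "y \<in> crystal n s"
  then obtain d a e b where x: "x = xb d a" "a \<in> comps n s" and y: "y = xb e b" "b \<in> comps n s"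
    unfolding crystal_def by blast
  have "prim n a = prim n b \<longleftrightarrow> a = b" using prim_inj x(2) y(2) by (metis inj_on_eq_iff)
  then show "Kbar x = Kbar y \<longleftrightarrow> x = y"
    unfolding x(1) y(1) K[OF x(2)] K[OF y(2)] xb_inject by auto
next
  fix x assume "x \<in> crystal n s"
  then obtain d a where x: "x = xb d a" "a \<in> comps n s" unfolding crystal_def by blast
  show "Kbar x \<in> crystal n s"
    unfolding x(1) K[OF x(2)] crystal_def using prim_comps[OF n x(2)] by blast
next
  fix y assume "y \<in> crystal n s"
  then obtain e b where y: "y = xb e b" "b \<in> comps n s" unfolding crystal_def by blast
  obtain a where a: "a \<in> comps n s" "b = prim n a"
    using prim_bij[OF n, of s] y(2) unfolding bij_betw_def by blast
  have "y = Kbar (xb (e - int (Istat a)) a)" unfolding K[OF a(1)] y(1) a(2) by simp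
  then show "\<exists>x\<in>crystal n s. y = Kbar x" using a(1) unfolding crystal_def by blast
qed

theorem proposition10:
  fixes n s :: nat
  assumes "n \<ge> 3" and "s \<ge> 1"
  shows "combinatorial_K_matrix n s (calK n s)"
  unfolding combinatorial_K_matrix_def
proof (intro conjI allI impI)
  show "\<exists>M. quantum_K_matrix n s M" by (rule quantum_K_matrix_exists[OF assms])
next
  fix M assume M: "quantum_K_matrix n s M"
  let ?C = "comps n s"
  have n: "2 \<le> n" "1 \<le> n" using assms(1) by simp_all
  note IM = quantum_K_matrix_intertwines[OF n(1) M]
  have Mv: "M a \<in> vspace ?C" if "a \<in> ?C" for a using IM(1) that unfolding intertwines_nodes_def by blast
  have top: "top_comp s \<in> ?C" by (rule top_comp_in[OF n(2)])
  obtain b0 where b0: "b0 \<in> ?C" "M (top_comp s) b0 \<noteq> 0" using IM(2)[OF top] by blast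
  \<comment> \<open>One power of q serves all matrix entries simultaneously; a nonzero entry to
    start from exists because the composite is injective.\<close>
  obtain t where t: "\<And>p. p \<in> ?C \<times> ?C \<Longrightarrow> qv powi t * (case p of (a, b) \<Rightarrow> M a b) \<in> Ax"
    "\<exists>p\<in>?C \<times> ?C. residue (qv powi t * (case p of (a, b) \<Rightarrow> M a b)) \<noteq> 0"
  proof (rule normalise_family[of "?C \<times> ?C" "(top_comp s, b0)" "\<lambda>(a, b). M a b"])
  qed (use finite_comps top b0 in auto)
  define M' where "M' a = (\<lambda>b. qv powi t * M a b)" for a
  have lM': "lin ?C M' v = (\<lambda>x. qv powi t * lin ?C M v x)" for v
    by (simp add: lin_def M'_def sum_distrib_left mult_ac)
  have I': "intertwines_nodes n s M'"
    unfolding intertwines_nodes_def lM'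
  proof (intro conjI ballI)
    show "M' a \<in> vspace ?C" if "a \<in> ?C" for a using Mv[OF that] by (simp add: M'_def vspace_def)
    fix i v assume "i \<in> {1..n}" "v \<in> vspace ?C"
    then show "(\<lambda>x. qv powi t * lin ?C M (node_op i (nxt n i) (spec n xv i) v) x)
       = node_op (nxt n i) i (inverse (spec n xv i)) (\<lambda>x. qv powi t * lin ?C M v x)"
      using IM(1) unfolding intertwines_nodes_def lin_op_smult[OF lin_op_node_op, of _ _ _ "qv powi t"] by simp
  qed
  have A': "M' a b \<in> Ax" if "a \<in> ?C" "b \<in> ?C" for a b using t(1)[of "(a, b)"] that by (simp add: M'_def)
  obtain c where c: "\<And>a b. a \<in> ?C \<Longrightarrow> b \<in> ?C \<Longrightarrow> residue (M' a b) = (if b = prim n a then c * x0 ^ Istat a else 0)"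
    using intertwiner_limit[OF assms(1) I' A'] by blast
  obtain a b where ab: "a \<in> ?C" "b \<in> ?C" "residue (M' a b) \<noteq> 0" using t(2) by (auto simp: M'_def)
  have c0: "c \<noteq> 0" using c[OF ab(1,2)] ab(3) by (auto split: if_splits)
  \<comment> \<open>The limit after rescaling by q^t is c times the stated map, with c in
    \<complex>(x); the inverse of c completes the normalisation.\<close>
  define k where "k = cst (inverse c) * qv powi t"
  have k0: "k \<noteq> 0"
  proof -
    have "residue (cst (inverse c)) \<noteq> 0" using c0 by simp
    then have "cst (inverse c) \<noteq> 0" by (metis residue_0)
    then show ?thesis by (simp add: k_def)
  qed
  have kM: "k * M a b = cst (inverse c) * M' a b" for a b by (simp add: k_def M'_def mult.assoc)
  have kA: "k * M a b \<in> Ax" "residue (k * M a b) = (if b = prim n a then x0 ^ Istat a else 0)"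
    if "a \<in> ?C" "b \<in> ?C" for a b
    unfolding kM using A'[OF that] c[OF that] c0 by (auto simp: residue_mult)
  \<comment> \<open>The induced map is the matrix of residues, extended to all functions on
    compositions and set to 0 outside \<open>comps n s\<close>, where reductions of lattice vectors
    vanish.\<close>
  define Kbar where "Kbar \<phi> = (\<lambda>b. if b \<in> ?C then \<Sum>a\<in>?C. \<phi> a * residue (k * M a b) else 0)" for \<phi>
  have Kxb: "Kbar (xb d a) = xb (d + int (Istat a)) (prim n a)" if a: "a \<in> ?C" for d a
  proof
    fix b
    show "Kbar (xb d a) b = xb (d + int (Istat a)) (prim n a) b"
    proof (cases "b \<in> ?C")
      case False
      then have "b \<noteq> prim n a" using prim_comps[OF n(2) a] by blast
      then show ?thesis using False by (simp add: Kbar_def xb_def bvec_def)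
    next
      case True
      have "Kbar (xb d a) b = (\<Sum>a'\<in>?C. if a' = a then x0 powi d * residue (k * M a b) else 0)"
        unfolding Kbar_def xb_def bvec_def using True by (auto intro!: sum.cong)
      also have "\<dots> = x0 powi d * residue (k * M a b)" using a finite_comps by simp
      finally show ?thesis
        using kA(2)[OF a True] x0_nonzero by (simp add: xb_def bvec_def power_int_add)
    qed
  qed
  have ind: "induces n s (\<lambda>v \<alpha>. k * lin ?C M v \<alpha>) Kbar"
    unfolding induces_def
  proof (intro ballI conjI)
    fix v assume v: "v \<in> lattice n s"
    have vA: "v a \<in> Ax" if "a \<in> ?C" for a using v that by (simp add: lattice_def)
    have e: "k * lin ?C M v b = (\<Sum>a\<in>?C. v a * (k * M a b))" for b
      by (simp add: lin_def sum_distrib_left mult_ac)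
    have vs: "lin ?C M v \<in> vspace ?C" by (rule lin_vspace[OF Mv])
    show "(\<lambda>\<alpha>. k * lin ?C M v \<alpha>) \<in> lattice n s"
      unfolding lattice_def
    proof (intro CollectI conjI ballI)
      show "(\<lambda>\<alpha>. k * lin ?C M v \<alpha>) \<in> vspace ?C" using vs by (simp add: vspace_def)
      show "k * lin ?C M v b \<in> Ax" if "b \<in> ?C" for b unfolding e using vA kA(1) that by auto
    qed
    show "Kbar (reduce v) = reduce (\<lambda>\<alpha>. k * lin ?C M v \<alpha>)"
    proof
      fix b
      show "Kbar (reduce v) b = reduce (\<lambda>\<alpha>. k * lin ?C M v \<alpha>) b"
      proof (cases "b \<in> ?C")
        case True
        then show ?thesis
          unfolding Kbar_def reduce_def e residue_sum
          using vA kA(1)[OF _ True] by (auto simp: residue_mult intro!: sum.cong)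
      next
        case False
        then show ?thesis using vs by (simp add: Kbar_def reduce_def vspace_def)
      qed
    qed
  qed
  have nz: "\<exists>v\<in>lattice n s. Kbar (reduce v) \<noteq> (\<lambda>_. 0)"
  proof (intro bexI[of _ "bvec (top_comp s)"])
    have "reduce (bvec (top_comp s)) = xb 0 (top_comp s)"
      by (auto simp: reduce_def bvec_def xb_def)
    then have "Kbar (reduce (bvec (top_comp s))) (prim n (top_comp s)) \<noteq> 0"
      using Kxb[OF top, of 0] x0_nonzero by (simp add: xb_def bvec_def)
    then show "Kbar (reduce (bvec (top_comp s))) \<noteq> (\<lambda>_. 0)" by metis
    show "bvec (top_comp s) \<in> lattice n s"
      using bvec_vspace[OF top] by (auto simp: lattice_def bvec_def)
  qed
  have "\<forall>b\<in>crystal n s. calK n s b = Kbar b"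
    unfolding crystal_def using Kxb calK_xb by force
  then show "\<exists>c Kbar. c \<noteq> 0 \<and> induces n s (\<lambda>v \<alpha>. c * lin ?C M v \<alpha>) Kbar \<and>
      (\<exists>v\<in>lattice n s. Kbar (reduce v) \<noteq> (\<lambda>_. 0)) \<and>
      bij_betw Kbar (crystal n s) (crystal n s) \<and> (\<forall>b\<in>crystal n s. calK n s b = Kbar b)"
    using k0 ind nz crystal_bij[OF n(2) Kxb] by blast
qed

end
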